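(* Assume that $\max_{i\in\{1,\dots,n-1\}}(s_{i+1}-s_i)\to0$ as $n\to\infty$ and that $K<+\infty$. Let $0<a\le b<+\infty$ and $0<c\le d<+\infty$ be fixed. (1) Let either $J=[a,b]\times[c,d]$ with $ad\le\theta_0\sigma_0^2$ and $bc\ge\theta_0\sigma_0^2$, or $J=(0,\infty)\times[c,d]$, and assume that there exists $(\tilde\theta,\tilde\sigma^2)\in J$ such that $\tilde\theta\tilde\sigma^2=\theta_0\sigma_0^2$. Then, as $n\to\infty$, $$\frac{\sqrt n\,\left(\sum_{k=1}^Kw_k\right)}{\tau_n\sigma_0^2\theta_0}\left(\hat\sigma^2_{p\ell}\hat\theta_{p\ell}-\sigma_0^2\theta_0\right)\xrightarrow{\ \mathcal D\ }\mathcal N(0,1).$$ (2) Let $J=[a,b]\times[c,d]$ or $J=[a,b]\times(0,\infty)$ or $J=(0,\infty)\times[c,d]$, and assume that there exists $(\tilde\theta,\tilde\sigma^2)\in J$ such that $\tilde\theta\tilde\sigma^2=\theta_0\sigma_0^2$. Then, as $n\to\infty$, $$\frac{\sqrt n\,\left(\sum_{k=1}^Kw_k\right)}{\tau_n\sigma_0^2\theta_0}\left(\hat\sigma^2_{pc\ell}\hat\theta_{pc\ell}-\sigma_0^2\theta_0\right)\xrightarrow{\ \mathcal D\ }\mathcal N(0,1).$$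
   Context: $Z=\{Z(s),s\in[0,1]\}$ is a stationary zero-mean Gaussian process (the stationary Ornstein-Uhlenbeck process, with almost surely continuous sample paths) with covariance $\mathrm{cov}\{Z(s),Z(t)\}=\sigma_0^2e^{-\theta_0|s-t|}$, for fixed (true) $\theta_0,\sigma_0^2\in(0,\infty)$. For each $n$, the observation points are $s_1<\dots<s_n$ in $[0,1]$, where $s_i=s_i^{(n)}$ is a (deterministic) triangular array; the observations are $Z(s_1),\dots,Z(s_n)$. Weights: $(w_k)_{k\ge1}$ is a fixed sequence of non-negative numbers, not all zero (not depending on $n$), and $K=\max\{k\ge 1: w_k\ne0\}$ (with $K=+\infty$ if infinitely many $w_k$ are non-zero). For $\psi=(\theta,\sigma^2)^\top\in(0,\infty)^2$ and $s\ne t\in[0,1]$ let $$\ell_{t|s}(\psi)=\ln(\sigma^2)+\ln(1-e^{-2\theta|s-t|})+\frac{\{Z(t)-e^{-\theta|s-t|}Z(s)\}^2}{\sigma^2(1-e^{-2\theta|s-t|})},\qquad \ell_{s,t}(\psi)=\ln(\sigma^2)+\frac{1}{\sigma^2}Z(s)^2+\ell_{t|s}(\psi).$$ Define $$p\ell_n(\psi)=\sum_{i=1}^{n-1}\sum_{j=i+1}^n w_{j-i}\,\ell_{s_i,s_j}(\psi),\qquad pc\ell_n(\psi)=\sum_{i=1}^{n}\sum_{j=1,\,j\ne i}^n w_{|i-j|}\,\ell_{s_j|s_i}(\psi).$$ For $J\subset(0,\infty)^2$, $(\hat\theta_{p\ell},\hat\sigma^2_{p\ell})^\top=\mathrm{argmin}_{\psi\in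 J}\,p\ell_n(\psi)$ (weighted pairwise maximum likelihood estimator) and $(\hat\theta_{pc\ell},\hat\sigma^2_{pc\ell})^\top=\mathrm{argmin}_{\psi\in J}\,pc\ell_n(\psi)$ (weighted pairwise conditional maximum likelihood estimator), i.e. minimizers over $J$. For $i,k\ge1$ with $i+k\le n$, $$W^2_{i,i+k}=\frac{\{Z(s_{i+k})-e^{-\theta_0(s_{i+k}-s_i)}Z(s_i)\}^2}{\sigma_0^2(1-e^{-2\theta_0(s_{i+k}-s_i)})},\qquad \tau_n^2=\frac1n\,\mathrm{var}\left\{\sum_{i=1}^{n-1}\sum_{k=1}^{\min\{K,n-i\}}w_k\left(W^2_{i,i+k}-1\right)\right\},$$ and $\tau_n=\sqrt{\tau_n^2}$. $\xrightarrow{\mathcal D}$ denotes convergence in distribution.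
   Formalization: For J=[a,b]×[c,d] the inequalities are strict: ad<θ₀σ₀²<bc in (1) and ac<θ₀σ₀²<bd in (2); at equality the claim fails (e.g. a=b=θ₀, c=d=σ₀² makes the statistic identically 0). *)

theory Defs
  imports "HOL-Probability.Probability"
begin

text \<open>Parameters are pairs \<open>\<psi> = (\<theta>, v)\<close>, where \<open>v\<close> stands for the variance \<open>\<sigma>\<^sup>2\<close>; \<open>v\<^sub>0\<close> is the
  true variance. The process is \<open>Z t \<omega>\<close>, and \<open>z = (\<lambda>t. Z t \<omega>)\<close> is a sample path.\<close>

text \<open>Degenerate (almost surely constant) normal variables are included.\<close>

definition normal_rv :: "'a measure \<Rightarrow> ('a \<Rightarrow> real) \<Rightarrow> bool" where
  "normal_rv M X \<longleftrightarrow> X \<in> borel_measurable M \<and>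
     ((\<exists>\<mu>. AE \<omega> in M. X \<omega> = \<mu>) \<or>
      (\<exists>\<mu> \<sigma>. 0 < \<sigma> \<and> distributed M lborel X (\<lambda>x. ennreal (normal_density \<mu> \<sigma> x))))"

definition gaussian_process :: "'a measure \<Rightarrow> 'i set \<Rightarrow> ('i \<Rightarrow> 'a \<Rightarrow> real) \<Rightarrow> bool" where
  "gaussian_process M T Z \<longleftrightarrow>
     (\<forall>F c. finite F \<longrightarrow> F \<subseteq> T \<longrightarrow> normal_rv M (\<lambda>\<omega>. \<Sum>t\<in>F. c t * Z t \<omega>))"

definition variance_of :: "'a measure \<Rightarrow> ('a \<Rightarrow> real) \<Rightarrow> real" where
  "variance_of M X = (\<integral>\<omega>. (X \<omega> - (\<integral>\<eta>. X \<eta> \<partial>M))\<^sup>2 \<partial>M)"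

definition covariance_of :: "'a measure \<Rightarrow> ('a \<Rightarrow> real) \<Rightarrow> ('a \<Rightarrow> real) \<Rightarrow> real" where
  "covariance_of M X Y =
     (\<integral>\<omega>. (X \<omega> - (\<integral>\<eta>. X \<eta> \<partial>M)) * (Y \<omega> - (\<integral>\<eta>. Y \<eta> \<partial>M)) \<partial>M)"

definition OU_process :: "'a measure \<Rightarrow> real \<Rightarrow> real \<Rightarrow> (real \<Rightarrow> 'a \<Rightarrow> real) \<Rightarrow> bool" where
  "OU_process M \<theta>\<^sub>0 v\<^sub>0 Z \<longleftrightarrow>
     prob_space M \<and>
     gaussian_process M {0..1} Z \<and>
     (\<forall>t\<in>{0..1}. (\<integral>\<omega>. Z t \<omega> \<partial>M) = 0) \<and>
     (\<forall>s\<in>{0..1}. \<forall>t\<in>{0..1}. covariance_of M (Z s) (Z t) = v\<^sub>0 * exp (- \<theta>\<^sub>0 * \<bar>s - t\<bar>)) \<and>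
     (AE \<omega> in M. continuous_on {0..1} (\<lambda>t. Z t \<omega>))"

text \<open>\<open>cond_loss z t s\<close> is \<open>\<ell>\<close> for \<open>t\<close> given \<open>s\<close>.\<close>

definition cond_loss :: "(real \<Rightarrow> real) \<Rightarrow> real \<Rightarrow> real \<Rightarrow> real \<times> real \<Rightarrow> real" where
  "cond_loss z t s = (\<lambda>(\<theta>, v).
     ln v + ln (1 - exp (- 2 * \<theta> * \<bar>s - t\<bar>)) +
     (z t - exp (- \<theta> * \<bar>s - t\<bar>) * z s)\<^sup>2 / (v * (1 - exp (- 2 * \<theta> * \<bar>s - t\<bar>))))"

definition pair_loss :: "(real \<Rightarrow> real) \<Rightarrow> real \<Rightarrow> real \<Rightarrow> real \<times> real \<Rightarrow> real" where
  "pair_loss z s t = (\<lambda>(\<theta>, v). ln v + (1 / v) * (z s)\<^sup>2 + cond_loss z t s (\<theta>, v))"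

text \<open>Below, \<open>s 1 < \<dots> < s n\<close> are the observation points for one fixed \<open>n\<close>;
  the values \<open>w 0\<close> and \<open>s 0\<close> are never used.\<close>

definition pl :: "(nat \<Rightarrow> real) \<Rightarrow> nat \<Rightarrow> (nat \<Rightarrow> real) \<Rightarrow> (real \<Rightarrow> real) \<Rightarrow> real \<times> real \<Rightarrow> real" where
  "pl w n s z \<psi> = (\<Sum>i=1..n-1. \<Sum>j=i+1..n. w (j - i) * pair_loss z (s i) (s j) \<psi>)"

definition pcl :: "(nat \<Rightarrow> real) \<Rightarrow> nat \<Rightarrow> (nat \<Rightarrow> real) \<Rightarrow> (real \<Rightarrow> real) \<Rightarrow> real \<times> real \<Rightarrow> real" where
  "pcl w n s z \<psi> =
     (\<Sum>i=1..n. \<Sum>j\<in>{1..n} - {i}. w (nat \<bar>int i - int j\<bar>) * cond_loss z (s j) (s i) \<psi>)"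

text \<open>A measurable choice from the argmin set over \<open>J\<close>, almost surely wherever that set is
  nonempty. Existence of a minimizer for every \<open>\<omega>\<close> and \<open>n\<close> cannot be assumed: for
  \<open>J = {0<..} \<times> {c..d}\<close> the infimum may be approached only as \<open>\<theta> \<rightarrow> \<infinity>\<close>, with positive
  probability for fixed \<open>n\<close>. Nothing is required of the values where no minimizer exists.\<close>

definition argmin_estimator ::
  "'a measure \<Rightarrow> (real \<times> real) set \<Rightarrow> ('a \<Rightarrow> real \<times> real \<Rightarrow> real) \<Rightarrow> ('a \<Rightarrow> real \<times> real) \<Rightarrow> bool" where
  "argmin_estimator M J L \<psi>h \<longleftrightarrow>
     \<psi>h \<in> borel_measurable M \<and>
     (AE \<omega> in M. (\<exists>\<psi>. is_arg_min (L \<omega>) (\<lambda>\<psi>. \<psi> \<in> J) \<psi>) \<longrightarrow>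
                 is_arg_min (L \<omega>) (\<lambda>\<psi>. \<psi> \<in> J) (\<psi>h \<omega>))"

text \<open>\<open>W_sq \<theta>\<^sub>0 v\<^sub>0 z s t\<close> is \<open>W\<^sup>2\<close> for the ordered pair of points \<open>s < t\<close>.\<close>

definition W_sq :: "real \<Rightarrow> real \<Rightarrow> (real \<Rightarrow> real) \<Rightarrow> real \<Rightarrow> real \<Rightarrow> real" where
  "W_sq \<theta>\<^sub>0 v\<^sub>0 z s t =
     (z t - exp (- \<theta>\<^sub>0 * (t - s)) * z s)\<^sup>2 / (v\<^sub>0 * (1 - exp (- 2 * \<theta>\<^sub>0 * (t - s))))"

definition tau_sq :: "'a measure \<Rightarrow> real \<Rightarrow> real \<Rightarrow> (real \<Rightarrow> 'a \<Rightarrow> real) \<Rightarrow> (nat \<Rightarrow> real) \<Rightarrow> nat \<Rightarrow>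
    nat \<Rightarrow> (nat \<Rightarrow> real) \<Rightarrow> real" where
  "tau_sq M \<theta>\<^sub>0 v\<^sub>0 Z w K n s =
     (1 / real n) * variance_of M (\<lambda>\<omega>.
       \<Sum>i=1..n-1. \<Sum>k=1..min K (n - i). w k * (W_sq \<theta>\<^sub>0 v\<^sub>0 (\<lambda>t. Z t \<omega>) (s i) (s (i + k)) - 1))"

definition tau :: "'a measure \<Rightarrow> real \<Rightarrow> real \<Rightarrow> (real \<Rightarrow> 'a \<Rightarrow> real) \<Rightarrow> (nat \<Rightarrow> real) \<Rightarrow> nat \<Rightarrow>
    nat \<Rightarrow> (nat \<Rightarrow> real) \<Rightarrow> real" where
  "tau M \<theta>\<^sub>0 v\<^sub>0 Z w K n s = sqrt (tau_sq M \<theta>\<^sub>0 v\<^sub>0 Z w K n s)"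

definition converges_in_dist_std_normal :: "'a measure \<Rightarrow> (nat \<Rightarrow> 'a \<Rightarrow> real) \<Rightarrow> bool" where
  "converges_in_dist_std_normal M X \<longleftrightarrow>
     weak_conv_m (\<lambda>n. distr M borel (X n)) std_normal_distribution"

end

theory Submission
  imports Defs "HOL-Real_Asymp.Real_Asymp"
begin

text \<open>With \<open>x = \<theta>\<Delta>\<close> for a pair of observations at distance \<open>\<Delta>\<close>, increment \<open>D\<close> and sum of squares \<open>B\<close>,
  \<open>(z\<^sub>t - exp (- x) z\<^sub>s)\<^sup>2 / (1 - exp (- 2x)) = D\<^sup>2 / (2 sinh x) + (z\<^sub>t\<^sup>2 - z\<^sub>s\<^sup>2) / 2 + tanh (x / 2) B / 2\<close>.
  The middle term telescopes along the observations. Hence both contrasts depend on \<open>\<theta>\<close> through one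
  and the same function, their difference (up to a factor 2) being a function of \<open>\<sigma>\<^sup>2\<close> alone, and first-order
  conditions in either coordinate (one-sided at the boundary of \<open>J\<close>) pin the product \<open>\<theta>\<sigma>\<^sup>2\<close> of any
  minimizer to the weighted mean of \<open>D\<^sup>2 / (2\<Delta>)\<close> up to \<open>O(1/n)\<close> in probability. By the same identity at
  \<open>\<theta>\<^sub>0\<close> this mean is \<open>\<theta>\<^sub>0\<sigma>\<^sub>0\<^sup>2\<close> times the weighted mean of \<open>W\<^sup>2\<close>, again up to \<open>O(1/n)\<close>.
  The \<open>W\<^sup>2\<close> are functions of at most \<open>K\<close> consecutive independent innovations, so their weighted sum obeys a
  central limit theorem for \<open>K\<close>-dependent variables; its variance is at least of order \<open>n\<close> because
  \<open>cov (W\<^sup>2, W'\<^sup>2) = 2 cov (W, W')\<^sup>2 \<ge> 0\<close>.\<close>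

section \<open>Independence from characteristic functions\<close>

text \<open>A Gaussian process is given only through the laws of single linear combinations. Joint
  statements are therefore reduced to one dimension: independence of innovations follows from the
  product form of their joint characteristic function, one coordinate at a time, by a change of
  measure and Levy uniqueness on the line; mixed moments follow by polarization. The remainder is
  O(1/n) because for each lag k \<le> K the distances and the telescoping terms collapse to k
  boundary terms at either end, so they stay bounded in mean, whereas the total weight grows like n.
  Each W is standard normal whatever the spacing, so the moment bounds are uniform over the rows of
  the array. The estimator is controlled only where a minimizer exists, so the deterministic part
  has to supply existence as well as location; on unbounded parameter sets, comparison with explicit
  competitors restores compactness. All bounds are explicit for each n, and a threshold growing like
  n^(1/4) balances the probability of the exceptional event against the error outside it.\<close>

lemma (in prob_space) nonneg_factor_of_chf:
  fixes X g :: "'a \<Rightarrow> real"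
  assumes X[measurable]: "random_variable borel X" and g[measurable]: "random_variable borel g"
    and nonneg: "\<And>\<omega>. 0 \<le> g \<omega>" and bnd: "\<And>\<omega>. g \<omega> \<le> B"
    and chf: "\<And>t. (CLINT \<omega>|M. g \<omega> * iexp (t * X \<omega>)) = (CLINT \<omega>|M. g \<omega>) * char (distr M borel X) t"
    and A[measurable]: "A \<in> sets borel"
  shows "(\<integral>\<omega>. g \<omega> * indicator A (X \<omega>) \<partial>M) = expectation g * prob (X -` A \<inter> space M)"
proof -
  have int: "integrable M g"
    by (rule integrable_const_bound[where B=B]) (auto simp: nonneg bnd)
  define e where "e = expectation g"
  have e0: "e \<ge> 0" unfolding e_def by (simp add: nonneg integral_nonneg_AE)
  show ?thesis
  proof (cases "e = 0")
    case True
    then have "AE \<omega> in M. g \<omega> = 0"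
      using integral_nonneg_eq_0_iff_AE[OF int] nonneg unfolding e_def by auto
    then have "(\<integral>\<omega>. g \<omega> * indicator A (X \<omega>) \<partial>M) = (\<integral>\<omega>. 0 \<partial>M)"
      by (intro integral_cong_AE) auto
    with True show ?thesis unfolding e_def by simp
  next
    case False
    with e0 have e: "e > 0" by simp
    \<comment> \<open>Reweighting by \<open>g / e\<close> gives a probability measure. The
      factorization hypothesis says that \<open>X\<close> has the same characteristic function under
      it, hence the same law.\<close>
    define D where "D = density M (\<lambda>\<omega>. ennreal (g \<omega> / e))"
    have "emeasure D (space D) = (\<integral>\<^sup>+\<omega>. ennreal (g \<omega> / e) \<partial>M)"
      unfolding D_def by (subst emeasure_density) (auto intro!: nn_integral_cong)
    also have "\<dots> = ennreal (\<integral>\<omega>. g \<omega> / e \<partial>M)"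
      by (rule nn_integral_eq_integral) (use int e nonneg in auto)
    also have "\<dots> = 1" using e by (simp add: e_def)
    finally interpret D: prob_space D by (rule prob_spaceI)
    have XD: "X \<in> borel_measurable D" by (simp add: D_def)
    have "char (distr D borel X) t = char (distr M borel X) t" for t
    proof -
      have "char (distr D borel X) t = (CLINT \<omega>|D. iexp (t * X \<omega>))"
        unfolding char_def by (subst integral_distr) (auto simp: XD)
      also have "\<dots> = (CLINT \<omega>|M. (g \<omega> / e) *\<^sub>R iexp (t * X \<omega>))"
        unfolding D_def by (subst integral_density) (use e nonneg in auto)
      also have "\<dots> = (CLINT \<omega>|M. (g \<omega> * iexp (t * X \<omega>)) / e)"
        by (simp add: scaleR_conv_of_real)
      also have "\<dots> = (CLINT \<omega>|M. g \<omega> * iexp (t * X \<omega>)) / e"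
        by simp
      also have "\<dots> = char (distr M borel X) t"
        using e chf[of t] integral_complex_of_real[of M g] by (simp add: e_def)
      finally show ?thesis .
    qed
    then have eq: "distr D borel X = distr M borel X"
      by (intro Levy_uniqueness real_distribution_distr ext D.real_distribution_distr XD X)
    have "measure D (X -` A \<inter> space M) = measure (distr D borel X) A"
      by (subst measure_distr) (auto simp: XD D_def)
    also have "\<dots> = prob (X -` A \<inter> space M)" by (simp add: eq measure_distr)
    finally have 1: "measure D (X -` A \<inter> space M) = prob (X -` A \<inter> space M)" .
    have "emeasure D (X -` A \<inter> space M) = (\<integral>\<^sup>+\<omega>. ennreal (g \<omega> / e * indicator A (X \<omega>)) \<partial>M)"
      unfolding D_def using e nonneg
      by (subst emeasure_density) (auto intro!: nn_integral_cong split: split_indicator)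
    also have "\<dots> = ennreal (\<integral>\<omega>. g \<omega> / e * indicator A (X \<omega>) \<partial>M)"
      by (rule nn_integral_eq_integral,
          rule Bochner_Integration.integrable_bound[OF integrable_divide_zero[OF int, of e]])
         (use int e nonneg in \<open>auto split: split_indicator\<close>)
    finally have "measure D (X -` A \<inter> space M) = (\<integral>\<omega>. g \<omega> / e * indicator A (X \<omega>) \<partial>M)"
      using e nonneg by (auto simp: measure_def intro!: integral_nonneg_AE)
    also have "(\<lambda>\<omega>. g \<omega> / e * indicator A (X \<omega>)) = (\<lambda>\<omega>. g \<omega> * indicator A (X \<omega>) / e)"
      by (simp add: fun_eq_iff)
    also have "(\<integral>\<omega>. g \<omega> * indicator A (X \<omega>) / e \<partial>M) = (\<integral>\<omega>. g \<omega> * indicator A (X \<omega>) \<partial>M) / e"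
      by simp
    finally show ?thesis using 1 e by (simp add: e_def field_simps)
  qed
qed

text \<open>Adding the bound \<open>B\<close> makes \<open>g\<close> nonnegative, and the constant
  \<open>B\<close> factors trivially, so the nonnegative case applies to \<open>g + B\<close> and
  \<open>B\<close> is subtracted again.\<close>

lemma (in prob_space) real_factor_of_chf:
  fixes X g :: "'a \<Rightarrow> real"
  assumes X[measurable]: "random_variable borel X" and g[measurable]: "random_variable borel g"
    and bnd: "\<And>\<omega>. \<bar>g \<omega>\<bar> \<le> B"
    and chf: "\<And>t. (CLINT \<omega>|M. g \<omega> * iexp (t * X \<omega>)) = (CLINT \<omega>|M. g \<omega>) * char (distr M borel X) t"
    and A[measurable]: "A \<in> sets borel"
  shows "(\<integral>\<omega>. g \<omega> * indicator A (X \<omega>) \<partial>M) = expectation g * prob (X -` A \<inter> space M)"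
proof -
  have ig: "integrable M g"
    by (rule integrable_const_bound[where B=B]) (auto simp: bnd)
  have ie: "integrable M (\<lambda>\<omega>. iexp (t * X \<omega>))" for t
    by (rule integrable_const_bound[where B=1]) auto
  have ige: "integrable M (\<lambda>\<omega>. g \<omega> * iexp (t * X \<omega>))" for t
    by (rule integrable_const_bound[where B=B]) (auto simp: norm_mult bnd)
  have iga: "integrable M (\<lambda>\<omega>. g \<omega> * indicator A (X \<omega>))"
    by (rule integrable_const_bound[where B=B]) (use bnd in \<open>auto split: split_indicator intro: order_trans[OF abs_ge_zero]\<close>)
  have ia: "integrable M (\<lambda>\<omega>. indicator A (X \<omega>) :: real)"
    by (rule integrable_const_bound[where B=1]) auto
  have pA: "(\<integral>\<omega>. indicator A (X \<omega>) \<partial>M) = prob (X -` A \<inter> space M)"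
  proof -
    have "(\<integral>\<omega>. indicator A (X \<omega>) \<partial>M) = (\<integral>\<omega>. (indicator (X -` A \<inter> space M) \<omega> :: real) \<partial>M)"
      by (intro Bochner_Integration.integral_cong) (auto split: split_indicator)
    then show ?thesis by simp
  qed
  have "(\<integral>\<omega>. (g \<omega> + B) * indicator A (X \<omega>) \<partial>M)
      = expectation (\<lambda>\<omega>. g \<omega> + B) * prob (X -` A \<inter> space M)"
  proof (rule nonneg_factor_of_chf[OF X, where B="2*B"])
    show "0 \<le> g \<omega> + B" "g \<omega> + B \<le> 2 * B" for \<omega> using bnd[of \<omega>] by auto
    show "(CLINT \<omega>|M. complex_of_real (g \<omega> + B) * iexp (t * X \<omega>))
      = (CLINT \<omega>|M. complex_of_real (g \<omega> + B)) * char (distr M borel X) t" for t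
    proof -
      have "(CLINT \<omega>|M. complex_of_real (g \<omega> + B) * iexp (t * X \<omega>))
        = (CLINT \<omega>|M. g \<omega> * iexp (t * X \<omega>)) + B * (CLINT \<omega>|M. iexp (t * X \<omega>))"
        using ige ie by (simp add: distrib_right)
      also have "(CLINT \<omega>|M. iexp (t * X \<omega>)) = char (distr M borel X) t"
        unfolding char_def by (subst integral_distr) auto
      finally show ?thesis
        using ig chf[of t] by (simp add: distrib_right prob_space)
    qed
  qed auto
  then show ?thesis
    using ig iga ia pA by (simp add: distrib_right prob_space)
qed

text \<open>Real and imaginary parts are combinations of \<open>g\<close> and its conjugate. The
  conjugate inherits the factorization, so both parts fall under the real case.\<close>

lemma (in prob_space) complex_factor_of_chf:
  fixes X :: "'a \<Rightarrow> real" and g :: "'a \<Rightarrow> complex"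
  assumes X[measurable]: "random_variable borel X" and g[measurable]: "random_variable borel g"
    and bnd: "\<And>\<omega>. norm (g \<omega>) \<le> B"
    and chf: "\<And>t. (CLINT \<omega>|M. g \<omega> * iexp (t * X \<omega>)) = (CLINT \<omega>|M. g \<omega>) * char (distr M borel X) t"
    and A[measurable]: "A \<in> sets borel"
  shows "(CLINT \<omega>|M. g \<omega> * indicator A (X \<omega>)) = (CLINT \<omega>|M. g \<omega>) * prob (X -` A \<inter> space M)"
proof -
  have ig: "integrable M g"
    by (rule integrable_const_bound[where B=B]) (auto simp: bnd)
  have ige: "integrable M (\<lambda>\<omega>. g \<omega> * iexp (t * X \<omega>))" for t
    by (rule integrable_const_bound[where B=B]) (auto simp: norm_mult bnd)
  have [measurable]: "random_variable borel (\<lambda>\<omega>. cnj (g \<omega>))"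
    by (rule measurable_compose[OF g]) (intro borel_measurable_continuous_onI continuous_intros)
  have igc: "integrable M (\<lambda>\<omega>. cnj (g \<omega>) * iexp (t * X \<omega>))" for t
    by (rule integrable_const_bound[where B=B]) (auto simp: norm_mult bnd)
  have iga: "integrable M (\<lambda>\<omega>. g \<omega> * indicator A (X \<omega>))"
    by (rule integrable_const_bound[where B=B])
       (use bnd in \<open>auto split: split_indicator intro: order_trans[OF norm_ge_zero]\<close>)
  \<comment> \<open>Conjugation reverses the frequency, so the hypothesis is used at
    \<open>- t\<close>.\<close>
  have cnj: "(CLINT \<omega>|M. cnj (g \<omega>) * iexp (t * X \<omega>)) = cnj (CLINT \<omega>|M. g \<omega>) * char (distr M borel X) t" for t
  proof -
    have "(CLINT \<omega>|M. cnj (g \<omega>) * iexp (t * X \<omega>)) = (CLINT \<omega>|M. cnj (g \<omega> * iexp (- t * X \<omega>)))"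
      by (simp add: exp_cnj)
    also have "\<dots> = cnj (CLINT \<omega>|M. g \<omega> * iexp (- t * X \<omega>))"
      by (rule Bochner_Integration.integral_cnj)
    also have "\<dots> = cnj (CLINT \<omega>|M. g \<omega>) * cnj (char (distr M borel X) (-t))"
      by (simp only: chf complex_cnj_mult)
    also have "cnj (char (distr M borel X) (-t)) = char (distr M borel X) t"
    proof -
      have "cnj (char (distr M borel X) (-t)) = (CLINT x|distr M borel X. cnj (iexp (- t * x)))"
        unfolding char_def by (rule Bochner_Integration.integral_cnj[symmetric])
      then show ?thesis unfolding char_def by (simp add: exp_cnj)
    qed
    finally show ?thesis .
  qed
  have Re: "complex_of_real (Re (g \<omega>)) = (g \<omega> + cnj (g \<omega>)) / 2" for \<omega>
    by (simp add: complex_eq_iff)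
  have Im: "complex_of_real (Im (g \<omega>)) = (g \<omega> - cnj (g \<omega>)) / (2 * \<i>)" for \<omega>
    by (auto simp: complex_eq_iff Re_divide Im_divide power2_eq_square)
  have 1: "(\<integral>\<omega>. Re (g \<omega>) * indicator A (X \<omega>) \<partial>M) = expectation (\<lambda>\<omega>. Re (g \<omega>)) * prob (X -` A \<inter> space M)"
  proof (rule real_factor_of_chf[OF X, where B=B])
    show "\<bar>Re (g \<omega>)\<bar> \<le> B" for \<omega> using abs_Re_le_cmod bnd order_trans by blast
    show "(CLINT \<omega>|M. complex_of_real (Re (g \<omega>)) * iexp (t * X \<omega>))
      = (CLINT \<omega>|M. complex_of_real (Re (g \<omega>))) * char (distr M borel X) t" for t
      unfolding Re using ig ige igc cnj chf by (simp add: distrib_right add_divide_distrib)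
  qed auto
  have 2: "(\<integral>\<omega>. Im (g \<omega>) * indicator A (X \<omega>) \<partial>M) = expectation (\<lambda>\<omega>. Im (g \<omega>)) * prob (X -` A \<inter> space M)"
  proof (rule real_factor_of_chf[OF X, where B=B])
    show "\<bar>Im (g \<omega>)\<bar> \<le> B" for \<omega> using abs_Im_le_cmod bnd order_trans by blast
    show "(CLINT \<omega>|M. complex_of_real (Im (g \<omega>)) * iexp (t * X \<omega>))
      = (CLINT \<omega>|M. complex_of_real (Im (g \<omega>))) * char (distr M borel X) t" for t
    proof -
      have "(g \<omega> - cnj (g \<omega>)) / (2 * \<i>) * iexp (t * X \<omega>) =
          (g \<omega> * iexp (t * X \<omega>) - cnj (g \<omega>) * iexp (t * X \<omega>)) / (2 * \<i>)" for \<omega>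
        by (simp only: left_diff_distrib times_divide_eq_left)
      then show ?thesis
        unfolding Im using ige[of t] igc[of t] cnj[of t] chf[of t] ig
        by (simp only: Bochner_Integration.integral_diff integral_divide_zero integrable_cnj
            Bochner_Integration.integral_cnj left_diff_distrib times_divide_eq_left)
    qed
  qed auto
  have ReA: "Re (g \<omega> * indicator A (X \<omega>)) = Re (g \<omega>) * indicator A (X \<omega>)"
    and ImA: "Im (g \<omega> * indicator A (X \<omega>)) = Im (g \<omega>) * indicator A (X \<omega>)" for \<omega>
    by (auto split: split_indicator)
  have "Re (CLINT \<omega>|M. g \<omega> * indicator A (X \<omega>)) = (\<integral>\<omega>. Re (g \<omega>) * indicator A (X \<omega>) \<partial>M)"
    using integral_Re[OF iga] by (simp only: ReA)
  moreover have "Im (CLINT \<omega>|M. g \<omega> * indicator A (X \<omega>)) = (\<integral>\<omega>. Im (g \<omega>) * indicator A (X \<omega>) \<partial>M)"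
    using integral_Im[OF iga] by (simp only: ImA)
  ultimately show ?thesis
    using 1 2 ig by (simp add: complex_eq_iff)
qed

text \<open>Exponential factors are traded for indicators one index at a time. All other indicators
  and exponentials form the bounded complex factor \<open>g\<close> for the variable being
  traded.\<close>

lemma (in prob_space) chf_prod_indicator:
  fixes X :: "'i \<Rightarrow> 'a \<Rightarrow> real"
  assumes I: "finite I" and X[measurable]: "\<And>i. i \<in> I \<Longrightarrow> random_variable borel (X i)"
    and chf: "\<And>t. (CLINT \<omega>|M. iexp (\<Sum>i\<in>I. t i * X i \<omega>)) = (\<Prod>i\<in>I. char (distr M borel (X i)) (t i))"
    and J: "J \<subseteq> I" and A[measurable]: "\<And>i. i \<in> I \<Longrightarrow> A i \<in> sets borel"
  shows "(CLINT \<omega>|M. (\<Prod>j\<in>J. indicator (A j) (X j \<omega>)) * iexp (\<Sum>i\<in>I - J. t i * X i \<omega>))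
     = (\<Prod>j\<in>J. complex_of_real (prob (X j -` A j \<inter> space M))) * (\<Prod>i\<in>I - J. char (distr M borel (X i)) (t i))"
  using finite_subset[OF J I] J
proof (induction J arbitrary: t)
  case empty
  then show ?case using chf by simp
next
  case (insert j J)
  have jI: "j \<in> I" and JI: "J \<subseteq> I" using insert by auto
  have [measurable]: "random_variable borel (X i)" "A i \<in> sets borel" if "i \<in> J" for i
    using that JI by auto
  have [measurable]: "random_variable borel (X j)" "A j \<in> sets borel" using jI by auto
  define R where "R = I - insert j J"
  have R: "I - J = insert j R" "j \<notin> R" "finite R" "R \<subseteq> I" using insert I by (auto simp: R_def)
  define g where "g \<omega> = (\<Prod>j\<in>J. indicator (A j) (X j \<omega>)) * iexp (\<Sum>i\<in>R. t i * X i \<omega>)" for \<omega>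
  have gm: "g \<in> borel_measurable M"
  proof -
    have 1: "(\<lambda>\<omega>. indicator (A i) (X i \<omega>) :: complex) \<in> borel_measurable M" if "i \<in> J" for i
      using that by measurable
    have 2: "(\<lambda>\<omega>. \<Sum>i\<in>R. t i * X i \<omega>) \<in> borel_measurable M"
      by (intro borel_measurable_sum borel_measurable_times borel_measurable_const X) (use R in auto)
    show ?thesis
      unfolding g_def
      by (intro borel_measurable_times borel_measurable_prod 1)
         (use measurable_compose[OF 2, of iexp borel] in simp_all)
  qed
  have gb: "cmod (g \<omega>) \<le> 1" for \<omega>
  proof -
    have "cmod (g \<omega>) = (\<Prod>j\<in>J. indicator (A j) (X j \<omega>))"
      unfolding g_def norm_mult norm_exp_i_times mult_1_right prod_norm[symmetric]
      by (intro prod.cong) (auto split: split_indicator)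
    also have "\<dots> \<le> 1" by (intro prod_le_1) (auto split: split_indicator)
    finally show ?thesis .
  qed
  define c where "c = (\<Prod>j\<in>J. complex_of_real (prob (X j -` A j \<inter> space M))) *
      (\<Prod>i\<in>R. char (distr M borel (X i)) (t i))"
  \<comment> \<open>The induction hypothesis at \<open>t(j:=r)\<close> lets the frequency of
    \<open>X j\<close> vary while the others stay fixed; this is why \<open>t\<close> is
    generalized.\<close>
  have g: "(CLINT \<omega>|M. g \<omega> * iexp (r * X j \<omega>)) = c * char (distr M borel (X j)) r" for r
  proof -
    have eq: "(\<Prod>j\<in>J. indicator (A j) (X j \<omega>)) * iexp (\<Sum>i\<in>insert j R. (t(j:=r)) i * X i \<omega>) = g \<omega> * iexp (r * X j \<omega>)" for \<omega>
    proof -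
      have "(\<Sum>i\<in>insert j R. (t(j:=r)) i * X i \<omega>) = r * X j \<omega> + (\<Sum>i\<in>R. (t(j:=r)) i * X i \<omega>)"
        using R by simp
      also have "(\<Sum>i\<in>R. (t(j:=r)) i * X i \<omega>) = (\<Sum>i\<in>R. t i * X i \<omega>)"
        using R by (intro sum.cong) auto
      finally have "iexp (\<Sum>i\<in>insert j R. (t(j:=r)) i * X i \<omega>)
          = iexp (r * X j \<omega>) * iexp (\<Sum>i\<in>R. t i * X i \<omega>)"
        by (simp only: of_real_add distrib_left exp_add)
      then show ?thesis by (simp only: g_def mult_ac)
    qed
    have eq2: "(\<Prod>i\<in>insert j R. char (distr M borel (X i)) ((t(j:=r)) i))
      = char (distr M borel (X j)) r * (\<Prod>i\<in>R. char (distr M borel (X i)) (t i))"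
      using R by (auto intro!: prod.cong)
    show ?thesis
      using insert.IH[OF JI, of "t(j:=r)"] unfolding R(1) eq eq2 c_def by (simp only: mult_ac)
  qed
  interpret Xj: real_distribution "distr M borel (X j)" by simp
  have g0: "(CLINT \<omega>|M. g \<omega>) = c"
    using g[of 0] by (simp add: Xj.char_zero)
  have "(CLINT \<omega>|M. g \<omega> * indicator (A j) (X j \<omega>)) = (CLINT \<omega>|M. g \<omega>) * prob (X j -` A j \<inter> space M)"
  proof (rule complex_factor_of_chf[OF _ gm gb])
    show "(CLINT \<omega>|M. g \<omega> * iexp (r * X j \<omega>)) = (CLINT \<omega>|M. g \<omega>) * char (distr M borel (X j)) r" for r
      by (simp only: g g0)
  qed auto
  then show ?case
    using insert.hyps unfolding g0 R_def[symmetric] by (simp add: g_def c_def mult_ac)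
qed

lemma (in prob_space) integral_indicator_event:
  assumes S: "S \<in> events"
  shows "(CLINT \<omega>|M. indicator S \<omega>) = complex_of_real (prob S)"
proof -
  have "(\<lambda>\<omega>. indicator S \<omega> *\<^sub>R (1 :: complex)) = indicator S"
    by (auto simp: fun_eq_iff split: split_indicator)
  then show ?thesis
    using has_bochner_integral_integral_eq[OF has_bochner_integral_indicator[OF S, of "1::complex"]]
    by (simp add: of_real_def emeasure_eq_measure)
qed

text \<open>When every exponential has been traded for an indicator, what remains is the product
  formula on rectangles, whose sides run over an intersection-stable generator.\<close>

lemma (in prob_space) indep_vars_of_chf:
  fixes X :: "'i \<Rightarrow> 'a \<Rightarrow> real"
  assumes I: "finite I" "I \<noteq> {}" and X[measurable]: "\<And>i. i \<in> I \<Longrightarrow> random_variable borel (X i)"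
    and chf: "\<And>t. (CLINT \<omega>|M. iexp (\<Sum>i\<in>I. t i * X i \<omega>)) = (\<Prod>i\<in>I. char (distr M borel (X i)) (t i))"
  shows "indep_vars (\<lambda>_. borel) X I"
proof (subst indep_vars_finite[where E = "\<lambda>_. sets borel"])
  show "\<forall>A\<in>\<Pi> i\<in>I. sets borel. prob (\<Inter>j\<in>I. X j -` A j \<inter> space M) = (\<Prod>j\<in>I. prob (X j -` A j \<inter> space M))"
  proof
    fix A assume "A \<in> (\<Pi> i\<in>I. sets (borel :: real measure))"
    then have A[measurable]: "A i \<in> sets borel" if "i \<in> I" for i using that by auto
    have S: "(\<Inter>j\<in>I. X j -` A j \<inter> space M) \<in> sets M"
      using I by (intro sets.finite_INT) auto
    have "complex_of_real (prob (\<Inter>j\<in>I. X j -` A j \<inter> space M)) =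
       (CLINT \<omega>|M. indicator (\<Inter>j\<in>I. X j -` A j \<inter> space M) \<omega>)"
      by (rule integral_indicator_event[OF S, symmetric])
    also have "\<dots> = (CLINT \<omega>|M. (\<Prod>j\<in>I. indicator (A j) (X j \<omega>)))"
    proof (rule Bochner_Integration.integral_cong[OF refl])
      fix \<omega> assume w: "\<omega> \<in> space M"
      show "indicator (\<Inter>j\<in>I. X j -` A j \<inter> space M) \<omega> = (\<Prod>j\<in>I. indicator (A j) (X j \<omega>) :: complex)"
      proof (cases "\<forall>j\<in>I. X j \<omega> \<in> A j")
        case True then show ?thesis using w I by (auto simp: indicator_def)
      next
        case False
        then show ?thesis using w I by (auto simp: indicator_def intro!: prod_zero[symmetric])
      qed
    qed
    also have "\<dots> = (\<Prod>j\<in>I. complex_of_real (prob (X j -` A j \<inter> space M)))"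
      using chf_prod_indicator[OF I(1) X chf order_refl A, where t="\<lambda>_. 0"] by simp
    finally show "prob (\<Inter>j\<in>I. X j -` A j \<inter> space M) = (\<Prod>j\<in>I. prob (X j -` A j \<inter> space M))"
      by (simp flip: of_real_prod)
  qed
qed (use I sets.sigma_sets_eq[of "borel :: real measure"] in \<open>auto simp: Int_stable_def\<close>)

section \<open>A central limit theorem for m-dependent sums\<close>

text \<open>Separation is required between elements, not between intervals, so \<open>B\<close> may
  surround \<open>A\<close>. The method below needs this: it pairs a neighbourhood of an index with
  everything outside a larger one.\<close>

definition (in prob_space) m_dependent :: "nat \<Rightarrow> nat set \<Rightarrow> (nat \<Rightarrow> 'a \<Rightarrow> real) \<Rightarrow> bool" where
  "m_dependent m I X \<longleftrightarrow> (\<forall>A B. A \<subseteq> I \<longrightarrow> B \<subseteq> I \<longrightarrow> (\<forall>a\<in>A. \<forall>b\<in>B. a + m < b \<or> b + m < a) \<longrightarrow>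
     indep_var (PiM A (\<lambda>_. borel)) (\<lambda>\<omega>. restrict (\<lambda>i. X i \<omega>) A)
               (PiM B (\<lambda>_. borel)) (\<lambda>\<omega>. restrict (\<lambda>i. X i \<omega>) B))"

lemma (in prob_space) m_dependent_lebesgue_integral:
  fixes F G :: "(nat \<Rightarrow> real) \<Rightarrow> complex"
  assumes "m_dependent m I X" "A \<subseteq> I" "B \<subseteq> I" "\<And>a b. a \<in> A \<Longrightarrow> b \<in> B \<Longrightarrow> a + m < b \<or> b + m < a"
    and F: "F \<in> borel_measurable (PiM A (\<lambda>_. borel))" and G: "G \<in> borel_measurable (PiM B (\<lambda>_. borel))"
    and intF: "integrable M (\<lambda>\<omega>. F (restrict (\<lambda>i. X i \<omega>) A))" and intG: "integrable M (\<lambda>\<omega>. G (restrict (\<lambda>i. X i \<omega>) B))"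
  shows "(CLINT \<omega>|M. F (restrict (\<lambda>i. X i \<omega>) A) * G (restrict (\<lambda>i. X i \<omega>) B)) =
    (CLINT \<omega>|M. F (restrict (\<lambda>i. X i \<omega>) A)) * (CLINT \<omega>|M. G (restrict (\<lambda>i. X i \<omega>) B))"
proof -
  have "indep_var (PiM A (\<lambda>_. borel)) (\<lambda>\<omega>. restrict (\<lambda>i. X i \<omega>) A)
               (PiM B (\<lambda>_. borel)) (\<lambda>\<omega>. restrict (\<lambda>i. X i \<omega>) B)"
    using assms(1-4) unfolding m_dependent_def by blast
  from indep_var_compose[OF this F G]
  have "indep_var borel (\<lambda>\<omega>. F (restrict (\<lambda>i. X i \<omega>) A)) borel (\<lambda>\<omega>. G (restrict (\<lambda>i. X i \<omega>) B))"
    by (simp add: comp_def)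
  from indep_var_lebesgue_integral[OF this intF intG] show ?thesis by simp
qed

section \<open>Elementary bounds for cubes and complex exponentials\<close>

lemma abs_prod3_le: "\<bar>a * b * c\<bar> \<le> (\<bar>a\<bar>^3 + \<bar>b\<bar>^3 + \<bar>c\<bar>^3) / (3::real)"
proof -
  have *: "3 * (x * y * z) \<le> x^3 + y^3 + z^3" if "0 \<le> x" "0 \<le> y" "0 \<le> z" for x y z :: real
  proof -
    \<comment> \<open>The factorization behind the arithmetic-geometric mean inequality for three
      numbers; it reduces mixed third moments to individual ones.\<close>
    have "x^3 + y^3 + z^3 - 3 * (x * y * z) = (x + y + z) * ((x - y)^2 + (y - z)^2 + (z - x)^2) / 2"
      by (simp add: power2_eq_square power3_eq_cube algebra_simps)
    also have "\<dots> \<ge> 0" using that by simp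
    finally show ?thesis by simp
  qed
  show ?thesis using *[of "\<bar>a\<bar>" "\<bar>b\<bar>" "\<bar>c\<bar>"] by (simp add: abs_mult)
qed

lemma power_le_one_plus_cube:
  fixes x :: real shows "\<bar>x\<bar> \<le> 1 + \<bar>x\<bar>^3" "x\<^sup>2 \<le> 1 + \<bar>x\<bar>^3"
proof -
  have "\<bar>x\<bar> ^ j \<le> 1 + \<bar>x\<bar>^3" if "j \<le> 3" for j
  proof (cases "\<bar>x\<bar> \<le> 1")
    case True
    then have "\<bar>x\<bar>^j \<le> 1" by (intro power_le_one) auto
    then show ?thesis by (simp add: add_increasing2)
  next
    case False
    then have "\<bar>x\<bar>^j \<le> \<bar>x\<bar>^3" using that by (intro power_increasing) auto
    then show ?thesis by simp
  qed
  from this[of 1] this[of 2] show "\<bar>x\<bar> \<le> 1 + \<bar>x\<bar>^3" "x\<^sup>2 \<le> 1 + \<bar>x\<bar>^3" by auto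
qed

lemma abs_mult_le_mean_squares: "\<bar>a * b\<bar> \<le> (a\<^sup>2 + b\<^sup>2) / (2::real)"
  using sum_squares_bound[of "\<bar>a\<bar>" "\<bar>b\<bar>"] by (simp add: abs_mult)

lemma cmod_iexp_minus_one_le: "cmod (iexp x - 1) \<le> \<bar>x\<bar>"
  using iexp_approx1[of x 0] by simp

lemma cmod_iexp_taylor2_le: "cmod (iexp x - 1 - \<i> * x) \<le> x\<^sup>2 / 2"
  using iexp_approx1[of x 1] by (simp add: diff_diff_eq numeral_2_eq_2)

lemma cmod_iexp_diff_le: "cmod (iexp x - iexp y) \<le> \<bar>x - y\<bar>"
proof -
  have "iexp x - iexp y = iexp y * (iexp (x - y) - 1)"
    by (simp add: right_diff_distrib flip: exp_add)
  then show ?thesis using cmod_iexp_minus_one_le[of "x - y"] by (simp add: norm_mult)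
qed

lemma norm_integral_le_integral:
  fixes f :: "'a \<Rightarrow> 'b::{banach, second_countable_topology}" and g :: "'a \<Rightarrow> real"
  assumes "integrable M g" "\<And>x. x \<in> space M \<Longrightarrow> norm (f x) \<le> g x"
  shows "norm (integral\<^sup>L M f) \<le> integral\<^sup>L M g"
  by (rule order_trans[OF integral_norm_bound integral_mono'])
     (use assms order_trans[OF norm_ge_zero] in auto)

text \<open>The second-order Taylor bound for \<open>iexp\<close>, integrated against the second
  moment, makes the error of the difference quotient linear in \<open>u - t\<close>.\<close>

lemma (in prob_space) chf_has_vector_derivative:
  fixes S :: "'a \<Rightarrow> real"
  assumes [measurable]: "random_variable borel S" and S: "integrable M S" and S2: "integrable M (\<lambda>\<omega>. (S \<omega>)\<^sup>2)"
  shows "((\<lambda>t. CLINT \<omega>|M. iexp (t * S \<omega>)) has_vector_derivative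
     (\<i> * (CLINT \<omega>|M. S \<omega> * iexp (t * S \<omega>)))) (at t)"
proof -
  let ?\<phi> = "\<lambda>t. CLINT \<omega>|M. iexp (t * S \<omega>)"
  let ?D = "\<i> * (CLINT \<omega>|M. S \<omega> * iexp (t * S \<omega>))"
  have i1: "integrable M (\<lambda>\<omega>. iexp (t * S \<omega>))" for t
    by (rule integrable_const_bound[where B=1]) auto
  have i2: "integrable M (\<lambda>\<omega>. S \<omega> * iexp (t * S \<omega>))" for t
    by (rule Bochner_Integration.integrable_bound[OF S]) (auto simp: norm_mult)
  define C where "C = expectation (\<lambda>\<omega>. (S \<omega>)\<^sup>2) / 2"
  have bd: "cmod (?\<phi> u - ?\<phi> t - (u - t) *\<^sub>R ?D) \<le> C * (u - t)\<^sup>2" for u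
  proof -
    have eq: "?\<phi> u - ?\<phi> t - (u - t) *\<^sub>R ?D
      = (CLINT \<omega>|M. iexp (u * S \<omega>) - iexp (t * S \<omega>) - ((u - t) * \<i>) * (S \<omega> * iexp (t * S \<omega>)))"
      using i1 i2 by (simp add: scaleR_conv_of_real)
    have "cmod (CLINT \<omega>|M. iexp (u * S \<omega>) - iexp (t * S \<omega>) - ((u - t) * \<i>) * (S \<omega> * iexp (t * S \<omega>)))
       \<le> (\<integral>\<omega>. (u - t)\<^sup>2 / 2 * (S \<omega>)\<^sup>2 \<partial>M)"
    proof (rule norm_integral_le_integral)
      fix \<omega>
      have "iexp (u * S \<omega>) - iexp (t * S \<omega>) - ((u - t) * \<i>) * (S \<omega> * iexp (t * S \<omega>))
        = iexp (t * S \<omega>) * (iexp ((u - t) * S \<omega>) - 1 - \<i> * ((u - t) * S \<omega>))"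
        by (simp add: algebra_simps flip: exp_add)
      then show "cmod (iexp (u * S \<omega>) - iexp (t * S \<omega>) - ((u - t) * \<i>) * (S \<omega> * iexp (t * S \<omega>)))
         \<le> (u - t)\<^sup>2 / 2 * (S \<omega>)\<^sup>2"
        using cmod_iexp_taylor2_le[of "(u - t) * S \<omega>"]
        by (simp only: norm_mult norm_exp_i_times power_mult_distrib mult_1 times_divide_eq_left)
    qed (use S2 in auto)
    then show ?thesis unfolding eq C_def by (simp add: mult_ac)
  qed
  have "((\<lambda>u. C * \<bar>u - t\<bar>) \<longlongrightarrow> C * \<bar>t - t\<bar>) (at t)"
    by (intro tendsto_intros)
  then have lim: "((\<lambda>u. C * \<bar>u - t\<bar>) \<longlongrightarrow> 0) (at t)" by simp
  show ?thesis
    unfolding has_vector_derivative_def has_derivative_at_within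
  proof (intro conjI bounded_linear_scaleR_left)
    show "((\<lambda>u. (?\<phi> u - ?\<phi> t - (u - t) *\<^sub>R ?D) /\<^sub>R norm (u - t)) \<longlongrightarrow> 0) (at t)"
    proof (rule Lim_null_comparison[OF _ lim], intro always_eventually allI)
      fix u
      show "norm ((?\<phi> u - ?\<phi> t - (u - t) *\<^sub>R ?D) /\<^sub>R norm (u - t)) \<le> C * \<bar>u - t\<bar>"
      proof (cases "u = t")
        case False
        then show ?thesis
          using bd[of u] by (simp add: divide_simps power2_eq_square mult_ac del: scaleR_complex.simps)
      qed simp
    qed
  qed
qed

text \<open>The function \<open>\<phi>(t) exp (t\<^sup>2 / 2)\<close> has derivative \<open>(\<phi>'(t) + t \<phi>(t)) exp (t\<^sup>2 / 2)\<close>.\<close>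

lemma gaussian_chf_perturbation:
  fixes \<phi> \<phi>' :: "real \<Rightarrow> complex"
  assumes deriv: "\<And>t. (\<phi> has_vector_derivative \<phi>' t) (at t)" and "\<phi> 0 = 1"
    and bd: "\<And>t. cmod (\<phi>' t + t * \<phi> t) \<le> C * t\<^sup>2"
  shows "cmod (\<phi> t - complex_of_real (exp (- t\<^sup>2 / 2))) \<le> C * \<bar>t\<bar>^3"
proof -
  define \<psi> where "\<psi> u = exp (u\<^sup>2 / 2) *\<^sub>R \<phi> u" for u
  define \<psi>' where "\<psi>' u = exp (u\<^sup>2 / 2) *\<^sub>R (\<phi>' u + u * \<phi> u)" for u
  have C: "0 \<le> C" using order_trans[OF norm_ge_zero bd[of 1]] by simp
  have d: "(\<psi> has_vector_derivative \<psi>' u) (at u within closed_segment 0 t)" for u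
  proof -
    have "((\<lambda>u::real. exp (u\<^sup>2 / 2)) has_real_derivative exp (u\<^sup>2 / 2) * u) (at u within closed_segment 0 t)"
      by (auto intro!: derivative_eq_intros)
    from has_vector_derivative_scaleR[OF this has_vector_derivative_at_within[OF deriv[of u]]]
    show ?thesis unfolding \<psi>_def \<psi>'_def
      by (simp add: scaleR_conv_of_real algebra_simps)
  qed
  have \<psi>'0: "\<psi>' 0 = 0" using bd[of 0] by (simp add: \<psi>'_def)
  \<comment> \<open>Mean value inequality around 0, where \<open>\<psi>'\<close> vanishes because
    \<open>bd\<close> forces it. The factor exp (t^2 / 2) lost here is exactly undone when
    \<open>\<phi>\<close> is recovered from \<open>\<psi>\<close>.\<close>
  have "norm (\<psi> t - \<psi> 0 - (t - 0) *\<^sub>R \<psi>' 0) \<le> norm (t - 0) * (exp (t\<^sup>2 / 2) * (C * t\<^sup>2))"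
  proof (rule vector_differentiable_bound_linearization[OF d order_refl])
    fix u assume u: "u \<in> closed_segment 0 t"
    then have "\<bar>u\<bar> \<le> \<bar>t\<bar>" by (auto simp: closed_segment_eq_real_ivl split: if_splits)
    then have ut: "u\<^sup>2 \<le> t\<^sup>2" by (simp add: abs_le_square_iff)
    have "norm (\<psi>' u) \<le> exp (u\<^sup>2 / 2) * (C * u\<^sup>2)"
      using bd[of u] by (simp add: \<psi>'_def)
    also have "\<dots> \<le> exp (t\<^sup>2 / 2) * (C * t\<^sup>2)"
      using ut C by (intro mult_mono) auto
    finally show "norm (\<psi>' u - \<psi>' 0) \<le> exp (t\<^sup>2 / 2) * (C * t\<^sup>2)" by (simp add: \<psi>'0)
  qed auto
  then have 1: "norm (\<psi> t - 1) \<le> exp (t\<^sup>2 / 2) * (C * \<bar>t\<bar>^3)"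
    using assms(2) by (simp add: \<psi>'0 \<psi>_def power2_eq_square power3_eq_cube mult_ac flip: abs_mult)
  have "\<phi> t - complex_of_real (exp (- t\<^sup>2 / 2)) = exp (- (t\<^sup>2 / 2)) *\<^sub>R (\<psi> t - 1)"
    by (simp add: \<psi>_def exp_minus scaleR_conv_of_real field_simps)
  also have "norm \<dots> = exp (- (t\<^sup>2 / 2)) * norm (\<psi> t - 1)" by simp
  also have "\<dots> \<le> exp (- (t\<^sup>2 / 2)) * (exp (t\<^sup>2 / 2) * (C * \<bar>t\<bar>^3))"
    using 1 by (intro mult_left_mono) auto
  also have "\<dots> = C * \<bar>t\<bar>^3" by (simp flip: mult.assoc exp_add)
  finally show ?thesis .
qed


lemma
  fixes f :: "'i \<Rightarrow> 'j \<Rightarrow> 'a \<Rightarrow> real"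
  assumes "\<And>i j. i \<in> A \<Longrightarrow> j \<in> B \<Longrightarrow> integrable M (f i j)"
  shows integrable_double_sum: "integrable M (\<lambda>\<omega>. \<Sum>i\<in>A. \<Sum>j\<in>B. f i j \<omega>)"
    and integral_double_sum: "(\<integral>\<omega>. (\<Sum>i\<in>A. \<Sum>j\<in>B. f i j \<omega>) \<partial>M) = (\<Sum>i\<in>A. \<Sum>j\<in>B. \<integral>\<omega>. f i j \<omega> \<partial>M)"
proof -
  have *: "integrable M (\<lambda>\<omega>. \<Sum>j\<in>B. f i j \<omega>)" if "i \<in> A" for i
    using assms that by (intro Bochner_Integration.integrable_sum) auto
  then show "integrable M (\<lambda>\<omega>. \<Sum>i\<in>A. \<Sum>j\<in>B. f i j \<omega>)"
    by (rule Bochner_Integration.integrable_sum)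
  have "(\<integral>\<omega>. (\<Sum>i\<in>A. \<Sum>j\<in>B. f i j \<omega>) \<partial>M) = (\<Sum>i\<in>A. \<integral>\<omega>. (\<Sum>j\<in>B. f i j \<omega>) \<partial>M)"
    using * by (intro Bochner_Integration.integral_sum) auto
  also have "\<dots> = (\<Sum>i\<in>A. \<Sum>j\<in>B. \<integral>\<omega>. f i j \<omega> \<partial>M)"
    using assms by (intro sum.cong refl Bochner_Integration.integral_sum) auto
  finally show "(\<integral>\<omega>. (\<Sum>i\<in>A. \<Sum>j\<in>B. f i j \<omega>) \<partial>M) = (\<Sum>i\<in>A. \<Sum>j\<in>B. \<integral>\<omega>. f i j \<omega> \<partial>M)" .
qed

text \<open>Tikhomirov's characteristic function method: \<open>X i\<close> is independent of the sum without the
  \<open>m\<close>-neighbourhood of \<open>i\<close>, and \<open>X i\<close> times the sum over that neighbourhood is independent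
  of the sum without the \<open>2m\<close>-neighbourhood. Expanding the exponential to second order gives
  \<open>\<phi>'(t) = - t \<phi>(t) + O(t\<^sup>2)\<close>.\<close>

lemma (in prob_space) m_dependent_chf_bound:
  fixes X :: "nat \<Rightarrow> 'a \<Rightarrow> real" and \<gamma> :: real
  assumes I: "finite I" and m: "m_dependent m I X"
    and X[measurable]: "\<And>i. random_variable borel (X i)"
    and int3: "\<And>i. i \<in> I \<Longrightarrow> integrable M (\<lambda>\<omega>. \<bar>X i \<omega>\<bar>^3)"
    and mean: "\<And>i. i \<in> I \<Longrightarrow> expectation (X i) = 0"
    and b1: "\<And>i. i \<in> I \<Longrightarrow> expectation (\<lambda>\<omega>. \<bar>X i \<omega>\<bar>) \<le> \<gamma>"
    and b2: "\<And>i. i \<in> I \<Longrightarrow> expectation (\<lambda>\<omega>. (X i \<omega>)\<^sup>2) \<le> \<gamma>\<^sup>2"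
    and b3: "\<And>i. i \<in> I \<Longrightarrow> expectation (\<lambda>\<omega>. \<bar>X i \<omega>\<bar>^3) \<le> \<gamma>^3"
    and \<gamma>: "0 \<le> \<gamma>"
    and var: "expectation (\<lambda>\<omega>. (\<Sum>i\<in>I. X i \<omega>)\<^sup>2) = 1"
  shows "cmod (char (distr M borel (\<lambda>\<omega>. \<Sum>i\<in>I. X i \<omega>)) t - complex_of_real (exp (- t\<^sup>2 / 2)))
           \<le> 3 * (4 * m + 1)\<^sup>2 * (card I * \<gamma>^3) * \<bar>t\<bar>^3"
proof -
  define q where "q = real (4 * m + 1)"
  define nb where "nb r i = {j\<in>I. j \<le> i + r \<and> i \<le> j + r}" for r i
  have nbI: "nb r i \<subseteq> I" "finite (nb r i)" for r i using I by (auto simp: nb_def)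
  have nbsub: "nb m i \<subseteq> nb (2*m) i" for i by (auto simp: nb_def)
  have card: "real (card (nb (2*m) i)) \<le> q" for i
  proof -
    have "card (nb (2*m) i) \<le> card {i - 2*m..i + 2*m}"
      by (intro card_mono) (auto simp: nb_def)
    then show ?thesis by (auto simp: q_def)
  qed
  have q0: "0 \<le> q" by (simp add: q_def)
  define S where "S \<omega> = (\<Sum>i\<in>I. X i \<omega>)" for \<omega>
  define Y where "Y i \<omega> = (\<Sum>j\<in>nb m i. X j \<omega>)" for i \<omega>
  define U where "U i \<omega> = (\<Sum>j\<in>I - nb m i. X j \<omega>)" for i \<omega>
  define V where "V i \<omega> = (\<Sum>j\<in>I - nb (2*m) i. X j \<omega>)" for i \<omega>
  \<comment> \<open>One majorant for \<open>Y i\<close>, for \<open>U i - V i\<close> and for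
    \<open>V i - S\<close>: up to sign, each is a sum over part or all of the
    \<open>2 * m\<close>-neighbourhood.\<close>
  define B where "B i \<omega> = (\<Sum>j\<in>nb (2*m) i. \<bar>X j \<omega>\<bar>)" for i \<omega>
  have [measurable]: "random_variable borel S" "random_variable borel (Y i)" "random_variable borel (U i)"
    "random_variable borel (V i)" "random_variable borel (B i)" for i
    unfolding S_def[abs_def] Y_def[abs_def] U_def[abs_def] V_def[abs_def] B_def[abs_def] by measurable
  have SUY: "S \<omega> = U i \<omega> + Y i \<omega>" for i \<omega>
    unfolding S_def U_def Y_def using sum.subset_diff[OF nbI(1) I] by simp
  have B0: "0 \<le> B i \<omega>" for i \<omega> by (simp add: B_def sum_nonneg)
  have YB: "\<bar>Y i \<omega>\<bar> \<le> B i \<omega>" for i \<omega>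
    unfolding Y_def B_def by (rule order_trans[OF sum_abs]) (intro sum_mono2 nbI nbsub, auto)
  have UVB: "\<bar>U i \<omega> - V i \<omega>\<bar> \<le> B i \<omega>" for i \<omega>
  proof -
    have "U i \<omega> - V i \<omega> = (\<Sum>j\<in>(I - nb m i) - (I - nb (2*m) i). X j \<omega>)"
      unfolding U_def V_def using I nbsub[of i] by (subst sum_diff) auto
    also have "(I - nb m i) - (I - nb (2*m) i) = nb (2*m) i - nb m i" by (auto simp: nb_def)
    finally show ?thesis
      unfolding B_def by (simp, intro order_trans[OF sum_abs] sum_mono2 nbI) auto
  qed
  have SVB: "\<bar>V i \<omega> - S \<omega>\<bar> \<le> B i \<omega>" for i \<omega>
  proof -
    have "S \<omega> - V i \<omega> = (\<Sum>j\<in>nb (2*m) i. X j \<omega>)"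
      unfolding S_def V_def using sum.subset_diff[OF nbI(1)[of "2*m" i] I, of "\<lambda>j. X j \<omega>"] by simp
    then have "\<bar>V i \<omega> - S \<omega>\<bar> = \<bar>\<Sum>j\<in>nb (2*m) i. X j \<omega>\<bar>" by (simp add: abs_minus_commute)
    then show ?thesis unfolding B_def by (simp add: sum_abs)
  qed

  have i3: "integrable M (\<lambda>\<omega>. \<bar>X i \<omega> * X j \<omega> * X k \<omega>\<bar>)"
    and e3: "expectation (\<lambda>\<omega>. \<bar>X i \<omega> * X j \<omega> * X k \<omega>\<bar>) \<le> \<gamma>^3"
    if "i \<in> I" "j \<in> I" "k \<in> I" for i j k
  proof -
    have *: "integrable M (\<lambda>\<omega>. (\<bar>X i \<omega>\<bar>^3 + \<bar>X j \<omega>\<bar>^3 + \<bar>X k \<omega>\<bar>^3) / 3)"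
      using that int3 by auto
    show 1: "integrable M (\<lambda>\<omega>. \<bar>X i \<omega> * X j \<omega> * X k \<omega>\<bar>)"
      by (rule Bochner_Integration.integrable_bound[OF *]) (use abs_prod3_le in auto)
    have "expectation (\<lambda>\<omega>. \<bar>X i \<omega> * X j \<omega> * X k \<omega>\<bar>) \<le> expectation (\<lambda>\<omega>. (\<bar>X i \<omega>\<bar>^3 + \<bar>X j \<omega>\<bar>^3 + \<bar>X k \<omega>\<bar>^3) / 3)"
      by (rule integral_mono[OF 1 *]) (rule abs_prod3_le)
    also have "\<dots> \<le> \<gamma>^3"
      using that int3[of i] int3[of j] int3[of k] b3[of i] b3[of j] b3[of k] by simp
    finally show "expectation (\<lambda>\<omega>. \<bar>X i \<omega> * X j \<omega> * X k \<omega>\<bar>) \<le> \<gamma>^3" .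
  qed
  have i2': "integrable M (\<lambda>\<omega>. (X i \<omega>)\<^sup>2)" if "i \<in> I" for i
  proof (rule Bochner_Integration.integrable_bound[where f="\<lambda>\<omega>. 1 + \<bar>X i \<omega>\<bar>^3"])
    show "AE \<omega> in M. norm ((X i \<omega>)\<^sup>2) \<le> norm (1 + \<bar>X i \<omega>\<bar>^3)"
      using power_le_one_plus_cube(2) by auto
  qed (use int3 that in auto)
  have i2: "integrable M (\<lambda>\<omega>. \<bar>X i \<omega> * X j \<omega>\<bar>)"
    and e2: "expectation (\<lambda>\<omega>. \<bar>X i \<omega> * X j \<omega>\<bar>) \<le> \<gamma>\<^sup>2" if "i \<in> I" "j \<in> I" for i j
  proof -
    note le = abs_mult_le_mean_squares
    have *: "integrable M (\<lambda>\<omega>. ((X i \<omega>)\<^sup>2 + (X j \<omega>)\<^sup>2) / 2)"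
      using that i2' by auto
    show 1: "integrable M (\<lambda>\<omega>. \<bar>X i \<omega> * X j \<omega>\<bar>)"
      by (rule Bochner_Integration.integrable_bound[OF *]) (use le in auto)
    have "expectation (\<lambda>\<omega>. \<bar>X i \<omega> * X j \<omega>\<bar>) \<le> expectation (\<lambda>\<omega>. ((X i \<omega>)\<^sup>2 + (X j \<omega>)\<^sup>2) / 2)"
      by (rule integral_mono[OF 1 *]) (rule le)
    also have "\<dots> \<le> \<gamma>\<^sup>2"
      using that i2'[of i] i2'[of j] b2[of i] b2[of j] by simp
    finally show "expectation (\<lambda>\<omega>. \<bar>X i \<omega> * X j \<omega>\<bar>) \<le> \<gamma>\<^sup>2" .
  qed
  have i1: "integrable M (X i)" if "i \<in> I" for i
    by (rule square_integrable_imp_integrable) (use i2'[OF that] in auto)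
  have iXY: "integrable M (\<lambda>\<omega>. X i \<omega> * X j \<omega>)" if "i \<in> I" "j \<in> I" for i j
    using i2[OF that] by (simp add: integrable_abs_iff)

  have sumq: "(\<Sum>j\<in>nb (2*m) i. f j) \<le> q * c" if "\<And>j. j \<in> I \<Longrightarrow> f j \<le> c" "0 \<le> c" for f c i
  proof -
    have "(\<Sum>j\<in>nb (2*m) i. f j) \<le> of_nat (card (nb (2*m) i)) * c"
      by (rule sum_bounded_above) (use that nbI in auto)
    also have "\<dots> \<le> q * c" using card that by (intro mult_right_mono) auto
    finally show ?thesis .
  qed
  have iB: "integrable M (B i)" and eB: "expectation (B i) \<le> q * \<gamma>" for i
  proof -
    show "integrable M (B i)" unfolding B_def[abs_def] using i1 nbI(1)[of "2*m" i]
      by (intro Bochner_Integration.integrable_sum integrable_abs) auto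
    have "expectation (B i) = (\<Sum>j\<in>nb (2*m) i. expectation (\<lambda>\<omega>. \<bar>X j \<omega>\<bar>))"
      unfolding B_def[abs_def] using i1 nbI(1)[of "2*m" i]
      by (intro Bochner_Integration.integral_sum) auto
    also have "\<dots> \<le> q * \<gamma>" by (rule sumq[OF b1 \<gamma>])
    finally show "expectation (B i) \<le> q * \<gamma>" .
  qed
  have iXB: "integrable M (\<lambda>\<omega>. \<bar>X i \<omega>\<bar> * B i \<omega>)"
    and eXB: "expectation (\<lambda>\<omega>. \<bar>X i \<omega>\<bar> * B i \<omega>) \<le> q * \<gamma>\<^sup>2" if "i \<in> I" for i
  proof -
    have eq: "(\<lambda>\<omega>. \<bar>X i \<omega>\<bar> * B i \<omega>) = (\<lambda>\<omega>. \<Sum>j\<in>nb (2*m) i. \<bar>X i \<omega> * X j \<omega>\<bar>)"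
      by (simp add: B_def sum_distrib_left abs_mult)
    show "integrable M (\<lambda>\<omega>. \<bar>X i \<omega>\<bar> * B i \<omega>)"
      unfolding eq using i2 that nbI(1)[of "2*m" i] by (intro Bochner_Integration.integrable_sum) auto
    have "expectation (\<lambda>\<omega>. \<bar>X i \<omega>\<bar> * B i \<omega>) = (\<Sum>j\<in>nb (2*m) i. expectation (\<lambda>\<omega>. \<bar>X i \<omega> * X j \<omega>\<bar>))"
      unfolding eq using i2 that nbI(1)[of "2*m" i] by (intro Bochner_Integration.integral_sum) auto
    also have "\<dots> \<le> q * \<gamma>\<^sup>2" using e2 that by (intro sumq) auto
    finally show "expectation (\<lambda>\<omega>. \<bar>X i \<omega>\<bar> * B i \<omega>) \<le> q * \<gamma>\<^sup>2" .
  qed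
  have iXBB: "integrable M (\<lambda>\<omega>. \<bar>X i \<omega>\<bar> * (B i \<omega>)\<^sup>2)"
    and eXBB: "expectation (\<lambda>\<omega>. \<bar>X i \<omega>\<bar> * (B i \<omega>)\<^sup>2) \<le> q\<^sup>2 * \<gamma>^3" if "i \<in> I" for i
  proof -
    have eq: "(\<lambda>\<omega>. \<bar>X i \<omega>\<bar> * (B i \<omega>)\<^sup>2) = (\<lambda>\<omega>. \<Sum>j\<in>nb (2*m) i. \<Sum>k\<in>nb (2*m) i. \<bar>X i \<omega> * X j \<omega> * X k \<omega>\<bar>)"
      unfolding B_def power2_eq_square sum_product by (simp add: sum_distrib_left abs_mult mult.assoc)
    show "integrable M (\<lambda>\<omega>. \<bar>X i \<omega>\<bar> * (B i \<omega>)\<^sup>2)"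
      unfolding eq using i3 that nbI(1)[of "2*m" i] by (intro integrable_double_sum) auto
    have "expectation (\<lambda>\<omega>. \<bar>X i \<omega>\<bar> * (B i \<omega>)\<^sup>2)
        = (\<Sum>j\<in>nb (2*m) i. \<Sum>k\<in>nb (2*m) i. expectation (\<lambda>\<omega>. \<bar>X i \<omega> * X j \<omega> * X k \<omega>\<bar>))"
      unfolding eq using i3 that nbI(1)[of "2*m" i] by (intro integral_double_sum) auto
    also have "\<dots> \<le> q * (q * \<gamma>^3)" using e3 that q0 \<gamma> by (intro sumq) auto
    finally show "expectation (\<lambda>\<omega>. \<bar>X i \<omega>\<bar> * (B i \<omega>)\<^sup>2) \<le> q\<^sup>2 * \<gamma>^3" by (simp add: power2_eq_square)
  qed

  have orth: "expectation (\<lambda>\<omega>. X i \<omega> * X j \<omega>) = 0" if "i \<in> I" "j \<in> I - nb m i" for i j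
  proof -
    have "(CLINT \<omega>|M. complex_of_real (restrict (\<lambda>i. X i \<omega>) {i} i) * complex_of_real (restrict (\<lambda>i. X i \<omega>) {j} j))
      = (CLINT \<omega>|M. complex_of_real (restrict (\<lambda>i. X i \<omega>) {i} i)) * (CLINT \<omega>|M. complex_of_real (restrict (\<lambda>i. X i \<omega>) {j} j))"
      by (rule m_dependent_lebesgue_integral[OF m]) (use that i1 in \<open>auto simp: nb_def\<close>)
    then have "complex_of_real (expectation (\<lambda>\<omega>. X i \<omega> * X j \<omega>)) = 0"
      using mean that by (simp flip: of_real_mult)
    then show ?thesis by simp
  qed
  have iXYi: "integrable M (\<lambda>\<omega>. X i \<omega> * Y i \<omega>)" if "i \<in> I" for i
    unfolding Y_def sum_distrib_left using iXY that nbI(1)[of m i] by (intro Bochner_Integration.integrable_sum) auto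
  \<comment> \<open>The normalization becomes total weight 1 of the local covariances, which makes
    the coefficient of \<open>\<phi> t\<close> exactly \<open>- t\<close>.\<close>
  have var': "(\<Sum>i\<in>I. expectation (\<lambda>\<omega>. X i \<omega> * Y i \<omega>)) = 1"
  proof -
    have "1 = (\<Sum>i\<in>I. \<Sum>j\<in>I. expectation (\<lambda>\<omega>. X i \<omega> * X j \<omega>))"
      unfolding var[symmetric] power2_eq_square sum_product using iXY
      by (intro integral_double_sum) auto
    also have "\<dots> = (\<Sum>i\<in>I. \<Sum>j\<in>nb m i. expectation (\<lambda>\<omega>. X i \<omega> * X j \<omega>))"
      using orth nbI I by (intro sum.cong refl sum.mono_neutral_right) auto
    also have "\<dots> = (\<Sum>i\<in>I. expectation (\<lambda>\<omega>. X i \<omega> * Y i \<omega>))"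
      unfolding Y_def sum_distrib_left using iXY nbI(1)
      by (intro sum.cong refl Bochner_Integration.integral_sum[symmetric]) blast
    finally show ?thesis by simp
  qed
  have iS: "integrable M S" unfolding S_def[abs_def] using i1 by auto
  have iS2: "integrable M (\<lambda>\<omega>. (S \<omega>)\<^sup>2)"
    unfolding S_def power2_eq_square sum_product using iXY by (intro integrable_double_sum) auto

  define \<phi> where "\<phi> t = (CLINT \<omega>|M. iexp (t * S \<omega>))" for t
  define \<phi>' where "\<phi>' t = \<i> * (CLINT \<omega>|M. S \<omega> * iexp (t * S \<omega>))" for t
  have key: "cmod ((CLINT \<omega>|M. X i \<omega> * iexp (t * S \<omega>)) - \<i> * t * expectation (\<lambda>\<omega>. X i \<omega> * Y i \<omega>) * \<phi> t)
     \<le> 3 * q\<^sup>2 * \<gamma>^3 * t\<^sup>2" if i: "i \<in> I" for i t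
  proof -
    let ?c = "expectation (\<lambda>\<omega>. X i \<omega> * Y i \<omega>)"
    \<comment> \<open>\<open>R1\<close> is the error of expanding the exponential of
      \<open>Y i\<close> to first order, \<open>R2\<close> that of replacing \<open>U i\<close> by
      \<open>V i\<close> in the linear term, so that \<open>X i * Y i\<close> becomes independent of
      the exponential.\<close>
    define R1 where "R1 \<omega> = X i \<omega> * iexp (t * U i \<omega>) * (iexp (t * Y i \<omega>) - 1 - \<i> * (t * Y i \<omega>))" for \<omega>
    define R2 where "R2 \<omega> = \<i> * t * (X i \<omega> * Y i \<omega>) * (iexp (t * U i \<omega>) - iexp (t * V i \<omega>))" for \<omega>
    have bR1: "cmod (R1 \<omega>) \<le> t\<^sup>2 * (\<bar>X i \<omega>\<bar> * (B i \<omega>)\<^sup>2)" for \<omega>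
    proof -
      have "cmod (R1 \<omega>) = \<bar>X i \<omega>\<bar> * cmod (iexp (t * Y i \<omega>) - 1 - \<i> * complex_of_real (t * Y i \<omega>))"
        by (simp only: R1_def norm_mult norm_exp_i_times norm_of_real mult_1_right)
      also have "\<dots> \<le> \<bar>X i \<omega>\<bar> * ((t * Y i \<omega>)\<^sup>2 / 2)"
        by (intro mult_left_mono cmod_iexp_taylor2_le) auto
      also have "\<dots> \<le> \<bar>X i \<omega>\<bar> * (t\<^sup>2 * (B i \<omega>)\<^sup>2)"
      proof (intro mult_left_mono)
        have "(Y i \<omega>)\<^sup>2 \<le> (B i \<omega>)\<^sup>2" using YB B0 by (subst power2_le_iff_abs_le) auto
        then have "t\<^sup>2 * (Y i \<omega>)\<^sup>2 \<le> t\<^sup>2 * (B i \<omega>)\<^sup>2" by (intro mult_left_mono) auto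
        then show "(t * Y i \<omega>)\<^sup>2 / 2 \<le> t\<^sup>2 * (B i \<omega>)\<^sup>2"
          using zero_le_power2[of "t * Y i \<omega>"] unfolding power_mult_distrib by linarith
      qed simp
      finally show ?thesis by (simp add: mult_ac)
    qed
    have bR2: "cmod (R2 \<omega>) \<le> t\<^sup>2 * (\<bar>X i \<omega>\<bar> * (B i \<omega>)\<^sup>2)" for \<omega>
    proof -
      have "cmod (R2 \<omega>) = \<bar>t\<bar> * (\<bar>X i \<omega>\<bar> * \<bar>Y i \<omega>\<bar>) * cmod (iexp (t * U i \<omega>) - iexp (t * V i \<omega>))"
        by (simp only: R2_def norm_mult norm_of_real norm_ii mult_1_left abs_mult)
      also have "\<dots> \<le> \<bar>t\<bar> * (\<bar>X i \<omega>\<bar> * B i \<omega>) * \<bar>t * U i \<omega> - t * V i \<omega>\<bar>"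
        using YB B0 by (intro mult_mono cmod_iexp_diff_le mult_nonneg_nonneg) auto
      also have "\<dots> = \<bar>t\<bar> * (\<bar>X i \<omega>\<bar> * B i \<omega>) * (\<bar>t\<bar> * \<bar>U i \<omega> - V i \<omega>\<bar>)"
        by (simp flip: abs_mult right_diff_distrib)
      also have "\<dots> \<le> \<bar>t\<bar> * (\<bar>X i \<omega>\<bar> * B i \<omega>) * (\<bar>t\<bar> * B i \<omega>)"
        using UVB B0 by (intro mult_mono mult_nonneg_nonneg) auto
      also have "\<dots> = t\<^sup>2 * (\<bar>X i \<omega>\<bar> * (B i \<omega>)\<^sup>2)"
        unfolding power2_abs[of t, symmetric] power2_eq_square by (simp only: mult_ac)
      finally show ?thesis .
    qed
    have [measurable]: "R1 \<in> borel_measurable M" "R2 \<in> borel_measurable M"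
      unfolding R1_def[abs_def] R2_def[abs_def] by measurable
    have iR: "integrable M (\<lambda>\<omega>. t\<^sup>2 * (\<bar>X i \<omega>\<bar> * (B i \<omega>)\<^sup>2))" using iXBB[OF i] by simp
    have iR1: "integrable M R1" and iR2: "integrable M R2"
      by (rule Bochner_Integration.integrable_bound[OF iR]; use bR1 bR2 B0 in \<open>auto simp: abs_mult\<close>)+
    have eR: "expectation (\<lambda>\<omega>. t\<^sup>2 * (\<bar>X i \<omega>\<bar> * (B i \<omega>)\<^sup>2)) \<le> t\<^sup>2 * (q\<^sup>2 * \<gamma>^3)"
      using eXBB[OF i] by (simp add: mult_left_mono)
    have eR1: "cmod (CLINT \<omega>|M. R1 \<omega>) \<le> t\<^sup>2 * (q\<^sup>2 * \<gamma>^3)"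
      by (rule order_trans[OF norm_integral_le_integral[OF iR bR1] eR])
    have eR2: "cmod (CLINT \<omega>|M. R2 \<omega>) \<le> t\<^sup>2 * (q\<^sup>2 * \<gamma>^3)"
      by (rule order_trans[OF norm_integral_le_integral[OF iR bR2] eR])
    have iU: "integrable M (\<lambda>\<omega>. iexp (t * U i \<omega>))" and iV: "integrable M (\<lambda>\<omega>. iexp (t * V i \<omega>))"
      and iSe: "integrable M (\<lambda>\<omega>. iexp (t * S \<omega>))"
      by (rule integrable_const_bound[where B=1]; auto)+
    have iXU: "integrable M (\<lambda>\<omega>. X i \<omega> * iexp (t * U i \<omega>))"
      by (rule Bochner_Integration.integrable_bound[OF i1[OF i]]) (auto simp: norm_mult)
    have iXYV: "integrable M (\<lambda>\<omega>. complex_of_real (X i \<omega> * Y i \<omega>) * iexp (t * V i \<omega>))"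
      by (rule Bochner_Integration.integrable_bound[OF iXYi[OF i]]) (auto simp: norm_mult abs_mult)
    have XU: "(CLINT \<omega>|M. X i \<omega> * iexp (t * U i \<omega>)) = 0"
    proof -
      let ?G = "\<lambda>f :: nat \<Rightarrow> real. iexp (t * (\<Sum>j\<in>I - nb m i. f j))"
      have G: "?G (restrict (\<lambda>i. X i \<omega>) (I - nb m i)) = iexp (t * U i \<omega>)" for \<omega>
        by (simp add: U_def)
      have "(CLINT \<omega>|M. complex_of_real (restrict (\<lambda>i. X i \<omega>) {i} i) * ?G (restrict (\<lambda>i. X i \<omega>) (I - nb m i)))
        = (CLINT \<omega>|M. complex_of_real (restrict (\<lambda>i. X i \<omega>) {i} i)) * (CLINT \<omega>|M. ?G (restrict (\<lambda>i. X i \<omega>) (I - nb m i)))"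
        by (rule m_dependent_lebesgue_integral[OF m], unfold G) (use i iU i1 in \<open>auto simp: nb_def\<close>)
      then show ?thesis unfolding G using mean[OF i] by simp
    qed
    \<comment> \<open>Indices within \<open>m\<close> of \<open>i\<close> and indices more than
      \<open>2 * m\<close> away from \<open>i\<close> are more than \<open>m\<close> apart.\<close>
    have XYV: "(CLINT \<omega>|M. complex_of_real (X i \<omega> * Y i \<omega>) * iexp (t * V i \<omega>)) = ?c * (CLINT \<omega>|M. iexp (t * V i \<omega>))"
    proof -
      let ?F = "\<lambda>f :: nat \<Rightarrow> real. complex_of_real (f i * (\<Sum>j\<in>nb m i. f j))"
      let ?G = "\<lambda>f :: nat \<Rightarrow> real. iexp (t * (\<Sum>j\<in>I - nb (2*m) i. f j))"
      have ii: "i \<in> nb m i" using i by (simp add: nb_def)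
      have F: "?F (restrict (\<lambda>i. X i \<omega>) (nb m i)) = complex_of_real (X i \<omega> * Y i \<omega>)" for \<omega>
        using ii by (simp add: Y_def)
      have G: "?G (restrict (\<lambda>i. X i \<omega>) (I - nb (2*m) i)) = iexp (t * V i \<omega>)" for \<omega>
        by (simp add: V_def)
      have "(CLINT \<omega>|M. ?F (restrict (\<lambda>i. X i \<omega>) (nb m i)) * ?G (restrict (\<lambda>i. X i \<omega>) (I - nb (2*m) i)))
        = (CLINT \<omega>|M. ?F (restrict (\<lambda>i. X i \<omega>) (nb m i))) * (CLINT \<omega>|M. ?G (restrict (\<lambda>i. X i \<omega>) (I - nb (2*m) i)))"
      proof (rule m_dependent_lebesgue_integral[OF m nbI(1)])
        show "?F \<in> borel_measurable (PiM (nb m i) (\<lambda>_. borel))"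
          using ii by measurable
        show "?G \<in> borel_measurable (PiM (I - nb (2*m) i) (\<lambda>_. borel))"
          by measurable
        show "integrable M (\<lambda>\<omega>. ?F (restrict (\<lambda>i. X i \<omega>) (nb m i)))"
          unfolding F using iXYi[OF i] by (rule integrable_of_real)
        show "integrable M (\<lambda>\<omega>. ?G (restrict (\<lambda>i. X i \<omega>) (I - nb (2*m) i)))"
          unfolding G by (rule iV)
      qed (auto simp: nb_def)
      then show ?thesis unfolding F G integral_complex_of_real .
    qed
    have eq: "X i \<omega> * iexp (t * S \<omega>) = X i \<omega> * iexp (t * U i \<omega>)
       + \<i> * t * (complex_of_real (X i \<omega> * Y i \<omega>) * iexp (t * V i \<omega>)) + R2 \<omega> + R1 \<omega>" for \<omega>
    proof -
      have "iexp (t * S \<omega>) = iexp (t * U i \<omega>) * iexp (t * Y i \<omega>)"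
        by (simp add: SUY[of \<omega> i] distrib_left exp_add)
      then show ?thesis by (simp add: R1_def R2_def algebra_simps)
    qed
    have "(CLINT \<omega>|M. X i \<omega> * iexp (t * S \<omega>))
      = \<i> * t * (?c * (CLINT \<omega>|M. iexp (t * V i \<omega>))) + (CLINT \<omega>|M. R2 \<omega>) + (CLINT \<omega>|M. R1 \<omega>)"
    proof -
      have i: "integrable M (\<lambda>\<omega>. \<i> * t * (complex_of_real (X i \<omega> * Y i \<omega>) * iexp (t * V i \<omega>)))"
        using iXYV by (intro integrable_mult_right)
      show ?thesis
        unfolding eq using iXU i iR1 iR2 XU XYV
        by (simp only: Bochner_Integration.integral_add Bochner_Integration.integrable_add
            integral_mult_right_zero add_0)
    qed
    then have "(CLINT \<omega>|M. X i \<omega> * iexp (t * S \<omega>)) - \<i> * t * ?c * \<phi> t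
      = \<i> * t * ?c * ((CLINT \<omega>|M. iexp (t * V i \<omega>)) - \<phi> t) + (CLINT \<omega>|M. R2 \<omega>) + (CLINT \<omega>|M. R1 \<omega>)"
      by (simp add: algebra_simps)
    also have "cmod \<dots> \<le> cmod (\<i> * t * ?c * ((CLINT \<omega>|M. iexp (t * V i \<omega>)) - \<phi> t)) + cmod (CLINT \<omega>|M. R2 \<omega>)
       + cmod (CLINT \<omega>|M. R1 \<omega>)"
      by (intro norm_triangle_mono order_refl)
    \<comment> \<open>A third error of the same order: the return from \<open>V i\<close> to
      \<open>S\<close>. Together with \<open>R1\<close> and \<open>R2\<close> it accounts for the
      factor 3.\<close>
    also have "cmod (\<i> * t * ?c * ((CLINT \<omega>|M. iexp (t * V i \<omega>)) - \<phi> t)) \<le> \<bar>t\<bar> * (q * \<gamma>\<^sup>2) * (\<bar>t\<bar> * (q * \<gamma>))"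
    proof -
      have "\<bar>?c\<bar> \<le> expectation (\<lambda>\<omega>. \<bar>X i \<omega>\<bar> * B i \<omega>)"
        using norm_integral_le_integral[OF iXB[OF i], of "\<lambda>\<omega>. X i \<omega> * Y i \<omega>"] YB
        by (simp add: abs_mult mult_left_mono)
      also have "\<dots> \<le> q * \<gamma>\<^sup>2" by (rule eXB[OF i])
      finally have c: "\<bar>?c\<bar> \<le> q * \<gamma>\<^sup>2" .
      have "(CLINT \<omega>|M. iexp (t * V i \<omega>)) - \<phi> t = (CLINT \<omega>|M. iexp (t * V i \<omega>) - iexp (t * S \<omega>))"
        unfolding \<phi>_def using iV iSe by simp
      also have "cmod \<dots> \<le> (\<integral>\<omega>. \<bar>t\<bar> * B i \<omega> \<partial>M)"
      proof (rule norm_integral_le_integral)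
        fix \<omega>
        have "cmod (iexp (t * V i \<omega>) - iexp (t * S \<omega>)) \<le> \<bar>t\<bar> * \<bar>V i \<omega> - S \<omega>\<bar>"
          using cmod_iexp_diff_le[of "t * V i \<omega>" "t * S \<omega>"]
          by (simp only: abs_mult flip: right_diff_distrib)
        also have "\<dots> \<le> \<bar>t\<bar> * B i \<omega>" using SVB by (intro mult_left_mono) auto
        finally show "cmod (iexp (t * V i \<omega>) - iexp (t * S \<omega>)) \<le> \<bar>t\<bar> * B i \<omega>" .
      qed (use iB in auto)
      also have "\<dots> \<le> \<bar>t\<bar> * (q * \<gamma>)" using eB[of i] by (simp add: mult_left_mono)
      finally have "cmod ((CLINT \<omega>|M. iexp (t * V i \<omega>)) - \<phi> t) \<le> \<bar>t\<bar> * (q * \<gamma>)" .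
      with c show ?thesis
        unfolding norm_mult norm_of_real norm_ii mult_1_left
        using q0 \<gamma> by (intro mult_mono) auto
    qed
    also have "\<bar>t\<bar> * (q * \<gamma>\<^sup>2) * (\<bar>t\<bar> * (q * \<gamma>)) = t\<^sup>2 * (q\<^sup>2 * \<gamma>^3)"
      unfolding power2_abs[of t, symmetric] power2_eq_square power3_eq_cube by (simp only: mult_ac)
    finally show ?thesis using eR1 eR2 by (simp add: mult_ac)
  qed

  have "cmod (\<phi>' t + t * \<phi> t) \<le> (3 * q\<^sup>2 * (card I * \<gamma>^3)) * t\<^sup>2" for t
  proof -
    have iXS: "integrable M (\<lambda>\<omega>. X i \<omega> * iexp (t * S \<omega>))" if "i \<in> I" for i
      by (rule Bochner_Integration.integrable_bound[OF i1[OF that]]) (auto simp: norm_mult)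
    have "\<phi>' t = \<i> * (\<Sum>i\<in>I. CLINT \<omega>|M. X i \<omega> * iexp (t * S \<omega>))"
    proof -
      have "(\<lambda>\<omega>. S \<omega> * iexp (t * S \<omega>)) = (\<lambda>\<omega>. \<Sum>i\<in>I. X i \<omega> * iexp (t * S \<omega>))"
        by (simp add: fun_eq_iff S_def sum_distrib_right)
      then show ?thesis unfolding \<phi>'_def using iXS by (simp add: Bochner_Integration.integral_sum)
    qed
    moreover have "t * \<phi> t = \<i> * (\<Sum>i\<in>I. - (\<i> * t * expectation (\<lambda>\<omega>. X i \<omega> * Y i \<omega>) * \<phi> t))"
    proof -
      have "(\<Sum>i\<in>I. - (\<i> * t * expectation (\<lambda>\<omega>. X i \<omega> * Y i \<omega>) * \<phi> t))
        = - (\<i> * t * complex_of_real (\<Sum>i\<in>I. expectation (\<lambda>\<omega>. X i \<omega> * Y i \<omega>)) * \<phi> t)"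
        unfolding of_real_sum sum_distrib_left sum_distrib_right sum_negf ..
      then show ?thesis unfolding var' by (simp flip: mult.assoc)
    qed
    ultimately have "\<phi>' t + t * \<phi> t = \<i> * (\<Sum>i\<in>I. (CLINT \<omega>|M. X i \<omega> * iexp (t * S \<omega>))
        - \<i> * t * expectation (\<lambda>\<omega>. X i \<omega> * Y i \<omega>) * \<phi> t)"
      by (simp add: sum_subtractf sum_negf right_diff_distrib)
    also have "cmod \<dots> \<le> (\<Sum>i\<in>I. 3 * q\<^sup>2 * \<gamma>^3 * t\<^sup>2)"
      unfolding norm_mult norm_ii mult_1_left by (intro sum_norm_le key)
    also have "\<dots> = (3 * q\<^sup>2 * (card I * \<gamma>^3)) * t\<^sup>2" by simp
    finally show ?thesis .
  qed
  moreover have "(\<phi> has_vector_derivative \<phi>' t) (at t)" for t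
    unfolding \<phi>_def[abs_def] \<phi>'_def by (rule chf_has_vector_derivative[OF _ iS iS2]) simp
  moreover have "\<phi> 0 = 1" by (simp add: \<phi>_def prob_space)
  ultimately have "cmod (\<phi> t - complex_of_real (exp (- t\<^sup>2 / 2))) \<le> (3 * q\<^sup>2 * (card I * \<gamma>^3)) * \<bar>t\<bar>^3"
    by (intro gaussian_chf_perturbation)
  moreover have "char (distr M borel (\<lambda>\<omega>. \<Sum>i\<in>I. X i \<omega>)) t = \<phi> t"
    unfolding char_def \<phi>_def S_def[abs_def] by (subst integral_distr) auto
  ultimately show ?thesis by (simp add: q_def add.commute)
qed

section \<open>Gaussian processes and the Ornstein-Uhlenbeck innovations\<close>

text \<open>The linear span of the process. For a Gaussian process each member is normal, and this
  is the only form in which joint normality is ever used.\<close>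

definition lin_comb :: "('i \<Rightarrow> 'a \<Rightarrow> real) \<Rightarrow> 'i set \<Rightarrow> ('a \<Rightarrow> real) \<Rightarrow> bool" where
  "lin_comb Z T X \<longleftrightarrow> (\<exists>F c. finite F \<and> F \<subseteq> T \<and> X = (\<lambda>\<omega>. \<Sum>t\<in>F. c t * Z t \<omega>))"

lemma lin_comb_base: "t \<in> T \<Longrightarrow> lin_comb Z T (Z t)"
  unfolding lin_comb_def by (intro exI[of _ "{t}"] exI[of _ "\<lambda>_. 1"]) auto

lemma lin_comb_zero: "lin_comb Z T (\<lambda>_. 0)"
  unfolding lin_comb_def by (intro exI[of _ "{}"]) auto

lemma lin_comb_scale: "lin_comb Z T X \<Longrightarrow> lin_comb Z T (\<lambda>\<omega>. a * X \<omega>)"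
  unfolding lin_comb_def
proof (elim exE conjE)
  fix F c assume "finite F" "F \<subseteq> T" "X = (\<lambda>\<omega>. \<Sum>t\<in>F. c t * Z t \<omega>)"
  then show "\<exists>F c. finite F \<and> F \<subseteq> T \<and> (\<lambda>\<omega>. a * X \<omega>) = (\<lambda>\<omega>. \<Sum>t\<in>F. c t * Z t \<omega>)"
    by (intro exI[of _ F] exI[of _ "\<lambda>t. a * c t"]) (auto simp: sum_distrib_left mult_ac)
qed

lemma lin_comb_add: assumes "lin_comb Z T X" "lin_comb Z T Y" shows "lin_comb Z T (\<lambda>\<omega>. X \<omega> + Y \<omega>)"
proof -
  obtain F c G e where F: "finite F" "F \<subseteq> T" "X = (\<lambda>\<omega>. \<Sum>t\<in>F. c t * Z t \<omega>)"
    and G: "finite G" "G \<subseteq> T" "Y = (\<lambda>\<omega>. \<Sum>t\<in>G. e t * Z t \<omega>)"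
    using assms unfolding lin_comb_def by blast
  have "X \<omega> + Y \<omega> = (\<Sum>t\<in>F \<union> G. (of_bool (t \<in> F) * c t + of_bool (t \<in> G) * e t) * Z t \<omega>)" for \<omega>
  proof -
    have "X \<omega> = (\<Sum>t\<in>F \<union> G. of_bool (t \<in> F) * c t * Z t \<omega>)"
      unfolding F(3) using F(1) G(1) by (intro sum.mono_neutral_cong_left) auto
    moreover have "Y \<omega> = (\<Sum>t\<in>F \<union> G. of_bool (t \<in> G) * e t * Z t \<omega>)"
      unfolding G(3) using F(1) G(1) by (intro sum.mono_neutral_cong_left) auto
    ultimately show ?thesis by (simp add: sum.distrib distrib_right)
  qed
  then show ?thesis
    unfolding lin_comb_def using F G
    by (intro exI[of _ "F \<union> G"] exI[of _ "\<lambda>t. of_bool (t \<in> F) * c t + of_bool (t \<in> G) * e t"]) auto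
qed

lemma lin_comb_diff: "lin_comb Z T X \<Longrightarrow> lin_comb Z T Y \<Longrightarrow> lin_comb Z T (\<lambda>\<omega>. X \<omega> - Y \<omega>)"
  using lin_comb_add[OF _ lin_comb_scale[of Z T Y "- 1"]] by simp

lemma lin_comb_sum:
  "(\<And>i. i \<in> I \<Longrightarrow> lin_comb Z T (X i)) \<Longrightarrow> lin_comb Z T (\<lambda>\<omega>. \<Sum>i\<in>I. X i \<omega>)"
  by (induction I rule: infinite_finite_induct) (auto intro: lin_comb_zero lin_comb_add)

text \<open>The degenerate case stays in, since a linear combination may vanish almost surely, for
  instance when all its coefficients are 0.\<close>

definition centered_normal :: "'a measure \<Rightarrow> ('a \<Rightarrow> real) \<Rightarrow> bool" where
  "centered_normal M X \<longleftrightarrow> X \<in> borel_measurable M \<and>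
     ((AE \<omega> in M. X \<omega> = 0) \<or> (\<exists>\<sigma>>0. distributed M lborel X (\<lambda>x. ennreal (normal_density 0 \<sigma> x))))"

context prob_space
begin

lemma normal_rv_integrable:
  assumes "normal_rv M X" shows "integrable M X"
proof -
  have X: "X \<in> borel_measurable M" using assms by (simp add: normal_rv_def)
  show ?thesis
  proof (cases "\<exists>\<mu>. AE \<omega> in M. X \<omega> = \<mu>")
    case True
    then obtain \<mu> where "AE \<omega> in M. X \<omega> = \<mu>" by auto
    then show ?thesis using integrable_cong_AE[of X M "\<lambda>_. \<mu>"] X by auto
  next
    case False
    then obtain \<mu> \<sigma> where "0 < \<sigma>" and d: "distributed M lborel X (\<lambda>x. ennreal (normal_density \<mu> \<sigma> x))"
      using assms by (auto simp: normal_rv_def)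
    then show ?thesis
      using distributed_integrable[OF d, of "\<lambda>x. x"] integrable_normal_moment_nz_1[of \<sigma> \<mu>] by simp
  qed
qed

lemma centered_normal_of_normal_rv:
  assumes "normal_rv M X" "expectation X = 0"
  shows "centered_normal M X"
proof -
  have X: "X \<in> borel_measurable M" using assms by (simp add: normal_rv_def)
  show ?thesis
  proof (cases "\<exists>\<mu>. AE \<omega> in M. X \<omega> = \<mu>")
    case True
    then obtain \<mu> where \<mu>: "AE \<omega> in M. X \<omega> = \<mu>" by auto
    then have "expectation X = expectation (\<lambda>_. \<mu>)" using X by (intro integral_cong_AE) auto
    then have "\<mu> = 0" using assms(2) by (simp add: prob_space)
    then show ?thesis using \<mu> X by (simp add: centered_normal_def)
  next
    case False
    then obtain \<mu> \<sigma> where \<sigma>: "0 < \<sigma>" and d: "distributed M lborel X (\<lambda>x. ennreal (normal_density \<mu> \<sigma> x))"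
      using assms by (auto simp: normal_rv_def)
    then have "\<mu> = 0" using normal_distributed_expectation[OF \<sigma> d] assms(2) by simp
    then show ?thesis using d \<sigma> X by (auto simp: centered_normal_def)
  qed
qed

text \<open>The formulas are phrased through the second moment and not through a scale parameter, so
  that they also cover variance 0. The factors 3 and 15 are the fourth and sixth moments of a
  standard normal variable.\<close>

lemma centered_normal_moments:
  assumes "centered_normal M X"
  shows "integrable M (\<lambda>\<omega>. X \<omega> ^ k)"
    and "expectation (\<lambda>\<omega>. X \<omega> ^ 4) = 3 * (expectation (\<lambda>\<omega>. (X \<omega>)\<^sup>2))\<^sup>2"
    and "expectation (\<lambda>\<omega>. X \<omega> ^ 6) = 15 * (expectation (\<lambda>\<omega>. (X \<omega>)\<^sup>2)) ^ 3"
    and "(CLINT \<omega>|M. iexp (t * X \<omega>)) = exp (- (t\<^sup>2 * expectation (\<lambda>\<omega>. (X \<omega>)\<^sup>2) / 2))"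
proof -
  have X[measurable]: "X \<in> borel_measurable M" using assms by (simp add: centered_normal_def)
  have "integrable M (\<lambda>\<omega>. X \<omega> ^ k) \<and> expectation (\<lambda>\<omega>. X \<omega> ^ 4) = 3 * (expectation (\<lambda>\<omega>. (X \<omega>)\<^sup>2))\<^sup>2 \<and>
    expectation (\<lambda>\<omega>. X \<omega> ^ 6) = 15 * (expectation (\<lambda>\<omega>. (X \<omega>)\<^sup>2)) ^ 3 \<and>
    (CLINT \<omega>|M. iexp (t * X \<omega>)) = exp (- (t\<^sup>2 * expectation (\<lambda>\<omega>. (X \<omega>)\<^sup>2) / 2))"
  proof (cases "AE \<omega> in M. X \<omega> = 0")
    case True
    have e: "expectation (\<lambda>\<omega>. X \<omega> ^ j) = 0" if "j > 0" for j
    proof -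
      have "expectation (\<lambda>\<omega>. X \<omega> ^ j) = expectation (\<lambda>\<omega>. 0)"
        using True that by (intro integral_cong_AE) auto
      then show ?thesis by simp
    qed
    have "integrable M (\<lambda>\<omega>. X \<omega> ^ k)"
    proof -
      have "AE \<omega> in M. X \<omega> ^ k = 0 ^ k" using True by eventually_elim simp
      then show ?thesis using integrable_cong_AE[of "\<lambda>\<omega>. X \<omega> ^ k" M "\<lambda>_. 0 ^ k"] by auto
    qed
    moreover have "(CLINT \<omega>|M. iexp (t * X \<omega>)) = (CLINT \<omega>|M. 1)"
      using True by (intro integral_cong_AE) auto
    ultimately show ?thesis using e by (simp add: prob_space)
  next
    case False
    then obtain \<sigma> where \<sigma>: "0 < \<sigma>" and d: "distributed M lborel X (\<lambda>x. ennreal (normal_density 0 \<sigma> x))"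
      using assms by (auto simp: centered_normal_def)
    have even: "expectation (\<lambda>\<omega>. X \<omega> ^ (2 * j)) = fact (2 * j) / ((2 / \<sigma>\<^sup>2)^j * fact j)" for j
      using distributed_integral[OF d, of "\<lambda>x. x ^ (2 * j)"] integral_normal_moment_even[OF \<sigma>, of 0 j] by simp
    have i: "integrable M (\<lambda>\<omega>. X \<omega> ^ k)"
      using distributed_integrable[OF d, of "\<lambda>x. x ^ k"] integrable_normal_moment[OF \<sigma>, of 0 k] by simp
    have e2: "expectation (\<lambda>\<omega>. (X \<omega>)\<^sup>2) = \<sigma>\<^sup>2" using even[of 1] by simp
    have e4: "expectation (\<lambda>\<omega>. X \<omega> ^ 4) = 3 * (\<sigma>\<^sup>2)\<^sup>2"
      using even[of 2] by (simp add: fact_numeral power_divide)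
    have e6: "expectation (\<lambda>\<omega>. X \<omega> ^ 6) = 15 * (\<sigma>\<^sup>2)^3"
      using even[of 3] by (simp add: fact_numeral power_divide)
    have "distributed M lborel (\<lambda>\<omega>. X \<omega> / \<sigma>) std_normal_density"
      using d normal_standard_normal_convert[OF \<sigma>, of X 0] by simp
    then have "distr M lborel (\<lambda>\<omega>. X \<omega> / \<sigma>) = std_normal_distribution"
      by (rule distributed_distr_eq_density)
    then have "distr M borel (\<lambda>\<omega>. X \<omega> / \<sigma>) = std_normal_distribution"
      by (metis distr_cong sets_lborel)
    then have "char (distr M borel (\<lambda>\<omega>. X \<omega> / \<sigma>)) (t * \<sigma>) = exp (- (t * \<sigma>)\<^sup>2 / 2)"
      by (simp add: char_std_normal_distribution)
    moreover have "char (distr M borel (\<lambda>\<omega>. X \<omega> / \<sigma>)) (t * \<sigma>) = (CLINT \<omega>|M. iexp (t * X \<omega>))"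
      unfolding char_def using \<sigma> by (subst integral_distr) auto
    ultimately show ?thesis using i e4 e6 unfolding e2 by (simp add: power_mult_distrib)
  qed
  then show "integrable M (\<lambda>\<omega>. X \<omega> ^ k)"
    and "expectation (\<lambda>\<omega>. X \<omega> ^ 4) = 3 * (expectation (\<lambda>\<omega>. (X \<omega>)\<^sup>2))\<^sup>2"
    and "expectation (\<lambda>\<omega>. X \<omega> ^ 6) = 15 * (expectation (\<lambda>\<omega>. (X \<omega>)\<^sup>2)) ^ 3"
    and "(CLINT \<omega>|M. iexp (t * X \<omega>)) = exp (- (t\<^sup>2 * expectation (\<lambda>\<omega>. (X \<omega>)\<^sup>2) / 2))"
    by blast+
qed

end

section \<open>The Ornstein-Uhlenbeck process and its innovations\<close>

locale ou = prob_space M for M :: "'a measure" +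
  fixes \<theta>\<^sub>0 v\<^sub>0 :: real and Z :: "real \<Rightarrow> 'a \<Rightarrow> real"
  assumes \<theta>\<^sub>0: "0 < \<theta>\<^sub>0" and v\<^sub>0: "0 < v\<^sub>0" and ou: "OU_process M \<theta>\<^sub>0 v\<^sub>0 Z"
begin

abbreviation lc :: "('a \<Rightarrow> real) \<Rightarrow> bool" where "lc \<equiv> lin_comb Z {0..1}"

lemma lc_normal_rv: "lc X \<Longrightarrow> normal_rv M X"
  using ou unfolding OU_process_def gaussian_process_def lin_comb_def by blast

lemma lc_expectation: assumes "lc X" shows "expectation X = 0"
proof -
  obtain F c where F: "finite F" "F \<subseteq> {0..1}" "X = (\<lambda>\<omega>. \<Sum>t\<in>F. c t * Z t \<omega>)"
    using assms unfolding lin_comb_def by blast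
  have "expectation X = (\<Sum>t\<in>F. c t * expectation (Z t))"
    unfolding F(3) using normal_rv_integrable[OF lc_normal_rv[OF lin_comb_base]] F(2)
    by (subst Bochner_Integration.integral_sum) auto
  also have "\<dots> = 0" using ou F(2) unfolding OU_process_def by (intro sum.neutral) auto
  finally show ?thesis .
qed

lemma lc_centered_normal: "lc X \<Longrightarrow> centered_normal M X"
  using centered_normal_of_normal_rv lc_normal_rv lc_expectation by blast

lemma lc_measurable: "lc X \<Longrightarrow> X \<in> borel_measurable M"
  using lc_normal_rv by (auto simp: normal_rv_def)

lemma lc_integrable_power: "lc X \<Longrightarrow> integrable M (\<lambda>\<omega>. X \<omega> ^ k)"
  by (intro centered_normal_moments lc_centered_normal)

lemma lc_integrable_mult:
  assumes "lc X" "lc Y" shows "integrable M (\<lambda>\<omega>. X \<omega> * Y \<omega>)"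
proof -
  have "integrable M (\<lambda>\<omega>. ((X \<omega> + Y \<omega>)^2 - (X \<omega> - Y \<omega>)^2) / 4)"
    using lc_integrable_power[OF lin_comb_add[OF assms]] lc_integrable_power[OF lin_comb_diff[OF assms]] by auto
  moreover have "((x + y)^2 - (x - y)^2) / 4 = x * y" for x y :: real
    by (simp add: power2_eq_square algebra_simps)
  ultimately show ?thesis by simp
qed

text \<open>Polarization expresses x^2 y^2 through the fourth powers of x, y, x + y and x - y. Each
  of these is a single centred normal variable, whose fourth moment is three times the squared
  variance.\<close>

lemma isserlis:
  assumes "lc X" "lc Y"
  shows "integrable M (\<lambda>\<omega>. (X \<omega>)\<^sup>2 * (Y \<omega>)\<^sup>2)"
    and "expectation (\<lambda>\<omega>. (X \<omega>)\<^sup>2 * (Y \<omega>)\<^sup>2)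
      = expectation (\<lambda>\<omega>. (X \<omega>)\<^sup>2) * expectation (\<lambda>\<omega>. (Y \<omega>)\<^sup>2) + 2 * (expectation (\<lambda>\<omega>. X \<omega> * Y \<omega>))\<^sup>2"
proof -
  note cn = lc_centered_normal[OF assms(1)] lc_centered_normal[OF assms(2)]
    lc_centered_normal[OF lin_comb_add[OF assms]] lc_centered_normal[OF lin_comb_diff[OF assms]]
  note i = cn[THEN centered_normal_moments(1)] and e = cn[THEN centered_normal_moments(2)]
  have eq: "x\<^sup>2 * y\<^sup>2 = ((x + y)^4 + (x - y)^4 - 2 * x^4 - 2 * y^4) / 12" for x y :: real
    by (simp add: power2_eq_square power4_eq_xxxx algebra_simps)
  show "integrable M (\<lambda>\<omega>. (X \<omega>)\<^sup>2 * (Y \<omega>)\<^sup>2)" unfolding eq using i by auto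
  have xy: "integrable M (\<lambda>\<omega>. X \<omega> * Y \<omega>)" by (rule lc_integrable_mult[OF assms])
  have p: "expectation (\<lambda>\<omega>. (X \<omega> + Y \<omega>)\<^sup>2) = expectation (\<lambda>\<omega>. (X \<omega>)\<^sup>2) + expectation (\<lambda>\<omega>. (Y \<omega>)\<^sup>2)
     + 2 * expectation (\<lambda>\<omega>. X \<omega> * Y \<omega>)"
    using i(1)[of 2] i(2)[of 2] xy by (simp add: power2_sum mult.assoc)
  have m: "expectation (\<lambda>\<omega>. (X \<omega> - Y \<omega>)\<^sup>2) = expectation (\<lambda>\<omega>. (X \<omega>)\<^sup>2) + expectation (\<lambda>\<omega>. (Y \<omega>)\<^sup>2)
     - 2 * expectation (\<lambda>\<omega>. X \<omega> * Y \<omega>)"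
    using i(1)[of 2] i(2)[of 2] xy by (simp add: power2_diff mult.assoc)
  have "expectation (\<lambda>\<omega>. (X \<omega>)\<^sup>2 * (Y \<omega>)\<^sup>2) = (expectation (\<lambda>\<omega>. (X \<omega> + Y \<omega>)^4) + expectation (\<lambda>\<omega>. (X \<omega> - Y \<omega>)^4)
     - 2 * expectation (\<lambda>\<omega>. X \<omega>^4) - 2 * expectation (\<lambda>\<omega>. Y \<omega>^4)) / 12"
    unfolding eq using i[of 4] by simp
  then show "expectation (\<lambda>\<omega>. (X \<omega>)\<^sup>2 * (Y \<omega>)\<^sup>2)
      = expectation (\<lambda>\<omega>. (X \<omega>)\<^sup>2) * expectation (\<lambda>\<omega>. (Y \<omega>)\<^sup>2) + 2 * (expectation (\<lambda>\<omega>. X \<omega> * Y \<omega>))\<^sup>2"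
    unfolding e p m by (simp add: power2_eq_square algebra_simps)
qed

lemma expectation_Z_Z:
  assumes "s \<in> {0..1}" "t \<in> {0..1}"
  shows "expectation (\<lambda>\<omega>. Z s \<omega> * Z t \<omega>) = v\<^sub>0 * exp (- \<theta>\<^sub>0 * \<bar>s - t\<bar>)"
proof -
  have "covariance_of M (Z s) (Z t) = v\<^sub>0 * exp (- \<theta>\<^sub>0 * \<bar>s - t\<bar>)"
    and "expectation (Z s) = 0" "expectation (Z t) = 0"
    using ou assms unfolding OU_process_def by auto
  then show ?thesis by (simp add: covariance_of_def)
qed

text \<open>The error of predicting \<open>Z t\<close> from \<open>Z s\<close>, scaled to variance 1
  when s < t. Allowing arbitrary s and t yields both the \<open>W\<close> of every lag and the
  independent adjacent innovations.\<close>

definition innov :: "real \<Rightarrow> real \<Rightarrow> 'a \<Rightarrow> real" where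
  "innov s t \<omega> = (Z t \<omega> - exp (- \<theta>\<^sub>0 * (t - s)) * Z s \<omega>) / sqrt (v\<^sub>0 * (1 - exp (- 2 * \<theta>\<^sub>0 * (t - s))))"

lemma innov_scale_pos: "s < t \<Longrightarrow> 0 < v\<^sub>0 * (1 - exp (- 2 * \<theta>\<^sub>0 * (t - s)))"
  using \<theta>\<^sub>0 v\<^sub>0 by simp

lemma W_sq_eq_innov: "s < t \<Longrightarrow> W_sq \<theta>\<^sub>0 v\<^sub>0 (\<lambda>t. Z t \<omega>) s t = (innov s t \<omega>)\<^sup>2"
  unfolding W_sq_def innov_def power_divide
  by (subst real_sqrt_pow2[OF less_imp_le[OF innov_scale_pos]]) auto

lemma lc_innov: assumes "s \<in> {0..1}" "t \<in> {0..1}" shows "lc (innov s t)"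
proof -
  have "lc (\<lambda>\<omega>. (1 / sqrt (v\<^sub>0 * (1 - exp (- 2 * \<theta>\<^sub>0 * (t - s))))) * (Z t \<omega> - exp (- \<theta>\<^sub>0 * (t - s)) * Z s \<omega>))"
    by (intro lin_comb_scale lin_comb_diff lin_comb_base assms)
  then show ?thesis by (simp add: innov_def[abs_def])
qed

text \<open>The Markov property in covariance form: for r \<le> s < t the exponential covariance
  factors through the intermediate point s.\<close>

lemma innov_orthogonal_past:
  assumes "s \<in> {0..1}" "t \<in> {0..1}" "r \<in> {0..1}" "r \<le> s" "s < t"
  shows "expectation (\<lambda>\<omega>. innov s t \<omega> * Z r \<omega>) = 0"
proof -
  let ?c = "sqrt (v\<^sub>0 * (1 - exp (- 2 * \<theta>\<^sub>0 * (t - s))))"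
  have i: "integrable M (\<lambda>\<omega>. Z t \<omega> * Z r \<omega>)" "integrable M (\<lambda>\<omega>. Z s \<omega> * Z r \<omega>)"
    by (intro lc_integrable_mult lin_comb_base assms)+
  have "(\<lambda>\<omega>. innov s t \<omega> * Z r \<omega>) = (\<lambda>\<omega>. (Z t \<omega> * Z r \<omega> - exp (- \<theta>\<^sub>0 * (t - s)) * (Z s \<omega> * Z r \<omega>)) / ?c)"
    by (simp add: innov_def left_diff_distrib mult.assoc)
  then have "expectation (\<lambda>\<omega>. innov s t \<omega> * Z r \<omega>)
    = (expectation (\<lambda>\<omega>. Z t \<omega> * Z r \<omega>) - exp (- \<theta>\<^sub>0 * (t - s)) * expectation (\<lambda>\<omega>. Z s \<omega> * Z r \<omega>)) / ?c"
    using i by simp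
  also have "expectation (\<lambda>\<omega>. Z t \<omega> * Z r \<omega>) - exp (- \<theta>\<^sub>0 * (t - s)) * expectation (\<lambda>\<omega>. Z s \<omega> * Z r \<omega>) = 0"
    using assms by (simp add: expectation_Z_Z algebra_simps flip: exp_add)
  finally show ?thesis by simp
qed

lemma innov_variance:
  assumes "s \<in> {0..1}" "t \<in> {0..1}" "s < t"
  shows "expectation (\<lambda>\<omega>. (innov s t \<omega>)\<^sup>2) = 1"
proof -
  let ?c = "v\<^sub>0 * (1 - exp (- 2 * \<theta>\<^sub>0 * (t - s)))" and ?r = "exp (- \<theta>\<^sub>0 * (t - s))"
  have c: "0 < ?c" by (rule innov_scale_pos[OF assms(3)])
  have i: "integrable M (\<lambda>\<omega>. Z t \<omega> * Z t \<omega>)" "integrable M (\<lambda>\<omega>. Z t \<omega> * Z s \<omega>)" "integrable M (\<lambda>\<omega>. Z s \<omega> * Z s \<omega>)"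
    by (intro lc_integrable_mult lin_comb_base assms)+
  have "(\<lambda>\<omega>. (innov s t \<omega>)\<^sup>2) = (\<lambda>\<omega>. (Z t \<omega> * Z t \<omega> - 2 * ?r * (Z t \<omega> * Z s \<omega>) + ?r\<^sup>2 * (Z s \<omega> * Z s \<omega>)) / ?c)"
    unfolding innov_def power_divide real_sqrt_pow2[OF less_imp_le[OF c]]
    by (simp add: power2_eq_square algebra_simps)
  then have "expectation (\<lambda>\<omega>. (innov s t \<omega>)\<^sup>2) = (v\<^sub>0 - 2 * ?r * (v\<^sub>0 * ?r) + ?r\<^sup>2 * v\<^sub>0) / ?c"
    using i assms by (simp add: expectation_Z_Z)
  also have "v\<^sub>0 - 2 * ?r * (v\<^sub>0 * ?r) + ?r\<^sup>2 * v\<^sub>0 = v\<^sub>0 * (1 - ?r\<^sup>2)"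
    by (simp add: power2_eq_square algebra_simps)
  also have "?r\<^sup>2 = exp (- 2 * \<theta>\<^sub>0 * (t - s))" by (simp add: algebra_simps flip: exp_double)
  finally show ?thesis using assms \<theta>\<^sub>0 v\<^sub>0 by simp
qed

lemma innov_orthogonal:
  assumes "r \<in> {0..1}" "r' \<in> {0..1}" "s \<in> {0..1}" "t \<in> {0..1}" "r < r'" "r' \<le> s" "s < t"
  shows "expectation (\<lambda>\<omega>. innov s t \<omega> * innov r r' \<omega>) = 0"
proof -
  let ?c = "sqrt (v\<^sub>0 * (1 - exp (- 2 * \<theta>\<^sub>0 * (r' - r))))"
  have i: "integrable M (\<lambda>\<omega>. innov s t \<omega> * Z r \<omega>)" "integrable M (\<lambda>\<omega>. innov s t \<omega> * Z r' \<omega>)"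
    by (intro lc_integrable_mult lin_comb_base lc_innov assms)+
  have "(\<lambda>\<omega>. innov s t \<omega> * innov r r' \<omega>)
    = (\<lambda>\<omega>. (innov s t \<omega> * Z r' \<omega> - exp (- \<theta>\<^sub>0 * (r' - r)) * (innov s t \<omega> * Z r \<omega>)) / ?c)"
    unfolding innov_def[of r r'] by (simp add: right_diff_distrib mult_ac)
  then show ?thesis
    using i assms innov_orthogonal_past[of s t r] innov_orthogonal_past[of s t r'] by simp
qed

lemma innov_sixth_moment:
  assumes "s \<in> {0..1}" "t \<in> {0..1}" "s < t"
  shows "expectation (\<lambda>\<omega>. (innov s t \<omega>)^6) = 15"
  using centered_normal_moments(3)[OF lc_centered_normal[OF lc_innov[OF assms(1,2)]]] innov_variance[OF assms]
  by simp

end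

section \<open>Deterministic analysis of the contrast\<close>

lemma one_minus_exp_le: "1 - exp (- y) \<le> (y::real)"
  using exp_ge_add_one_self[of "- y"] by simp

lemma mult_exp_minus_le: "y * exp (- y) \<le> 1 - exp (- (y::real))"
proof -
  have "(1 + y) * exp (- y) \<le> exp y * exp (- y)"
    using exp_ge_add_one_self[of y] by (intro mult_right_mono) auto
  then show ?thesis by (simp add: exp_minus algebra_simps)
qed

lemma ln_one_minus_exp_bounds:
  fixes y :: real assumes "0 < y"
  shows "ln y - y \<le> ln (1 - exp (- y))" "ln (1 - exp (- y)) \<le> ln y"
proof -
  have "ln y - y = ln (y * exp (- y))" using assms by (simp add: ln_mult)
  also have "\<dots> \<le> ln (1 - exp (- y))" using assms mult_exp_minus_le[of y] by (intro ln_mono) auto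
  finally show "ln y - y \<le> ln (1 - exp (- y))" .
  show "ln (1 - exp (- y)) \<le> ln y" using assms one_minus_exp_le[of y] by (intro ln_mono) auto
qed

lemma one_minus_mult_sinh_le: "0 \<le> x \<Longrightarrow> (1 - x) * sinh x \<le> (x::real)"
proof -
  assume x: "0 \<le> x"
  have "(1 - x) * sinh x \<le> exp (- x) * sinh x"
    using exp_ge_add_one_self[of "- x"] x by (intro mult_right_mono) auto
  also have "\<dots> = (1 - exp (- (2 * x))) / 2"
    by (simp add: sinh_field_def right_diff_distrib diff_divide_distrib flip: exp_add)
  also have "\<dots> \<le> x" using one_minus_exp_le[of "2 * x"] by simp
  finally show ?thesis .
qed

lemma le_sinh: "0 \<le> x \<Longrightarrow> x \<le> sinh (x::real)"
  using real_le_x_sinh[of x] by (simp add: sinh_field_def exp_minus)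

text \<open>The error against the leading term 1 / x is bounded for all x > 0 and not only near 0,
  so the later estimates hold for every \<theta> and every distance.\<close>

lemma inverse_sinh_bounds:
  fixes x :: real assumes "0 < x"
  shows "1 / x - 1 \<le> 1 / sinh x" "1 / sinh x \<le> 1 / x"
proof -
  have s: "0 < sinh x" using assms by simp
  show "1 / x - 1 \<le> 1 / sinh x"
    using one_minus_mult_sinh_le[of x] assms s by (simp add: field_simps)
  show "1 / sinh x \<le> 1 / x"
    using le_sinh[of x] assms s by (simp add: frac_le)
qed

lemma tanh_le_double: "0 \<le> x \<Longrightarrow> tanh x \<le> 2 * (x::real)"
proof -
  assume x: "0 \<le> x"
  have "tanh x = (1 - exp (- (2 * x))) / (1 + exp (- (2 * x)))"
    by (simp add: tanh_real_altdef)
  also have "\<dots> \<le> (1 - exp (- (2 * x))) / 1"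
    using x by (intro divide_left_mono) (auto simp: add_pos_pos)
  also have "\<dots> \<le> 2 * x" using one_minus_exp_le[of "2 * x"] by simp
  finally show ?thesis .
qed

text \<open>The expression is - x times the derivative of 1 / sinh, so this is the derivative
  counterpart of the bounds on 1 / sinh.\<close>

lemma cosh_sinh_sq_bounds:
  fixes x :: real assumes x: "0 < x"
  shows "1 / x - 2 \<le> x * cosh x / (sinh x)\<^sup>2" "x * cosh x / (sinh x)\<^sup>2 \<le> 1 / x + 2"
proof -
  have s: "0 < sinh x" and c: "1 \<le> cosh x" using x cosh_real_ge_1 by auto
  show "1 / x - 2 \<le> x * cosh x / (sinh x)\<^sup>2"
  \<comment> \<open>Squaring \<open>1 / x - 1\<close> needs it nonnegative; for x \<ge> 1 the
    claimed lower bound is negative anyway.\<close>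
  proof (cases "x < 1")
    case True
    have "(1 / x - 1)\<^sup>2 \<le> (1 / sinh x)\<^sup>2"
      using inverse_sinh_bounds(1)[OF x] True x by (intro power_mono) auto
    then have "x * (1 / x - 1)\<^sup>2 \<le> x * (1 / sinh x)\<^sup>2" using x by (intro mult_left_mono) auto
    also have "\<dots> \<le> x * cosh x / (sinh x)\<^sup>2"
      using x c s by (simp add: power_divide divide_right_mono)
    finally have "x * (1 / x - 1)\<^sup>2 \<le> x * cosh x / (sinh x)\<^sup>2" .
    moreover have "x * (1 / x - 1)\<^sup>2 = 1 / x - 2 + x" using x by (simp add: power2_eq_square field_simps)
    ultimately show ?thesis using x by linarith
  next
    case False
    then have "1 / x \<le> 1" by simp
    moreover have "0 \<le> x * cosh x / (sinh x)\<^sup>2" using x c by simp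
    ultimately show ?thesis by linarith
  qed
  have "x * cosh x / (sinh x)\<^sup>2 = (x * (1 / sinh x)) * (cosh x / sinh x)"
    by (simp add: power2_eq_square)
  also have "\<dots> \<le> 1 * (cosh x / sinh x)"
    using inverse_sinh_bounds(2)[OF x] x s c by (intro mult_right_mono) (auto simp: field_simps)
  also have "1 * (cosh x / sinh x) = 1 + exp (- x) / sinh x"
    using s by (simp add: field_simps cosh_field_def sinh_field_def)
  also have "exp (- x) / sinh x \<le> 1 / x"
  proof -
    have "x * exp (- x) \<le> sinh x"
    proof -
      have "2 * x * exp (- (2 * x)) * exp x \<le> (1 - exp (- (2 * x))) * exp x"
        using mult_exp_minus_le[of "2 * x"] by (intro mult_right_mono) auto
      then show ?thesis by (simp add: sinh_field_def left_diff_distrib mult.assoc flip: exp_add)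
    qed
    then show ?thesis using x s by (simp add: field_simps)
  qed
  finally show "x * cosh x / (sinh x)\<^sup>2 \<le> 1 / x + 2" by simp
qed

text \<open>The quotient is y times the logarithmic derivative of 1 - exp (- y), and this is near 1
  because 1 - exp (- y) behaves like y.\<close>

lemma exp_quotient_bounds:
  fixes y :: real assumes y: "0 < y"
  shows "1 - y \<le> y * exp (- y) / (1 - exp (- y))" "y * exp (- y) / (1 - exp (- y)) \<le> 1"
proof -
  have p: "0 < 1 - exp (- y)" using y by simp
  have "(1 - y) * (1 - exp (- y)) \<le> exp (- y) * (1 - exp (- y))"
    using exp_ge_add_one_self[of "- y"] p by (intro mult_right_mono) auto
  also have "\<dots> \<le> exp (- y) * y"
    using one_minus_exp_le[of y] by (intro mult_left_mono) auto
  finally show "1 - y \<le> y * exp (- y) / (1 - exp (- y))"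
    using p by (simp add: field_simps)
  show "y * exp (- y) / (1 - exp (- y)) \<le> 1"
    using mult_exp_minus_le[of y] p by simp
qed

text \<open>One-sided versions are needed because a minimizer may lie on an edge of the parameter
  set, where only one direction is admissible.\<close>

lemma DERIV_nonneg_if_right_min:
  fixes f :: "real \<Rightarrow> real"
  assumes "(f has_real_derivative l) (at x)" "x < b" "\<And>y. x < y \<Longrightarrow> y < b \<Longrightarrow> f x \<le> f y"
  shows "0 \<le> l"
proof (rule ccontr)
  assume "\<not> 0 \<le> l"
  then obtain d where d: "d > 0" "\<And>h. h > 0 \<Longrightarrow> h < d \<Longrightarrow> f (x + h) < f x"
    using DERIV_neg_dec_right[OF assms(1)] by auto
  define h where "h = min (d / 2) ((b - x) / 2)"
  have "h > 0" "h < d" "x + h < b" using d assms(2) by (auto simp: h_def min_def field_simps)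
  then show False using d(2)[of h] assms(3)[of "x + h"] by force
qed

lemma DERIV_nonpos_if_left_min:
  fixes f :: "real \<Rightarrow> real"
  assumes "(f has_real_derivative l) (at x)" "a < x" "\<And>y. a < y \<Longrightarrow> y < x \<Longrightarrow> f x \<le> f y"
  shows "l \<le> 0"
proof (rule ccontr)
  assume "\<not> l \<le> 0"
  then obtain d where d: "d > 0" "\<And>h. h > 0 \<Longrightarrow> h < d \<Longrightarrow> f (x - h) < f x"
    using DERIV_pos_inc_left[OF assms(1)] by auto
  define h where "h = min (d / 2) ((x - a) / 2)"
  have "h > 0" "h < d" "a < x - h" using d assms(2) by (auto simp: h_def min_def field_simps)
  then show False using d(2)[of h] assms(3)[of "x - h"] by force
qed

text \<open>For a pair \<open>p\<close> of observations, \<open>\<Delta> p\<close> is their distance, \<open>D p\<close> their squared increment and \<open>B p\<close> their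
  sum of squares. Then \<open>g\<close> below is half of \<open>pcl\<close>, and \<open>H / A\<close> is the explicit statistic that
  approximates \<open>\<theta> v\<close> at a minimizer with an error of order \<open>R / A\<close>.\<close>

locale pair_data =
  fixes P :: "'i set" and w \<Delta> D B :: "'i \<Rightarrow> real"
  assumes finP: "finite P" and w: "\<And>p. p \<in> P \<Longrightarrow> 0 \<le> w p" and \<Delta>: "\<And>p. p \<in> P \<Longrightarrow> 0 < \<Delta> p"
    and D: "\<And>p. p \<in> P \<Longrightarrow> 0 \<le> D p" and B: "\<And>p. p \<in> P \<Longrightarrow> 0 \<le> B p"
    and wpos: "0 < (\<Sum>p\<in>P. w p)"
begin

definition A where "A = (\<Sum>p\<in>P. w p)"
definition H where "H = (\<Sum>p\<in>P. w p * D p / (2 * \<Delta> p))"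
text \<open>The three parts are the prices of replacing \<open>ln (1 - exp (- y))\<close>,
  \<open>tanh\<close> and \<open>1 / sinh\<close> by their leading behaviour, in this order.\<close>

definition R where "R = (\<Sum>p\<in>P. w p * (\<Delta> p + \<Delta> p * B p + D p))"
definition L where "L \<theta> = (\<Sum>p\<in>P. w p * ln (1 - exp (- (2 * \<theta> * \<Delta> p))))"
definition T where "T \<theta> = (\<Sum>p\<in>P. w p / 2 * (tanh (\<theta> * \<Delta> p / 2) * B p))"
definition C where "C \<theta> = (\<Sum>p\<in>P. w p / 2 * (D p / sinh (\<theta> * \<Delta> p) + tanh (\<theta> * \<Delta> p / 2) * B p))"
definition g where "g \<theta> v = A * ln v + L \<theta> + C \<theta> / v"

lemma \<Delta>_nonneg: "p \<in> P \<Longrightarrow> 0 \<le> \<Delta> p" using \<Delta> by (rule less_imp_le)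

lemma A_pos: "0 < A" using wpos by (simp add: A_def)

lemma R_parts:
  "(\<Sum>p\<in>P. w p * \<Delta> p) \<le> R" "(\<Sum>p\<in>P. w p * (\<Delta> p * B p)) \<le> R" "(\<Sum>p\<in>P. w p * D p) \<le> R"
  and R_nonneg: "0 \<le> R"
proof -
  have *: "0 \<le> w p * \<Delta> p" "0 \<le> w p * (\<Delta> p * B p)" "0 \<le> w p * D p" if "p \<in> P" for p
    using that w \<Delta>_nonneg D B by auto
  show "(\<Sum>p\<in>P. w p * \<Delta> p) \<le> R" "(\<Sum>p\<in>P. w p * (\<Delta> p * B p)) \<le> R" "(\<Sum>p\<in>P. w p * D p) \<le> R" "0 \<le> R"
    unfolding R_def using * by (auto simp: distrib_left intro!: sum_mono sum_nonneg)
qed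

lemma T_bounds: assumes "0 < \<theta>" shows "0 \<le> T \<theta>" "T \<theta> \<le> \<theta> / 2 * R"
proof -
  show "0 \<le> T \<theta>"
    unfolding T_def using assms w \<Delta>_nonneg B by (intro sum_nonneg mult_nonneg_nonneg) auto
  have "T \<theta> \<le> (\<Sum>p\<in>P. \<theta> / 2 * (w p * (\<Delta> p * B p)))"
    unfolding T_def
  proof (rule sum_mono)
    fix p assume p: "p \<in> P"
    have "w p / 2 * (tanh (\<theta> * \<Delta> p / 2) * B p) \<le> w p / 2 * ((\<theta> * \<Delta> p) * B p)"
      using p w B \<Delta>_nonneg assms tanh_le_double[of "\<theta> * \<Delta> p / 2"]
      by (intro mult_left_mono mult_right_mono) auto
    then show "w p / 2 * (tanh (\<theta> * \<Delta> p / 2) * B p) \<le> \<theta> / 2 * (w p * (\<Delta> p * B p))" by (simp add: mult_ac)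
  qed
  also have "\<dots> \<le> \<theta> / 2 * R"
    unfolding sum_distrib_left[symmetric] using R_parts(2) assms by (intro mult_left_mono) auto
  finally show "T \<theta> \<le> \<theta> / 2 * R" .
qed

lemma T_mono: assumes "0 < \<theta>" "\<theta> \<le> \<theta>'" shows "T \<theta> \<le> T \<theta>'"
  unfolding T_def using assms w \<Delta>_nonneg B
  by (intro sum_mono mult_left_mono mult_right_mono) (auto intro!: mult_right_mono)

text \<open>\<open>T\<close> is kept apart and not absorbed into \<open>R\<close>: its bound grows
  with \<theta> and is of no help for large \<theta>, where its monotonicity is used
  instead.\<close>

lemma C_bounds:
  assumes \<theta>: "0 < \<theta>"
  shows "H / \<theta> - R / 2 + T \<theta> \<le> C \<theta>" "C \<theta> \<le> H / \<theta> + T \<theta>"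
proof -
  have C: "C \<theta> = (\<Sum>p\<in>P. w p / 2 * D p * (1 / sinh (\<theta> * \<Delta> p))) + T \<theta>"
    by (simp add: C_def T_def distrib_left sum.distrib)
  have H: "H / \<theta> = (\<Sum>p\<in>P. w p / 2 * D p * (1 / (\<theta> * \<Delta> p)))"
    by (simp add: H_def sum_divide_distrib field_simps)
  have "H / \<theta> - R / 2 \<le> (\<Sum>p\<in>P. w p / 2 * D p * (1 / (\<theta> * \<Delta> p) - 1))"
    using R_parts(3) by (simp add: H right_diff_distrib sum_subtractf flip: sum_divide_distrib)
  also have "\<dots> \<le> (\<Sum>p\<in>P. w p / 2 * D p * (1 / sinh (\<theta> * \<Delta> p)))"
    using w D \<Delta> \<theta> by (intro sum_mono mult_left_mono inverse_sinh_bounds) auto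
  finally show "H / \<theta> - R / 2 + T \<theta> \<le> C \<theta>" unfolding C by simp
  have "(\<Sum>p\<in>P. w p / 2 * D p * (1 / sinh (\<theta> * \<Delta> p))) \<le> (\<Sum>p\<in>P. w p / 2 * D p * (1 / (\<theta> * \<Delta> p)))"
    using w D \<Delta> \<theta> by (intro sum_mono mult_left_mono inverse_sinh_bounds) auto
  then show "C \<theta> \<le> H / \<theta> + T \<theta>" unfolding C H by simp
qed

text \<open>A positive \<open>H\<close> forces a nonzero increment with positive weight. Positivity
  of \<open>C\<close> makes the optimal variance \<open>C \<theta> / A\<close> admissible.\<close>

lemma C_pos:
  assumes "0 < H" "0 < \<theta>" shows "0 < C \<theta>"
proof -
  have "\<exists>p\<in>P. 0 < w p * D p / (2 * \<Delta> p)"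
  proof (rule ccontr)
    assume "\<not> ?thesis"
    then have "H \<le> 0" unfolding H_def by (intro sum_nonpos) force
    then show False using assms(1) by simp
  qed
  then obtain p where p: "p \<in> P" "0 < w p * D p / (2 * \<Delta> p)" by blast
  then have wD: "0 < w p * D p" using \<Delta>[OF p(1)] by (simp add: zero_less_divide_iff)
  have sinh: "0 < sinh (\<theta> * \<Delta> q)" if "q \<in> P" for q using \<Delta>[OF that] assms(2) by simp
  have nn: "0 \<le> w q / 2 * (tanh (\<theta> * \<Delta> q / 2) * B q)" if "q \<in> P" for q
    using w[OF that] \<Delta>_nonneg[OF that] B[OF that] assms(2) by simp
  show ?thesis
    unfolding C_def
  proof (rule sum_pos2[OF finP p(1)])
    have "0 < w p * D p / (2 * sinh (\<theta> * \<Delta> p))" using wD sinh[OF p(1)] by (intro divide_pos_pos) auto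
    then show "0 < w p / 2 * (D p / sinh (\<theta> * \<Delta> p) + tanh (\<theta> * \<Delta> p / 2) * B p)"
      using nn[OF p(1)] unfolding distrib_left by (simp add: add_pos_nonneg)
    fix q assume q: "q \<in> P"
    show "0 \<le> w q / 2 * (D q / sinh (\<theta> * \<Delta> q) + tanh (\<theta> * \<Delta> q / 2) * B q)"
    proof -
      have "0 \<le> w q / 2 * (D q / sinh (\<theta> * \<Delta> q))"
        using w[OF q] D[OF q] sinh[OF q] by (intro mult_nonneg_nonneg divide_nonneg_pos) auto
      then show ?thesis using nn[OF q] unfolding distrib_left by (rule add_nonneg_nonneg)
    qed
  qed
qed

lemma mult_C_bounds:
  assumes \<theta>: "0 < \<theta>"
  shows "\<bar>\<theta> * C \<theta> - H\<bar> \<le> (\<theta> + \<theta>\<^sup>2) * R"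
proof -
  have "\<theta> * (H / \<theta> - R / 2) \<le> \<theta> * C \<theta>" "\<theta> * C \<theta> \<le> \<theta> * (H / \<theta> + \<theta> / 2 * R)"
    using C_bounds[OF \<theta>] T_bounds[OF \<theta>] \<theta> by (auto intro!: mult_left_mono)
  then have "H - \<theta> / 2 * R \<le> \<theta> * C \<theta>" "\<theta> * C \<theta> \<le> H + \<theta>\<^sup>2 / 2 * R"
    using \<theta> by (auto simp: algebra_simps power2_eq_square)
  moreover have "0 \<le> \<theta> * R" "0 \<le> \<theta>\<^sup>2 * R" using \<theta> R_nonneg by auto
  ultimately show ?thesis unfolding abs_le_iff distrib_right by (auto simp: algebra_simps)
qed

definition L' where "L' \<theta> = (\<Sum>p\<in>P. w p * (2 * \<Delta> p * exp (- (2 * \<theta> * \<Delta> p)) / (1 - exp (- (2 * \<theta> * \<Delta> p)))))"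
definition C' where "C' \<theta> = (\<Sum>p\<in>P. w p / 2 * (\<Delta> p / 2 * (1 - (tanh (\<theta> * \<Delta> p / 2))\<^sup>2) * B p
   - D p * (\<Delta> p * cosh (\<theta> * \<Delta> p) / (sinh (\<theta> * \<Delta> p))\<^sup>2)))"

section \<open>First-order conditions for the contrast\<close>

lemma DERIV_L: assumes "0 < \<theta>" shows "(L has_real_derivative L' \<theta>) (at \<theta>)"
  unfolding L_def[abs_def] L'_def
proof (rule DERIV_sum)
  fix p assume "p \<in> P"
  then have "0 < \<theta> * \<Delta> p" using \<Delta> assms by simp
  then have "exp (- (2 * \<theta> * \<Delta> p)) < 1" by simp
  then show "((\<lambda>\<theta>. w p * ln (1 - exp (- (2 * \<theta> * \<Delta> p)))) has_real_derivative
      w p * (2 * \<Delta> p * exp (- (2 * \<theta> * \<Delta> p)) / (1 - exp (- (2 * \<theta> * \<Delta> p))))) (at \<theta>)"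
    by (auto intro!: derivative_eq_intros)
qed

lemma DERIV_C: assumes "0 < \<theta>" shows "(C has_real_derivative C' \<theta>) (at \<theta>)"
  unfolding C_def[abs_def] C'_def
proof (rule DERIV_sum)
  fix p assume "p \<in> P"
  then have "\<theta> * \<Delta> p \<noteq> 0" using \<Delta>[of p] assms by auto
  then have "sinh (\<theta> * \<Delta> p) \<noteq> 0" by simp
  then show "((\<lambda>\<theta>. w p / 2 * (D p / sinh (\<theta> * \<Delta> p) + tanh (\<theta> * \<Delta> p / 2) * B p)) has_real_derivative
      w p / 2 * (\<Delta> p / 2 * (1 - (tanh (\<theta> * \<Delta> p / 2))\<^sup>2) * B p
      - D p * (\<Delta> p * cosh (\<theta> * \<Delta> p) / (sinh (\<theta> * \<Delta> p))\<^sup>2))) (at \<theta>)"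
    by (auto intro!: derivative_eq_intros simp: power2_eq_square field_simps)
qed

lemma DERIV_g: assumes "0 < \<theta>" "v \<noteq> 0" shows "((\<lambda>\<theta>. g \<theta> v) has_real_derivative (L' \<theta> + C' \<theta> / v)) (at \<theta>)"
  unfolding g_def by (auto intro!: derivative_eq_intros DERIV_L DERIV_C assms)

lemma L'_bound: assumes \<theta>: "0 < \<theta>" shows "\<bar>\<theta> * L' \<theta> - A\<bar> \<le> 2 * \<theta> * R"
proof -
  have eq: "\<theta> * L' \<theta> - A = (\<Sum>p\<in>P. w p * ((2 * \<theta> * \<Delta> p) * exp (- (2 * \<theta> * \<Delta> p)) / (1 - exp (- (2 * \<theta> * \<Delta> p))) - 1))"
    by (simp add: L'_def A_def sum_distrib_left sum_subtractf right_diff_distrib mult_ac)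
  have "\<bar>\<theta> * L' \<theta> - A\<bar> \<le> (\<Sum>p\<in>P. 2 * \<theta> * (w p * \<Delta> p))"
    unfolding eq
  proof (rule order_trans[OF sum_abs], rule sum_mono)
    fix p assume p: "p \<in> P"
    let ?q = "(2 * \<theta> * \<Delta> p) * exp (- (2 * \<theta> * \<Delta> p)) / (1 - exp (- (2 * \<theta> * \<Delta> p)))"
    have y: "0 < 2 * \<theta> * \<Delta> p" using p \<Delta> \<theta> by simp
    have "\<bar>w p * (?q - 1)\<bar> = w p * \<bar>?q - 1\<bar>" using w p by (simp add: abs_mult)
    also have "\<dots> \<le> w p * (2 * \<theta> * \<Delta> p)"
      using exp_quotient_bounds[OF y] y w p by (intro mult_left_mono) (auto simp: abs_le_iff)
    finally show "\<bar>w p * (?q - 1)\<bar> \<le> 2 * \<theta> * (w p * \<Delta> p)" by (simp add: mult_ac)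
  qed
  also have "\<dots> \<le> 2 * \<theta> * R"
    unfolding sum_distrib_left[symmetric] using R_parts(1) \<theta> by (intro mult_left_mono) auto
  finally show ?thesis .
qed

lemma C'_bound: assumes \<theta>: "0 < \<theta>" shows "\<bar>\<theta> * C' \<theta> + H / \<theta>\<bar> \<le> (1 + \<theta>) * R"
proof -
  have H: "H / \<theta> = (\<Sum>p\<in>P. w p / 2 * (D p * (1 / (\<theta> * \<Delta> p))))"
    by (simp add: H_def sum_divide_distrib field_simps)
  have eq: "\<theta> * C' \<theta> + H / \<theta> = (\<Sum>p\<in>P. w p / 2 * (\<theta> * \<Delta> p / 2 * (1 - (tanh (\<theta> * \<Delta> p / 2))\<^sup>2) * B p
     - D p * ((\<theta> * \<Delta> p) * cosh (\<theta> * \<Delta> p) / (sinh (\<theta> * \<Delta> p))\<^sup>2 - 1 / (\<theta> * \<Delta> p))))"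
    unfolding H C'_def sum_distrib_left sum.distrib[symmetric]
    by (intro sum.cong refl) (simp add: algebra_simps)
  have "\<bar>\<theta> * C' \<theta> + H / \<theta>\<bar> \<le> (\<Sum>p\<in>P. \<theta> * (w p * (\<Delta> p * B p)) + w p * D p)"
    unfolding eq
  proof (rule order_trans[OF sum_abs], rule sum_mono)
    fix p assume p: "p \<in> P"
    define x where "x = \<theta> * \<Delta> p"
    have x: "0 < x" using p \<Delta> \<theta> by (simp add: x_def)
    let ?t = "1 - (tanh (x / 2))\<^sup>2" and ?q = "x * cosh x / (sinh x)\<^sup>2 - 1 / x"
    have t: "0 \<le> ?t" "?t \<le> 1" using tanh_real_bounds[of "x / 2"] by (auto simp: abs_square_le_1)
    have "\<bar>x / 2 * ?t * B p - D p * ?q\<bar> \<le> \<bar>x / 2 * ?t * B p\<bar> + \<bar>D p * ?q\<bar>"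
      by (rule abs_triangle_ineq4)
    also have "\<bar>x / 2 * ?t * B p\<bar> = x / 2 * ?t * B p"
      using x t B p by (intro abs_of_nonneg mult_nonneg_nonneg) auto
    also have "\<dots> \<le> x / 2 * 1 * B p"
      using x t B p by (intro mult_right_mono mult_left_mono) auto
    also have "\<bar>D p * ?q\<bar> = D p * \<bar>?q\<bar>" using D p by (simp add: abs_mult)
    also have "\<dots> \<le> D p * 2"
      using cosh_sinh_sq_bounds[OF x] D p by (intro mult_left_mono) (auto simp: abs_le_iff)
    finally have "w p / 2 * \<bar>x / 2 * ?t * B p - D p * ?q\<bar> \<le> w p / 2 * (x / 2 * 1 * B p + D p * 2)"
      using w p by (intro mult_left_mono) auto
    also have "\<dots> \<le> \<theta> * (w p * (\<Delta> p * B p)) + w p * D p"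
      using \<theta> w[OF p] \<Delta>[OF p] B[OF p] by (simp add: x_def field_simps)
    finally show "\<bar>w p / 2 * (\<theta> * \<Delta> p / 2 * (1 - (tanh (\<theta> * \<Delta> p / 2))\<^sup>2) * B p
     - D p * ((\<theta> * \<Delta> p) * cosh (\<theta> * \<Delta> p) / (sinh (\<theta> * \<Delta> p))\<^sup>2 - 1 / (\<theta> * \<Delta> p)))\<bar>
      \<le> \<theta> * (w p * (\<Delta> p * B p)) + w p * D p"
      using w p by (simp add: x_def abs_mult)
  qed
  also have "\<dots> \<le> \<theta> * R + R"
    unfolding sum.distrib sum_distrib_left[symmetric]
    using R_parts \<theta> by (intro add_mono mult_left_mono) auto
  finally show ?thesis by (simp add: distrib_right)
qed

text \<open>The error left when the \<theta>-derivative of \<open>g\<close> is multiplied by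
  \<theta>^2 v: the logarithms contribute 2 \<theta>^2 v and the part from \<open>C\<close>
  contributes \<theta> (1 + \<theta>). It increases in both arguments, so its value at upper bounds
  for \<theta> and v serves for all smaller ones.\<close>

definition K where "K \<theta> v = 2 * \<theta>\<^sup>2 * v + \<theta> + \<theta>\<^sup>2"

text \<open>The derivative to the right is nonnegative, and after multiplication by \<theta>^2 v its
  leading part is \<open>A * (\<theta> * v) - H\<close>.\<close>

lemma \<theta>_right_min:
  assumes "0 < \<theta>" "0 < v" "\<theta> < b" "\<And>y. \<theta> < y \<Longrightarrow> y < b \<Longrightarrow> g \<theta> v \<le> g y v"
  shows "H - K \<theta> v * R \<le> A * (\<theta> * v)"
proof -
  have "0 \<le> L' \<theta> + C' \<theta> / v"
    by (rule DERIV_nonneg_if_right_min[OF DERIV_g, where b=b]) (use assms in auto)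
  then have "0 \<le> (\<theta> * v) * (L' \<theta> + C' \<theta> / v)" using assms by simp
  also have "\<dots> = v * (\<theta> * L' \<theta>) + \<theta> * C' \<theta>" using assms by (simp add: field_simps)
  also have "\<dots> \<le> v * (A + 2 * \<theta> * R) + ((1 + \<theta>) * R - H / \<theta>)"
    using L'_bound[OF assms(1)] C'_bound[OF assms(1)] assms(2)
    by (intro add_mono mult_left_mono) (auto simp: abs_le_iff)
  finally have "0 \<le> \<theta> * (v * (A + 2 * \<theta> * R) + ((1 + \<theta>) * R - H / \<theta>))" using assms by simp
  also have "\<dots> = A * (\<theta> * v) + K \<theta> v * R - H"
    using assms by (simp add: K_def field_simps power2_eq_square)
  finally show ?thesis by simp
qed

lemma \<theta>_left_min:
  assumes "0 < \<theta>" "0 < v" "a < \<theta>" "\<And>y. a < y \<Longrightarrow> y < \<theta> \<Longrightarrow> g \<theta> v \<le> g y v"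
  shows "A * (\<theta> * v) \<le> H + K \<theta> v * R"
proof -
  have "L' \<theta> + C' \<theta> / v \<le> 0"
    by (rule DERIV_nonpos_if_left_min[OF DERIV_g, where a=a]) (use assms in auto)
  then have "0 \<ge> (\<theta> * v) * (L' \<theta> + C' \<theta> / v)"
    using assms by (simp add: mult_nonneg_nonpos)
  also have "(\<theta> * v) * (L' \<theta> + C' \<theta> / v) = v * (\<theta> * L' \<theta>) + \<theta> * C' \<theta>" using assms by (simp add: field_simps)
  finally have "0 \<ge> v * (\<theta> * L' \<theta>) + \<theta> * C' \<theta>" .
  moreover have "v * (A - 2 * \<theta> * R) + (- ((1 + \<theta>) * R) - H / \<theta>) \<le> v * (\<theta> * L' \<theta>) + \<theta> * C' \<theta>"
    using L'_bound[OF assms(1)] C'_bound[OF assms(1)] assms(2)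
    by (intro add_mono mult_left_mono) (auto simp: abs_le_iff)
  ultimately have "v * (A - 2 * \<theta> * R) + (- ((1 + \<theta>) * R) - H / \<theta>) \<le> 0" by linarith
  then have "0 \<ge> \<theta> * (v * (A - 2 * \<theta> * R) + (- ((1 + \<theta>) * R) - H / \<theta>))"
    using assms by (simp add: mult_nonneg_nonpos)
  also have "\<theta> * (v * (A - 2 * \<theta> * R) + (- ((1 + \<theta>) * R) - H / \<theta>)) = A * (\<theta> * v) - K \<theta> v * R - H"
    using assms by (simp add: K_def field_simps power2_eq_square)
  finally show ?thesis by simp
qed

lemma DERIV_g_v: assumes "0 < v" shows "((\<lambda>v. g \<theta> v) has_real_derivative (A - C \<theta> / v) / v) (at v)"
  unfolding g_def using assms by (auto intro!: derivative_eq_intros simp: power2_eq_square field_simps)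

lemma mult_C_K_bounds:
  assumes "0 < \<theta>" "0 < v" shows "\<bar>\<theta> * C \<theta> - H\<bar> \<le> K \<theta> v * R"
proof -
  have "(\<theta> + \<theta>\<^sup>2) * R \<le> K \<theta> v * R"
    using R_nonneg assms by (intro mult_right_mono) (auto simp: K_def)
  then show ?thesis using mult_C_bounds[OF assms(1)] by linarith
qed

text \<open>The v-derivative has exactly the sign of \<open>A * v - C \<theta>\<close>; the
  remainder enters only when \<open>\<theta> * C \<theta>\<close> is replaced by
  \<open>H\<close>.\<close>

lemma v_right_min:
  assumes "0 < \<theta>" "0 < v" "v < d" "\<And>y. v < y \<Longrightarrow> y < d \<Longrightarrow> g \<theta> v \<le> g \<theta> y"
  shows "H - K \<theta> v * R \<le> A * (\<theta> * v)"
proof -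
  have "0 \<le> (A - C \<theta> / v) / v"
    by (rule DERIV_nonneg_if_right_min[OF DERIV_g_v, where b=d]) (use assms in auto)
  then have "C \<theta> \<le> A * v" using assms by (simp add: field_simps)
  then have "\<theta> * C \<theta> \<le> \<theta> * (A * v)" using assms by (intro mult_left_mono) auto
  then show ?thesis using mult_C_K_bounds[OF assms(1,2)] by (simp add: mult_ac abs_le_iff)
qed

lemma v_left_min:
  assumes "0 < \<theta>" "0 < v" "c < v" "\<And>y. c < y \<Longrightarrow> y < v \<Longrightarrow> g \<theta> v \<le> g \<theta> y"
  shows "A * (\<theta> * v) \<le> H + K \<theta> v * R"
proof -
  have "(A - C \<theta> / v) / v \<le> 0"
    by (rule DERIV_nonpos_if_left_min[OF DERIV_g_v, where a=c]) (use assms in auto)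
  then have "A * v \<le> C \<theta>" using assms by (simp add: field_simps)
  then have "\<theta> * (A * v) \<le> \<theta> * C \<theta>" using assms by (intro mult_left_mono) auto
  then show ?thesis using mult_C_K_bounds[OF assms(1,2)] by (simp add: mult_ac abs_le_iff)
qed

lemma near_of_bounds:
  assumes "H - k * R \<le> A * m" "A * m \<le> H + k * R"
  shows "\<bar>m - H / A\<bar> \<le> k * (R / A)"
proof -
  have "\<bar>m - H / A\<bar> = \<bar>A * m - H\<bar> / A" using A_pos by (simp add: field_simps abs_if)
  also have "\<dots> \<le> (k * R) / A" using assms A_pos by (intro divide_right_mono) auto
  finally show ?thesis by simp
qed

section \<open>Existence and location of minimizers\<close>

lemma continuous_on_C: "continuous_on {0<..} C" and continuous_on_L: "continuous_on {0<..} L"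
  using DERIV_L DERIV_C by (auto intro!: continuous_at_imp_continuous_on DERIV_isCont)

lemma continuous_on_g: "continuous_on ({0<..} \<times> {0<..}) (\<lambda>\<psi>. g (fst \<psi>) (snd \<psi>))"
proof -
  have "continuous_on ({0<..} \<times> {0<..}) (\<lambda>\<psi>. L (fst \<psi>))" "continuous_on ({0<..} \<times> {0<..}) (\<lambda>\<psi>. C (fst \<psi>))"
    by (auto intro!: continuous_on_compose2[OF continuous_on_L] continuous_on_compose2[OF continuous_on_C] continuous_intros)
  then show ?thesis unfolding g_def by (auto intro!: continuous_intros)
qed

text \<open>The term \<open>f v\<close> makes one statement serve both contrasts: it is 0 for half
  of \<open>pcl\<close> and the \<theta>-free correction for \<open>pl\<close>.\<close>

lemma exists_min_on_compact:
  assumes F: "\<And>\<theta> v. 0 < \<theta> \<Longrightarrow> 0 < v \<Longrightarrow> F (\<theta>, v) = g \<theta> v + f v" and f: "continuous_on {0<..} f"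
    and S: "compact S" "S \<noteq> {}" "S \<subseteq> {0<..} \<times> {0<..}"
  shows "\<exists>\<psi>\<in>S. \<forall>\<psi>'\<in>S. F \<psi> \<le> F \<psi>'"
proof -
  have "continuous_on S (\<lambda>\<psi>. g (fst \<psi>) (snd \<psi>))" by (rule continuous_on_subset[OF continuous_on_g S(3)])
  moreover have "continuous_on S (\<lambda>\<psi>. f (snd \<psi>))"
    using S(3) by (auto intro!: continuous_on_compose2[OF f] continuous_intros)
  ultimately have "continuous_on S (\<lambda>\<psi>. g (fst \<psi>) (snd \<psi>) + f (snd \<psi>))" by (rule continuous_on_add)
  from continuous_attains_inf[OF S(1,2) this] obtain \<psi> where
    \<psi>: "\<psi> \<in> S" "\<forall>y\<in>S. g (fst \<psi>) (snd \<psi>) + f (snd \<psi>) \<le> g (fst y) (snd y) + f (snd y)" by auto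
  have "F x = g (fst x) (snd x) + f (snd x)" if "x \<in> S" for x
    using F[of "fst x" "snd x"] that S(3) by auto
  with \<psi> show ?thesis by auto
qed

text \<open>At any point other than the upper corner (b, d) one coordinate can be increased, and
  either direction yields the same lower bound on the product; at the corner the product exceeds
  \<open>H / A\<close> by assumption. The upper bound is symmetric, with the corner (a, c).\<close>

lemma arg_min_rectangle:
  assumes F: "\<And>\<theta> v. 0 < \<theta> \<Longrightarrow> 0 < v \<Longrightarrow> F (\<theta>, v) = g \<theta> v"
    and J: "0 < a" "a \<le> b" "0 < c" "c \<le> d" and h: "a * c < H / A" "H / A < b * d"
  shows "\<exists>\<psi>. is_arg_min F (\<lambda>\<psi>. \<psi> \<in> {a..b} \<times> {c..d}) \<psi>"
    and "is_arg_min F (\<lambda>\<psi>. \<psi> \<in> {a..b} \<times> {c..d}) (\<theta>, v) \<Longrightarrow> \<bar>\<theta> * v - H / A\<bar> \<le> K b d * (R / A)"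
proof -
  have S: "compact ({a..b} \<times> {c..d})" "{a..b} \<times> {c..d} \<noteq> {}" "{a..b} \<times> {c..d} \<subseteq> {0<..} \<times> {0<..}"
    using J by (auto intro!: compact_Times)
  show "\<exists>\<psi>. is_arg_min F (\<lambda>\<psi>. \<psi> \<in> {a..b} \<times> {c..d}) \<psi>"
  proof -
    have "\<exists>\<psi>\<in>{a..b} \<times> {c..d}. \<forall>\<psi>'\<in>{a..b} \<times> {c..d}. F \<psi> \<le> F \<psi>'"
      by (rule exists_min_on_compact[of F "\<lambda>_. 0", OF _ _ S]) (auto simp: F)
    then show ?thesis unfolding is_arg_min_linorder by blast
  qed
  assume "is_arg_min F (\<lambda>\<psi>. \<psi> \<in> {a..b} \<times> {c..d}) (\<theta>, v)"
  then have in_J: "a \<le> \<theta>" "\<theta> \<le> b" "c \<le> v" "v \<le> d"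
    and F_min: "\<And>y z. (y, z) \<in> {a..b} \<times> {c..d} \<Longrightarrow> F (\<theta>, v) \<le> F (y, z)"
    unfolding is_arg_min_linorder by auto
  then have pos: "0 < \<theta>" "0 < v" using J by auto
  have min: "g \<theta> v \<le> g y z" if "a \<le> y" "y \<le> b" "c \<le> z" "z \<le> d" for y z
    using F_min[of y z] F[of y z] F[OF pos] J that by simp
  have k: "K \<theta> v * R \<le> K b d * R"
    unfolding K_def using in_J pos R_nonneg
    by (intro mult_right_mono add_mono mult_mono power_mono) auto
  have k0: "0 \<le> K b d * R"
    unfolding K_def using J R_nonneg by simp
  have "H - K b d * R \<le> A * (\<theta> * v)"
  proof -
    consider "\<theta> < b" | "v < d" | "\<theta> = b" "v = d" using in_J by linarith
    then show ?thesis
    proof cases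
      case 1 then have "H - K \<theta> v * R \<le> A * (\<theta> * v)"
        using in_J by (intro \<theta>_right_min[OF pos 1] min) auto
      then show ?thesis using k by linarith
    next
      case 2 then have "H - K \<theta> v * R \<le> A * (\<theta> * v)"
        using in_J by (intro v_right_min[OF pos 2] min) auto
      then show ?thesis using k by linarith
    next
      case 3 then show ?thesis using h A_pos k0 by (simp add: field_simps)
    qed
  qed
  moreover have "A * (\<theta> * v) \<le> H + K b d * R"
  proof -
    consider "a < \<theta>" | "c < v" | "\<theta> = a" "v = c" using in_J by linarith
    then show ?thesis
    proof cases
      case 1 then have "A * (\<theta> * v) \<le> H + K \<theta> v * R"
        using in_J by (intro \<theta>_left_min[OF pos 1] min) auto
      then show ?thesis using k by linarith
    next
      case 2 then have "A * (\<theta> * v) \<le> H + K \<theta> v * R"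
        using in_J by (intro v_left_min[OF pos 2] min) auto
      then show ?thesis using k by linarith
    next
      case 3 then show ?thesis using h A_pos k0 by (simp add: field_simps)
    qed
  qed
  ultimately show "\<bar>\<theta> * v - H / A\<bar> \<le> K b d * (R / A)" by (rule near_of_bounds)
qed

text \<open>Stationarity in v is spoiled by the unspecified \<open>f\<close>, so only \<theta> is
  moved. When \<theta> sits at an endpoint, the product must be controlled for every v in {c..d};
  this explains the stronger conditions, which involve the corners (a, d) and (b, c).\<close>

lemma arg_min_rectangle_perturbed:
  assumes F: "\<And>\<theta> v. 0 < \<theta> \<Longrightarrow> 0 < v \<Longrightarrow> F (\<theta>, v) = g \<theta> v + f v" and f: "continuous_on {0<..} f"
    and J: "0 < a" "a \<le> b" "0 < c" "c \<le> d" and h: "a * d < H / A" "H / A < b * c"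
  shows "\<exists>\<psi>. is_arg_min F (\<lambda>\<psi>. \<psi> \<in> {a..b} \<times> {c..d}) \<psi>"
    and "is_arg_min F (\<lambda>\<psi>. \<psi> \<in> {a..b} \<times> {c..d}) (\<theta>, v) \<Longrightarrow> \<bar>\<theta> * v - H / A\<bar> \<le> K b d * (R / A)"
proof -
  have S: "compact ({a..b} \<times> {c..d})" "{a..b} \<times> {c..d} \<noteq> {}" "{a..b} \<times> {c..d} \<subseteq> {0<..} \<times> {0<..}"
    using J by (auto intro!: compact_Times)
  show "\<exists>\<psi>. is_arg_min F (\<lambda>\<psi>. \<psi> \<in> {a..b} \<times> {c..d}) \<psi>"
    using exists_min_on_compact[OF F f S] unfolding is_arg_min_linorder by blast
  assume "is_arg_min F (\<lambda>\<psi>. \<psi> \<in> {a..b} \<times> {c..d}) (\<theta>, v)"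
  then have in_J: "a \<le> \<theta>" "\<theta> \<le> b" "c \<le> v" "v \<le> d"
    and F_min: "\<And>y z. (y, z) \<in> {a..b} \<times> {c..d} \<Longrightarrow> F (\<theta>, v) \<le> F (y, z)"
    unfolding is_arg_min_linorder by auto
  then have pos: "0 < \<theta>" "0 < v" using J by auto
  have min: "g \<theta> v \<le> g y v" if "a \<le> y" "y \<le> b" for y
    using F_min[of y v] F[of y v] F[OF pos] J in_J that by simp
  have k: "K \<theta> v * R \<le> K b d * R"
    unfolding K_def using in_J pos R_nonneg
    by (intro mult_right_mono add_mono mult_mono power_mono) auto
  have k0: "0 \<le> K b d * R"
    unfolding K_def using J R_nonneg by simp
  have "H - K b d * R \<le> A * (\<theta> * v)"
  proof (cases "\<theta> < b")
    case True then have "H - K \<theta> v * R \<le> A * (\<theta> * v)"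
      using in_J by (intro \<theta>_right_min[OF pos True] min) auto
    then show ?thesis using k by linarith
  next
    case False
    then have "b * c \<le> \<theta> * v" using in_J J by (intro mult_mono) auto
    then have "A * (H / A) \<le> A * (\<theta> * v)" using h A_pos by (intro mult_left_mono) auto
    then show ?thesis using k0 A_pos by simp
  qed
  moreover have "A * (\<theta> * v) \<le> H + K b d * R"
  proof (cases "a < \<theta>")
    case True then have "A * (\<theta> * v) \<le> H + K \<theta> v * R"
      using in_J by (intro \<theta>_left_min[OF pos True] min) auto
    then show ?thesis using k by linarith
  next
    case False
    then have "\<theta> * v \<le> a * d" using in_J J by (intro mult_mono) auto
    then have "A * (\<theta> * v) \<le> A * (H / A)" using h A_pos by (intro mult_left_mono) auto
    then show ?thesis using k0 A_pos by simp
  qed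
  ultimately show "\<bar>\<theta> * v - H / A\<bar> \<le> K b d * (R / A)" by (rule near_of_bounds)
qed

text \<open>For fixed \<theta> the function \<open>A * ln v + C \<theta> / v\<close> is smallest at
  v = \<open>C \<theta> / A\<close>; this is ln x \<le> x - 1 at the ratio of that value to
  v.\<close>

lemma g_ge_profile:
  assumes "0 < C \<theta>" "0 < v" shows "g \<theta> (C \<theta> / A) \<le> g \<theta> v"
proof -
  have u: "0 < C \<theta> / A" using assms A_pos by simp
  have "ln (C \<theta> / A / v) \<le> C \<theta> / A / v - 1" using u assms A_pos by (intro ln_le_minus_one divide_pos_pos) auto
  then have "A * (ln (C \<theta> / A) - ln v) \<le> A * (C \<theta> / A / v - 1)"
    using u assms A_pos ln_div[of "C \<theta> / A" v]
    by (intro mult_left_mono) (simp_all del: divide_divide_eq_left divide_divide_eq_left' ln_div)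
  then show ?thesis using A_pos assms by (simp add: g_def algebra_simps)
qed

text \<open>Minimizing over v confines the problem to the curve v = \<open>C \<theta> / A\<close>
  over {a..b}, which is compact although the parameter set is not. On it
  \<open>A * (\<theta> * v)\<close> equals \<open>\<theta> * C \<theta>\<close> exactly, so no
  derivative in \<theta> enters the error.\<close>

lemma arg_min_profile:
  assumes F: "\<And>\<theta> v. 0 < \<theta> \<Longrightarrow> 0 < v \<Longrightarrow> F (\<theta>, v) = g \<theta> v"
    and J: "0 < a" "a \<le> b" and C: "\<And>\<theta>. 0 < \<theta> \<Longrightarrow> 0 < C \<theta>"
  shows "\<exists>\<psi>. is_arg_min F (\<lambda>\<psi>. \<psi> \<in> {a..b} \<times> {0<..}) \<psi>"
    and "is_arg_min F (\<lambda>\<psi>. \<psi> \<in> {a..b} \<times> {0<..}) (\<theta>, v) \<Longrightarrow> \<bar>\<theta> * v - H / A\<bar> \<le> (b + b\<^sup>2) * (R / A)"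
proof -
  let ?S = "(\<lambda>\<theta>. (\<theta>, C \<theta> / A)) ` {a..b}"
  have "continuous_on {a..b} C" by (rule continuous_on_subset[OF continuous_on_C]) (use J in auto)
  then have "compact ?S"
    using A_pos by (intro compact_continuous_image continuous_on_Pair continuous_on_id continuous_on_divide continuous_on_const) auto
  moreover have "?S \<noteq> {}" using J(2) by simp
  moreover have pos_C: "0 < \<theta>" "0 < C \<theta> / A" if "\<theta> \<in> {a..b}" for \<theta>
    using that J(1) C[of \<theta>] A_pos by auto
  then have S_pos: "?S \<subseteq> {0<..} \<times> {0<..}" by blast
  ultimately have "\<exists>\<psi>\<in>?S. \<forall>\<psi>'\<in>?S. F \<psi> \<le> F \<psi>'"
    by (intro exists_min_on_compact[of F "\<lambda>_. 0" ?S]) (assumption | simp only: F continuous_on_const add_0_right)+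
  then obtain \<psi> where \<psi>: "\<psi> \<in> ?S" "\<forall>\<psi>'\<in>?S. F \<psi> \<le> F \<psi>'" by blast
  have "F \<psi> \<le> F (y, z)" if "y \<in> {a..b}" "0 < z" for y z
  proof -
    have y: "0 < y" using that J by auto
    have "F \<psi> \<le> F (y, C y / A)" using \<psi>(2) that by auto
    also have "\<dots> \<le> F (y, z)" using g_ge_profile[OF C[OF y] that(2)] F[OF y] that(2) C[OF y] A_pos by simp
    finally show ?thesis .
  qed
  moreover have "\<psi> \<in> {a..b} \<times> {0<..}" using \<psi>(1) pos_C by auto
  ultimately show "\<exists>\<psi>. is_arg_min F (\<lambda>\<psi>. \<psi> \<in> {a..b} \<times> {0<..}) \<psi>"
    by (intro exI[of _ \<psi>]) (auto simp: is_arg_min_linorder)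
  assume m: "is_arg_min F (\<lambda>\<psi>. \<psi> \<in> {a..b} \<times> {0<..}) (\<theta>, v)"
  then have in_J: "a \<le> \<theta>" "\<theta> \<le> b" "0 < v"
    and F_min: "\<And>y z. (y, z) \<in> {a..b} \<times> {0<..} \<Longrightarrow> F (\<theta>, v) \<le> F (y, z)"
    unfolding is_arg_min_linorder by auto
  then have pos: "0 < \<theta>" using J by auto
  have min: "g \<theta> v \<le> g \<theta> y" if "0 < y" for y
    using F_min[of \<theta> y] F[of \<theta> y] F[OF pos, of v] pos in_J that by simp
  have "0 \<le> (A - C \<theta> / v) / v"
    by (rule DERIV_nonneg_if_right_min[OF DERIV_g_v, where b="v + 1"]) (use in_J min in auto)
  moreover have "(A - C \<theta> / v) / v \<le> 0"
    by (rule DERIV_nonpos_if_left_min[OF DERIV_g_v, where a=0]) (use in_J min in auto)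
  ultimately have "(A - C \<theta> / v) / v = 0" by linarith
  then have "A * v = C \<theta>" using in_J by (simp add: field_simps)
  then have "A * (\<theta> * v) = \<theta> * C \<theta>" by (simp add: mult_ac)
  moreover have "(\<theta> + \<theta>\<^sup>2) * R \<le> (b + b\<^sup>2) * R"
    using in_J pos R_nonneg by (intro mult_right_mono add_mono power_mono) auto
  ultimately show "\<bar>\<theta> * v - H / A\<bar> \<le> (b + b\<^sup>2) * (R / A)"
    using mult_C_bounds[OF pos] by (intro near_of_bounds) linarith+
qed

section \<open>Excluding extreme values of \<theta> in the unbounded strip\<close>

lemma L_bounds:
  assumes "0 < \<theta>"
  shows "(\<Sum>p\<in>P. w p * ln (2 * \<theta> * \<Delta> p)) - 2 * \<theta> * R \<le> L \<theta>" "L \<theta> \<le> (\<Sum>p\<in>P. w p * ln (2 * \<theta> * \<Delta> p))"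
proof -
  have y: "0 < 2 * \<theta> * \<Delta> p" if "p \<in> P" for p using that \<Delta> assms by simp
  have "(\<Sum>p\<in>P. w p * ln (2 * \<theta> * \<Delta> p)) - 2 * \<theta> * R
      \<le> (\<Sum>p\<in>P. w p * ln (2 * \<theta> * \<Delta> p)) - 2 * \<theta> * (\<Sum>p\<in>P. w p * \<Delta> p)"
    using R_parts(1) assms by simp
  also have "\<dots> = (\<Sum>p\<in>P. w p * (ln (2 * \<theta> * \<Delta> p) - 2 * \<theta> * \<Delta> p))"
    by (simp add: right_diff_distrib sum_subtractf sum_distrib_left mult_ac)
  also have "\<dots> \<le> L \<theta>"
    unfolding L_def by (intro sum_mono mult_left_mono w ln_one_minus_exp_bounds y)
  finally show "(\<Sum>p\<in>P. w p * ln (2 * \<theta> * \<Delta> p)) - 2 * \<theta> * R \<le> L \<theta>" .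
  show "L \<theta> \<le> (\<Sum>p\<in>P. w p * ln (2 * \<theta> * \<Delta> p))"
    unfolding L_def by (intro sum_mono mult_left_mono w ln_one_minus_exp_bounds y)
qed

lemma L_mono: assumes "0 < \<theta>" "\<theta> \<le> \<theta>'" shows "L \<theta> \<le> L \<theta>'"
  unfolding L_def
proof (intro sum_mono mult_left_mono w)
  fix p assume p: "p \<in> P"
  then have "0 < \<theta> * \<Delta> p" "\<theta> * \<Delta> p \<le> \<theta>' * \<Delta> p" using \<Delta>[OF p] assms by auto
  then show "ln (1 - exp (- (2 * \<theta> * \<Delta> p))) \<le> ln (1 - exp (- (2 * \<theta>' * \<Delta> p)))"
    by (intro ln_mono) auto
qed

text \<open>The logarithms of the distances, which may be arbitrarily negative, cancel in the
  difference. Only \<open>\<theta>'\<close> costs an error, because ln (1 - exp (- y)) \<le> ln y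
  holds without one.\<close>

lemma L_diff:
  assumes "0 < \<theta>" "0 < \<theta>'"
  shows "A * ln (\<theta>' / \<theta>) - 2 * \<theta>' * R \<le> L \<theta>' - L \<theta>"
proof -
  have "A * ln (\<theta>' / \<theta>) = (\<Sum>p\<in>P. w p * ln (2 * \<theta>' * \<Delta> p)) - (\<Sum>p\<in>P. w p * ln (2 * \<theta> * \<Delta> p))"
    unfolding A_def sum_distrib_right sum_subtractf[symmetric] right_diff_distrib[symmetric]
  proof (intro sum.cong refl)
    fix p assume p: "p \<in> P"
    show "w p * ln (\<theta>' / \<theta>) = w p * (ln (2 * \<theta>' * \<Delta> p) - ln (2 * \<theta> * \<Delta> p))"
      using \<Delta>[OF p] assms by (simp add: ln_div ln_mult)
  qed
  then show ?thesis using L_bounds(1)[OF assms(2)] L_bounds(2)[OF assms(1)] by linarith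
qed

text \<open>Outside a compact range, \<open>\<theta>\<close> is beaten by \<open>t = H / (A v)\<close>, for which the leading parts of
  \<open>A ln v + L\<close> and \<open>C / v\<close> balance.\<close>

lemma g_large_\<theta>:
  assumes "0 < v" "0 < H" and t: "t = H / (A * v)" and \<beta>: "exp 2 * t \<le> \<beta>" "\<beta> \<le> \<theta>" and R: "2 * \<beta> * R < A"
  shows "g t v < g \<theta> v"
proof -
  have t0: "0 < t" using assms A_pos by simp
  have \<beta>0: "0 < \<beta>" using t0 \<beta>(1) by (smt (verit) exp_gt_zero mult_pos_pos)
  \<comment> \<open>The factor exp 2 makes the logarithmic part grow by 2 \<open>A\<close> up to the
    remainder. One \<open>A\<close> pays for that remainder, the other for the \<open>A\<close> in
    the bound on \<open>C t / v\<close>.\<close>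
  have "ln (exp 2) \<le> ln (\<beta> / t)" using \<beta> t0 \<beta>0 by (intro ln_mono) (auto simp: field_simps)
  then have "A * 2 \<le> A * ln (\<beta> / t)" using A_pos by simp
  then have "2 * A - 2 * \<beta> * R \<le> L \<beta> - L t" using L_diff[OF t0 \<beta>0] by linarith
  moreover have "L \<beta> \<le> L \<theta>" using \<beta>0 \<beta>(2) by (rule L_mono)
  ultimately have 1: "A < L \<theta> - L t" using R by linarith
  have "t \<le> \<beta>"
  proof -
    have "1 * t \<le> exp 2 * t" using t0 by (intro mult_right_mono) auto
    then show ?thesis using \<beta> by simp
  qed
  then have tt: "t \<le> \<theta>" "0 < \<theta>" using \<beta> \<beta>0 by auto
  have "C t \<le> H / t + T t" by (rule C_bounds(2)[OF t0])
  also have "H / t = A * v" using t t0 assms A_pos by simp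
  also have "T t \<le> T \<theta>" by (rule T_mono[OF t0 tt(1)])
  also have "T \<theta> \<le> C \<theta>"
    unfolding T_def C_def
  proof (intro sum_mono mult_left_mono)
    fix p assume p: "p \<in> P"
    have "0 < sinh (\<theta> * \<Delta> p)" using \<Delta>[OF p] tt by simp
    then show "tanh (\<theta> * \<Delta> p / 2) * B p \<le> D p / sinh (\<theta> * \<Delta> p) + tanh (\<theta> * \<Delta> p / 2) * B p"
      using D[OF p] by simp
    show "0 \<le> w p / 2" using w[OF p] by simp
  qed
  finally have "C t / v \<le> (A * v + C \<theta>) / v" using assms by (intro divide_right_mono) auto
  then have "C t / v \<le> A + C \<theta> / v" using assms by (simp add: add_divide_distrib)
  then show ?thesis using 1 unfolding g_def by linarith
qed

text \<open>With y = t / \<theta> the term \<open>C / v\<close> is about \<open>A * y\<close>, while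
  the logarithmic part falls by at most \<open>A * y / 2\<close> up to the remainder. For y \<ge> 8
  a surplus of at least 4 \<open>A\<close> is left; it covers the \<open>A\<close> from
  \<open>C t / v\<close> and all remainders, which together stay below another
  \<open>A\<close>.\<close>

lemma g_small_\<theta>:
  assumes "0 < v" "0 < H" and t: "t = H / (A * v)" and \<theta>: "0 < \<theta>" "8 * \<theta> \<le> t"
    and R: "(2 * t + 1 / (2 * v) + t / (2 * v)) * R < A"
  shows "g t v < g \<theta> v"
proof -
  have t0: "0 < t" using assms A_pos by simp
  define y where "y = t / \<theta>"
  have y: "8 \<le> y" using \<theta> by (simp add: y_def field_simps)
  have "ln (y / 2) \<le> y / 2 - 1" using y by (intro ln_le_minus_one) auto
  moreover have "ln (y / 2) = ln y - ln 2" using y by (simp add: ln_div)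
  ultimately have "ln y \<le> y / 2 - 1 + ln 2" by linarith
  then have "A * ln y \<le> A * (y / 2)" using A_pos ln2_le_25_over_36 by simp
  moreover have "ln (\<theta> / t) = - ln y" using \<theta> t0 by (simp add: y_def ln_div)
  ultimately have L: "- (A * (y / 2)) - 2 * \<theta> * R \<le> L \<theta> - L t"
    using L_diff[OF t0 \<theta>(1)] by simp
  have "C t / v \<le> (H / t + t / 2 * R) / v"
    using C_bounds(2)[OF t0] T_bounds(2)[OF t0] assms(1) by (intro divide_right_mono) auto
  also have "\<dots> = A + t / (2 * v) * R" using t t0 assms A_pos by (simp add: field_simps)
  finally have 1: "C t / v \<le> A + t / (2 * v) * R" .
  have "(H / \<theta> - R / 2) / v \<le> C \<theta> / v"
    using C_bounds(1)[OF \<theta>(1)] T_bounds(1)[OF \<theta>(1)] assms(1) by (intro divide_right_mono) auto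
  moreover have "(H / \<theta> - R / 2) / v = A * y - 1 / (2 * v) * R"
  proof -
    have "H = A * v * t" using t assms A_pos by simp
    then show ?thesis using assms(1) \<theta> by (simp add: y_def field_simps)
  qed
  ultimately have 2: "A * y - 1 / (2 * v) * R \<le> C \<theta> / v" by simp
  have "A * 8 \<le> A * y" using y A_pos by simp
  moreover have "2 * \<theta> * R \<le> 2 * t * R" using \<theta> t0 R_nonneg by (intro mult_right_mono) auto
  ultimately show ?thesis using L 1 2 R A_pos unfolding g_def distrib_right by (simp, linarith)
qed

text \<open>Extreme \<theta> lose against \<open>t v\<close> at the same v, so \<open>f v\<close>
  cancels and a minimizer over a compact rectangle is one over the whole strip. As \<theta> ranges
  over an open half-line, both one-sided conditions in \<theta> are available and v is never
  moved.\<close>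

lemma arg_min_strip:
  assumes F: "\<And>\<theta> v. 0 < \<theta> \<Longrightarrow> 0 < v \<Longrightarrow> F (\<theta>, v) = g \<theta> v + f v" and f: "continuous_on {0<..} f"
    and J: "0 < c" "c \<le> d" and h: "0 < h1" "h1 \<le> H / A" "H / A \<le> h2"
    and \<beta>: "\<beta> = exp 2 * h2 / c" and R: "(2 * \<beta> + 1 / (2 * c) + \<beta> / (2 * c)) * R < A"
  shows "\<exists>\<psi>. is_arg_min F (\<lambda>\<psi>. \<psi> \<in> {0<..} \<times> {c..d}) \<psi>"
    and "is_arg_min F (\<lambda>\<psi>. \<psi> \<in> {0<..} \<times> {c..d}) (\<theta>, v) \<Longrightarrow> \<bar>\<theta> * v - H / A\<bar> \<le> K \<beta> d * (R / A)"
proof -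
  \<comment> \<open>\<open>\<alpha>\<close> and \<open>\<beta>\<close> are chosen so that
    \<open>8 * \<alpha> \<le> t v\<close> and \<open>exp 2 * t v \<le> \<beta>\<close> for every v
    in {c..d}, the thresholds for small and large \<theta>.\<close>
  define \<alpha> where "\<alpha> = h1 / d / 8"
  have d: "0 < d" using J by simp
  have \<alpha>0: "0 < \<alpha>" using h d by (simp add: \<alpha>_def)
  have h2: "0 < h2" using h by linarith
  have H: "0 < H" using h A_pos by (smt (verit) zero_less_divide_iff)
  have \<beta>0: "0 < \<beta>" using h2 J by (simp add: \<beta>)
  define t where "t v = H / (A * v)" for v
  have tv: "8 * \<alpha> \<le> t v" "exp 2 * t v \<le> \<beta>" "0 < t v" "t v \<le> \<beta>" if "c \<le> v" "v \<le> d" for v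
  proof -
    have t: "t v = (H / A) / v" by (simp add: t_def)
    have "h1 / d \<le> (H / A) / v" by (rule frac_le) (use that h J d in linarith)+
    then show "8 * \<alpha> \<le> t v" by (simp add: t \<alpha>_def)
    have "exp 2 * t v = exp 2 * (H / A) / v" by (simp add: t)
    also have "\<dots> \<le> exp 2 * h2 / c"
      by (intro frac_le mult_left_mono mult_nonneg_nonneg) (use that h J h2 in \<open>simp_all only: exp_ge_zero less_imp_le\<close>)
    finally show 2: "exp 2 * t v \<le> \<beta>" by (simp add: \<beta>)
    show 3: "0 < t v" using that J H A_pos by (simp add: t_def)
    have "1 * t v \<le> exp 2 * t v" using 3 by (intro mult_right_mono) auto
    with 2 show "t v \<le> \<beta>" by simp
  qed
  have \<alpha>\<beta>: "\<alpha> \<le> \<beta>" using tv(1,4)[of c] J \<alpha>0 by simp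
  have out: "g (t v) v < g \<theta> v" if "c \<le> v" "v \<le> d" "0 < \<theta>" "\<theta> \<le> \<alpha> \<or> \<beta> \<le> \<theta>" for \<theta> v
  proof (cases "\<beta> \<le> \<theta>")
    case True
    have "0 \<le> (1 / (2 * c) + \<beta> / (2 * c)) * R" using J \<beta>0 R_nonneg by simp
    then have "2 * \<beta> * R < A" using R unfolding distrib_right by linarith
    then show ?thesis
      using that J by (intro g_large_\<theta>[OF _ H t_def tv(2) True]) auto
  next
    case False
    then have "8 * \<theta> \<le> t v" using that tv(1)[OF that(1,2)] by auto
    moreover have "(2 * t v + 1 / (2 * v) + t v / (2 * v)) * R \<le> (2 * \<beta> + 1 / (2 * c) + \<beta> / (2 * c)) * R"
      using that J tv[OF that(1,2)] R_nonneg \<beta>0 by (intro mult_right_mono add_mono frac_le) auto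
    ultimately show ?thesis
      using that J R by (intro g_small_\<theta>[OF _ H t_def]) auto
  qed
  have S: "compact ({\<alpha>..\<beta>} \<times> {c..d})" "{\<alpha>..\<beta>} \<times> {c..d} \<noteq> {}" "{\<alpha>..\<beta>} \<times> {c..d} \<subseteq> {0<..} \<times> {0<..}"
    using J \<alpha>\<beta> \<alpha>0 by (auto intro!: compact_Times)
  obtain \<psi> where \<psi>: "\<psi> \<in> {\<alpha>..\<beta>} \<times> {c..d}" "\<forall>\<psi>'\<in>{\<alpha>..\<beta>} \<times> {c..d}. F \<psi> \<le> F \<psi>'"
    using exists_min_on_compact[OF F f S] by blast
  have "F \<psi> \<le> F (y, z)" if "0 < y" "c \<le> z" "z \<le> d" for y z
  proof (cases "\<alpha> \<le> y \<and> y \<le> \<beta>")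
    case True then show ?thesis using \<psi>(2) that by auto
  next
    case False
    have z: "0 < z" using that J by simp
    have "F \<psi> \<le> F (t z, z)" using \<psi>(2) tv[of z] that \<alpha>0 by auto
    also have "\<dots> \<le> F (y, z)"
      using out[OF that(2,3,1)] False F[OF tv(3) z] F[OF that(1) z] that by auto
    finally show ?thesis .
  qed
  moreover have "\<psi> \<in> {0<..} \<times> {c..d}" using \<psi>(1) \<alpha>0 by auto
  ultimately show "\<exists>\<psi>. is_arg_min F (\<lambda>\<psi>. \<psi> \<in> {0<..} \<times> {c..d}) \<psi>"
    by (intro exI[of _ \<psi>]) (auto simp: is_arg_min_linorder)
  assume "is_arg_min F (\<lambda>\<psi>. \<psi> \<in> {0<..} \<times> {c..d}) (\<theta>, v)"
  then have in_J: "0 < \<theta>" "c \<le> v" "v \<le> d"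
    and F_min: "\<And>y z. (y, z) \<in> {0<..} \<times> {c..d} \<Longrightarrow> F (\<theta>, v) \<le> F (y, z)"
    unfolding is_arg_min_linorder by auto
  then have pos: "0 < \<theta>" "0 < v" using J by auto
  have min: "g \<theta> v \<le> g y v" if "0 < y" for y
    using F_min[of y v] F[of y v] F[OF pos] J in_J that by simp
  have "\<theta> < \<beta>" using out[OF in_J(2,3,1)] min[OF tv(3)[OF in_J(2,3)]] by force
  then have k: "K \<theta> v * R \<le> K \<beta> d * R"
    unfolding K_def using in_J pos R_nonneg
    by (intro mult_right_mono add_mono mult_mono power_mono) auto
  have "H - K \<theta> v * R \<le> A * (\<theta> * v)"
    using pos by (intro \<theta>_right_min[of \<theta> v "\<theta> + 1"] min) auto
  moreover have "A * (\<theta> * v) \<le> H + K \<theta> v * R"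
    using pos by (intro \<theta>_left_min[of \<theta> v 0] min) auto
  ultimately show "\<bar>\<theta> * v - H / A\<bar> \<le> K \<beta> d * (R / A)"
    using k by (intro near_of_bounds) linarith+
qed

end

section \<open>The quadratic form in the innovations\<close>

text \<open>Every |y k| is at most the l^3 norm \<open>r\<close> of the family, so the weighted sum
  is at most the total weight times \<open>r\<close>.\<close>

lemma weighted_sum_cube_le:
  fixes w y :: "'i \<Rightarrow> real"
  assumes "finite S" and w: "\<And>k. k \<in> S \<Longrightarrow> 0 \<le> w k"
  shows "\<bar>\<Sum>k\<in>S. w k * y k\<bar>^3 \<le> (\<Sum>k\<in>S. w k)^3 * (\<Sum>k\<in>S. \<bar>y k\<bar>^3)"
proof -
  define r where "r = root 3 (\<Sum>k\<in>S. \<bar>y k\<bar>^3)"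
  have r3: "r^3 = (\<Sum>k\<in>S. \<bar>y k\<bar>^3)" by (simp add: r_def odd_real_root_pow)
  have r: "\<bar>y k\<bar> \<le> r" if "k \<in> S" for k
  proof -
    have "\<bar>y k\<bar>^3 \<le> (\<Sum>k\<in>S. \<bar>y k\<bar>^3)" using that assms(1) by (intro member_le_sum) auto
    then have "root 3 (\<bar>y k\<bar>^3) \<le> r" unfolding r_def by (intro real_root_le_mono) auto
    then show ?thesis by (simp add: odd_real_root_power_cancel)
  qed
  have "\<bar>\<Sum>k\<in>S. w k * y k\<bar> \<le> (\<Sum>k\<in>S. w k * r)"
    using w r by (intro order_trans[OF sum_abs] sum_mono) (simp add: abs_mult mult_left_mono)
  also have "\<dots> = (\<Sum>k\<in>S. w k) * r" by (simp add: sum_distrib_right)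
  finally have "\<bar>\<Sum>k\<in>S. w k * y k\<bar>^3 \<le> ((\<Sum>k\<in>S. w k) * r)^3" by (intro power_mono) auto
  then show ?thesis by (simp add: power_mult_distrib r3)
qed

text \<open>Reduces the third absolute moment of a centred squared innovation to its sixth
  moment.\<close>

lemma cube_minus_one_le: "\<bar>x\<^sup>2 - 1\<bar>^3 \<le> x^6 + (1::real)"
proof -
  have "\<bar>x\<^sup>2 - 1\<bar> \<le> max (x\<^sup>2) 1" by (auto simp: abs_if max_def)
  then have "\<bar>x\<^sup>2 - 1\<bar>^3 \<le> (max (x\<^sup>2) 1)^3" by (intro power_mono) auto
  also have "\<dots> \<le> (x\<^sup>2)^3 + 1" by (auto simp: max_def)
  finally show ?thesis by simp
qed

text \<open>One row of the array, with \<open>n\<close> and the points \<open>u\<close> fixed; all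
  estimates in it are explicit in \<open>n\<close>.\<close>

locale ou_sample = ou M \<theta>\<^sub>0 v\<^sub>0 Z for M :: "'a measure" and \<theta>\<^sub>0 v\<^sub>0 Z +
  fixes w :: "nat \<Rightarrow> real" and K n :: nat and u :: "nat \<Rightarrow> real"
  assumes w: "\<And>k. 1 \<le> k \<Longrightarrow> 0 \<le> w k" and K: "1 \<le> K" and wK: "0 < w K" and w_gt_K: "\<And>k. K < k \<Longrightarrow> w k = 0"
    and u: "\<And>i. i \<in> {1..n} \<Longrightarrow> u i \<in> {0..1}" and mono: "strict_mono_on {1..n} u"
begin

definition W :: "nat \<Rightarrow> nat \<Rightarrow> 'a \<Rightarrow> real" where "W i k = innov (u i) (u (i + k))"
definition Q :: "(nat \<times> nat) set" where "Q = (SIGMA i:{1..n-1}. {1..min K (n - i)})"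
text \<open>Pairs are grouped by their left index, which turns the quadratic form into a sum along a
  sequence with finite range of dependence. The value 0 outside the range lets the moment bounds
  hold for every index.\<close>

definition \<xi> :: "nat \<Rightarrow> 'a \<Rightarrow> real" where
  "\<xi> i \<omega> = (if i \<in> {1..n-1} then \<Sum>k=1..min K (n - i). w k * ((W i k \<omega>)\<^sup>2 - 1) else 0)"
definition wsum :: real where "wsum = (\<Sum>k=1..K. w k)"

lemma u_less: "1 \<le> i \<Longrightarrow> i < j \<Longrightarrow> j \<le> n \<Longrightarrow> u i < u j"
  using mono by (auto simp: strict_mono_on_def)

lemma u_le: "1 \<le> i \<Longrightarrow> i \<le> j \<Longrightarrow> j \<le> n \<Longrightarrow> u i \<le> u j"
  using u_less[of i j] by (cases "i = j") auto

lemma Q_D: assumes "(i, k) \<in> Q"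
  shows "1 \<le> i" "1 \<le> k" "k \<le> K" "i + k \<le> n" "u i \<in> {0..1}" "u (i + k) \<in> {0..1}" "u i < u (i + k)"
  using assms u u_less[of i "i + k"] by (auto simp: Q_def)

lemma finite_Q: "finite Q" by (simp add: Q_def)

lemma lc_W: "(i, k) \<in> Q \<Longrightarrow> lc (W i k)"
  unfolding W_def by (intro lc_innov Q_D)

lemma W_variance: "(i, k) \<in> Q \<Longrightarrow> expectation (\<lambda>\<omega>. (W i k \<omega>)\<^sup>2) = 1"
  unfolding W_def by (intro innov_variance Q_D)

lemma W_integrable: "(i, k) \<in> Q \<Longrightarrow> integrable M (\<lambda>\<omega>. (W i k \<omega>)^m)"
  by (intro lc_integrable_power lc_W)

lemma in_Q: "i \<in> {1..n-1} \<Longrightarrow> k \<in> {1..min K (n - i)} \<Longrightarrow> (i, k) \<in> Q"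
  by (simp add: Q_def)

text \<open>16 is the sixth moment 15 of a standard normal variable plus 1, and \<open>K\<close>
  bounds the number of lags. The leading 1 makes the same constant bound the first and second
  moments and gives \<kappa> \<ge> 1. Neither n nor the spacing enters.\<close>

definition \<kappa> :: real where "\<kappa> = 1 + 16 * real K * wsum^3"

lemma wsum_pos: "0 < wsum"
proof -
  have "w K \<le> wsum" unfolding wsum_def using w K by (intro member_le_sum) auto
  then show ?thesis using wK by simp
qed

lemma \<kappa>_ge_1: "1 \<le> \<kappa>" using wsum_pos by (simp add: \<kappa>_def)

lemma \<xi>_measurable [measurable]: "\<xi> i \<in> borel_measurable M"
proof (cases "i \<in> {1..n-1}")
  case True
  have "W i k \<in> borel_measurable M" if "k \<in> {1..min K (n - i)}" for k
    by (intro lc_measurable lc_W in_Q True that)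
  then have "(\<lambda>\<omega>. \<Sum>k=1..min K (n - i). w k * ((W i k \<omega>)\<^sup>2 - 1)) \<in> borel_measurable M"
    by (intro borel_measurable_sum borel_measurable_times borel_measurable_diff borel_measurable_power borel_measurable_const)
  then show ?thesis using True by (simp add: \<xi>_def[abs_def])
next
  case False
  then have "\<xi> i = (\<lambda>_. 0)" by (auto simp: \<xi>_def)
  then show ?thesis by simp
qed

lemma \<xi>_mean: "expectation (\<xi> i) = 0"
proof (cases "i \<in> {1..n-1}")
  case True
  have "expectation (\<xi> i) = (\<Sum>k=1..min K (n - i). expectation (\<lambda>\<omega>. w k * ((W i k \<omega>)\<^sup>2 - 1)))"
    using True W_integrable[OF in_Q[OF True], of _ 2]
    by (subst Bochner_Integration.integral_sum[symmetric]) (auto simp: \<xi>_def[abs_def])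
  also have "\<dots> = 0"
    using W_integrable[OF in_Q[OF True], of _ 2] W_variance[OF in_Q[OF True]]
    by (intro sum.neutral) (auto simp: prob_space)
  finally show ?thesis .
qed (auto simp: \<xi>_def[abs_def])

lemma \<xi>_cube: "integrable M (\<lambda>\<omega>. \<bar>\<xi> i \<omega>\<bar>^3)" "expectation (\<lambda>\<omega>. \<bar>\<xi> i \<omega>\<bar>^3) \<le> \<kappa> - 1"
proof -
  have "integrable M (\<lambda>\<omega>. \<bar>\<xi> i \<omega>\<bar>^3) \<and> expectation (\<lambda>\<omega>. \<bar>\<xi> i \<omega>\<bar>^3) \<le> \<kappa> - 1"
  proof (cases "i \<in> {1..n-1}")
    case True
    let ?S = "{1..min K (n - i)}"
    define b where "b \<omega> = wsum^3 * (\<Sum>k\<in>?S. (W i k \<omega>)^6 + 1)" for \<omega>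
    have le: "\<bar>\<xi> i \<omega>\<bar>^3 \<le> b \<omega>" for \<omega>
    proof -
      have "\<bar>\<xi> i \<omega>\<bar>^3 \<le> (\<Sum>k\<in>?S. w k)^3 * (\<Sum>k\<in>?S. \<bar>(W i k \<omega>)\<^sup>2 - 1\<bar>^3)"
        using True w by (simp add: \<xi>_def del: atLeastAtMost_iff min.bounded_iff) (rule weighted_sum_cube_le, auto)
      also have "\<dots> \<le> b \<omega>"
        unfolding b_def wsum_def
        by (intro mult_mono power_mono sum_mono sum_mono2 cube_minus_one_le zero_le_power sum_nonneg) (auto intro: w)
      finally show ?thesis .
    qed
    have ib: "integrable M b"
      unfolding b_def using W_integrable[OF in_Q[OF True], of _ 6] by auto
    have "expectation b = wsum^3 * (\<Sum>k\<in>?S. 16)"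
    proof -
      have "expectation (\<lambda>\<omega>. \<Sum>k\<in>?S. (W i k \<omega>)^6 + 1) = (\<Sum>k\<in>?S. expectation (\<lambda>\<omega>. (W i k \<omega>)^6 + 1))"
        using W_integrable[OF in_Q[OF True], of _ 6] by (intro Bochner_Integration.integral_sum) auto
      also have "\<dots> = (\<Sum>k\<in>?S. 16)"
      proof (intro sum.cong refl)
        fix k assume k: "k \<in> ?S"
        note q = in_Q[OF True k]
        have "expectation (\<lambda>\<omega>. (W i k \<omega>)^6) = 15"
          unfolding W_def by (rule innov_sixth_moment[OF Q_D(5-7)[OF q]])
        then show "expectation (\<lambda>\<omega>. (W i k \<omega>)^6 + 1) = 16"
          using W_integrable[OF q, of 6] by (simp add: prob_space)
      qed
      finally show ?thesis unfolding b_def by simp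
    qed
    also have "\<dots> \<le> \<kappa> - 1"
      using wsum_pos by (simp add: \<kappa>_def mult_ac mult_left_mono)
    finally have eb: "expectation b \<le> \<kappa> - 1" .
    have i: "integrable M (\<lambda>\<omega>. \<bar>\<xi> i \<omega>\<bar>^3)"
      by (rule Bochner_Integration.integrable_bound[OF ib])
         (use le in \<open>auto intro!: order_trans[OF _ abs_ge_self]\<close>)
    have "expectation (\<lambda>\<omega>. \<bar>\<xi> i \<omega>\<bar>^3) \<le> expectation b"
      by (rule integral_mono[OF i ib le])
    with i eb show ?thesis by simp
  next
    case False
    then have "\<xi> i = (\<lambda>_. 0)" by (auto simp: \<xi>_def)
    then show ?thesis using \<kappa>_ge_1 by simp
  qed
  then show "integrable M (\<lambda>\<omega>. \<bar>\<xi> i \<omega>\<bar>^3)" "expectation (\<lambda>\<omega>. \<bar>\<xi> i \<omega>\<bar>^3) \<le> \<kappa> - 1" by auto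
qed

lemma \<xi>_abs: "integrable M (\<xi> i)" "expectation (\<lambda>\<omega>. \<bar>\<xi> i \<omega>\<bar>) \<le> \<kappa>"
  and \<xi>_sq: "integrable M (\<lambda>\<omega>. (\<xi> i \<omega>)\<^sup>2)" "expectation (\<lambda>\<omega>. (\<xi> i \<omega>)\<^sup>2) \<le> \<kappa>"
proof -
  have b: "integrable M (\<lambda>\<omega>. 1 + \<bar>\<xi> i \<omega>\<bar>^3)" "expectation (\<lambda>\<omega>. 1 + \<bar>\<xi> i \<omega>\<bar>^3) \<le> \<kappa>"
    using \<xi>_cube[of i] by (auto simp: prob_space)
  show "integrable M (\<xi> i)" "integrable M (\<lambda>\<omega>. (\<xi> i \<omega>)\<^sup>2)"
    by (rule Bochner_Integration.integrable_bound[OF b(1)];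
        use power_le_one_plus_cube in \<open>auto intro!: order_trans[OF _ abs_ge_self]\<close>)+
  then show "expectation (\<lambda>\<omega>. \<bar>\<xi> i \<omega>\<bar>) \<le> \<kappa>" "expectation (\<lambda>\<omega>. (\<xi> i \<omega>)\<^sup>2) \<le> \<kappa>"
    using b power_le_one_plus_cube by (auto intro!: order_trans[OF integral_mono[OF _ b(1)] b(2)])
qed

definition \<epsilon> :: "nat \<Rightarrow> 'a \<Rightarrow> real" where "\<epsilon> i = innov (u i) (u (i + 1))"

text \<open>Adjacent innovations are orthonormal. A linear combination is therefore centred normal
  with variance the sum of the squared coefficients, and its characteristic function splits into the
  marginal ones.\<close>

lemma \<epsilon>_indep: "indep_vars (\<lambda>_. borel) \<epsilon> {1..<n}"
proof (cases "{1..<n} = {}")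
  case True
  then show ?thesis by (simp add: indep_vars_def indep_sets_def)
next
  case False
  have lc: "lc (\<epsilon> i)" if "i \<in> {1..<n}" for i
    unfolding \<epsilon>_def using that u by (intro lc_innov) auto
  have var: "expectation (\<lambda>\<omega>. (\<epsilon> i \<omega>)\<^sup>2) = 1" if "i \<in> {1..<n}" for i
    unfolding \<epsilon>_def using that u u_less[of i "i + 1"] by (intro innov_variance) auto
  have cov: "expectation (\<lambda>\<omega>. \<epsilon> i \<omega> * \<epsilon> j \<omega>) = (if i = j then 1 else 0)" if "i \<in> {1..<n}" "j \<in> {1..<n}" for i j
  proof -
    have *: "expectation (\<lambda>\<omega>. \<epsilon> j \<omega> * \<epsilon> i \<omega>) = 0" if "1 \<le> i" "i < j" "j < n" for i j
      unfolding \<epsilon>_def using that u u_less[of i "i + 1"] u_le[of "i + 1" j] u_less[of j "j + 1"]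
      by (intro innov_orthogonal) auto
    show ?thesis
      using that *[of i j] *[of j i] var[of i] by (cases i j rule: linorder_cases) (auto simp: mult.commute power2_eq_square)
  qed
  show ?thesis
  proof (rule indep_vars_of_chf)
    fix t
    have "lc (\<lambda>\<omega>. \<Sum>i\<in>{1..<n}. t i * \<epsilon> i \<omega>)" by (intro lin_comb_sum lin_comb_scale lc)
    from centered_normal_moments(4)[OF lc_centered_normal[OF this], of 1]
    have "(CLINT \<omega>|M. iexp (\<Sum>i\<in>{1..<n}. t i * \<epsilon> i \<omega>))
      = exp (- (expectation (\<lambda>\<omega>. (\<Sum>i\<in>{1..<n}. t i * \<epsilon> i \<omega>)\<^sup>2) / 2))" by simp
    also have "expectation (\<lambda>\<omega>. (\<Sum>i\<in>{1..<n}. t i * \<epsilon> i \<omega>)\<^sup>2) = (\<Sum>i\<in>{1..<n}. (t i)\<^sup>2)"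
    proof -
      have "(\<Sum>i\<in>{1..<n}. t i * \<epsilon> i \<omega>)\<^sup>2 = (\<Sum>i\<in>{1..<n}. \<Sum>j\<in>{1..<n}. t i * t j * (\<epsilon> i \<omega> * \<epsilon> j \<omega>))" for \<omega>
        unfolding power2_eq_square sum_product by (simp add: mult_ac)
      moreover have "expectation (\<lambda>\<omega>. \<Sum>i\<in>{1..<n}. \<Sum>j\<in>{1..<n}. t i * t j * (\<epsilon> i \<omega> * \<epsilon> j \<omega>))
          = (\<Sum>i\<in>{1..<n}. \<Sum>j\<in>{1..<n}. expectation (\<lambda>\<omega>. t i * t j * (\<epsilon> i \<omega> * \<epsilon> j \<omega>)))"
        by (intro integral_double_sum integrable_mult_right lc_integrable_mult lc)
      moreover have "\<dots> = (\<Sum>i\<in>{1..<n}. \<Sum>j\<in>{1..<n}. if i = j then t i * t j else 0)"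
        by (intro sum.cong refl) (use cov in auto)
      moreover have "\<dots> = (\<Sum>i\<in>{1..<n}. (t i)\<^sup>2)" by (simp add: power2_eq_square)
      ultimately show ?thesis by simp
    qed
    also have "complex_of_real (exp (- ((\<Sum>i\<in>{1..<n}. (t i)\<^sup>2) / 2))) = (\<Prod>i\<in>{1..<n}. complex_of_real (exp (- ((t i)\<^sup>2 / 2))))"
      by (simp add: exp_sum sum_divide_distrib sum_negf[symmetric])
    also have "\<dots> = (\<Prod>i\<in>{1..<n}. char (distr M borel (\<epsilon> i)) (t i))"
    proof (intro prod.cong refl)
      fix i assume i: "i \<in> {1..<n}"
      have "char (distr M borel (\<epsilon> i)) (t i) = (CLINT \<omega>|M. iexp (t i * \<epsilon> i \<omega>))"
        unfolding char_def using lc_measurable[OF lc[OF i]] by (subst integral_distr) auto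
      then show "complex_of_real (exp (- ((t i)\<^sup>2 / 2))) = char (distr M borel (\<epsilon> i)) (t i)"
        using centered_normal_moments(4)[OF lc_centered_normal[OF lc[OF i]], of "t i"] var[OF i] by simp
    qed
    finally show "(CLINT \<omega>|M. iexp (\<Sum>i\<in>{1..<n}. t i * \<epsilon> i \<omega>)) = (\<Prod>i\<in>{1..<n}. char (distr M borel (\<epsilon> i)) (t i))" .
  qed (use False lc_measurable[OF lc] in auto)
qed

text \<open>\<open>f l\<close> discounts \<open>Z (u l)\<close> to the time
  \<open>u (i + k)\<close>. Its increments telescope to the numerator of \<open>W i k\<close>, and
  each is a multiple of one adjacent innovation. Later only the range of \<open>l\<close> matters,
  not the coefficients.\<close>

lemma W_eq_sum_\<epsilon>:
  assumes "(i, k) \<in> Q"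
  shows "\<exists>c. \<forall>\<omega>. W i k \<omega> = (\<Sum>l\<in>{i..<i+k}. c l * \<epsilon> l \<omega>)"
proof -
  let ?c = "\<lambda>s t. sqrt (v\<^sub>0 * (1 - exp (- 2 * \<theta>\<^sub>0 * (t - s))))"
  note q = Q_D[OF assms]
  have "W i k \<omega> = (\<Sum>l\<in>{i..<i+k}. (exp (- \<theta>\<^sub>0 * (u (i + k) - u (l + 1))) * ?c (u l) (u (l + 1)) / ?c (u i) (u (i + k))) * \<epsilon> l \<omega>)" for \<omega>
  proof -
    define f where "f l = exp (- \<theta>\<^sub>0 * (u (i + k) - u l)) * Z (u l) \<omega>" for l
    have step: "f (Suc l) - f l = exp (- \<theta>\<^sub>0 * (u (i + k) - u (l + 1))) * (?c (u l) (u (l + 1)) * \<epsilon> l \<omega>)"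
      if "l \<in> {i..<i+k}" for l
    proof -
      have "u l < u (l + 1)" using that q by (intro u_less) auto
      then have "?c (u l) (u (l + 1)) \<noteq> 0" using \<theta>\<^sub>0 v\<^sub>0 by simp
      then have "?c (u l) (u (l + 1)) * \<epsilon> l \<omega> = Z (u (l + 1)) \<omega> - exp (- \<theta>\<^sub>0 * (u (l + 1) - u l)) * Z (u l) \<omega>"
        by (simp add: \<epsilon>_def innov_def)
      moreover have "exp (- \<theta>\<^sub>0 * (u (i + k) - u l)) = exp (- \<theta>\<^sub>0 * (u (i + k) - u (l + 1))) * exp (- \<theta>\<^sub>0 * (u (l + 1) - u l))"
        by (simp add: algebra_simps flip: exp_add)
      ultimately show ?thesis by (simp only: f_def right_diff_distrib Suc_eq_plus1 mult.assoc)
    qed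
    have "W i k \<omega> = (f (i + k) - f i) / ?c (u i) (u (i + k))"
      by (simp add: W_def innov_def f_def)
    also have "f (i + k) - f i = (\<Sum>l\<in>{i..<i+k}. f (Suc l) - f l)"
      by (simp add: sum_Suc_diff')
    also have "\<dots> = (\<Sum>l\<in>{i..<i+k}. exp (- \<theta>\<^sub>0 * (u (i + k) - u (l + 1))) * (?c (u l) (u (l + 1)) * \<epsilon> l \<omega>))"
      by (intro sum.cong refl step)
    finally show ?thesis by (simp add: sum_divide_distrib mult.assoc)
  qed
  then show ?thesis
    by (intro exI[of _ "\<lambda>l. exp (- \<theta>\<^sub>0 * (u (i + k) - u (l + 1))) * ?c (u l) (u (l + 1)) / ?c (u i) (u (i + k))"]) blast
qed

text \<open>\<open>\<xi> i\<close> is a function of the innovations with indices from i to i + K -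
  1, so separated index sets use disjoint groups of innovations. The factor \<open>a\<close>
  anticipates the normalization by the standard deviation.\<close>

lemma \<xi>_m_dependent: "m_dependent K {1..n-1} (\<lambda>i \<omega>. a * \<xi> i \<omega>)"
  unfolding m_dependent_def
proof (intro allI impI)
  fix A B assume AB: "A \<subseteq> {1..n-1}" "B \<subseteq> {1..n-1}" "\<forall>a\<in>A. \<forall>b\<in>B. a + K < b \<or> b + K < a"
  obtain c where c: "\<And>i k \<omega>. (i, k) \<in> Q \<Longrightarrow> W i k \<omega> = (\<Sum>l\<in>{i..<i+k}. c i k l * \<epsilon> l \<omega>)"
    using W_eq_sum_\<epsilon> by metis
  define G where "G i e = a * (\<Sum>k=1..min K (n - i). w k * ((\<Sum>l\<in>{i..<i+k}. c i k l * e l)\<^sup>2 - 1))"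
    for i and e :: "nat \<Rightarrow> real"
  define nb where "nb A = {l. \<exists>a\<in>A. a \<le> l \<and> l < a + K} \<inter> {1..<n}" for A
  have G: "restrict (\<lambda>i. a * \<xi> i \<omega>) S = (\<lambda>i\<in>S. G i (restrict (\<lambda>l. \<epsilon> l \<omega>) (nb S)))"
    if "S \<subseteq> {1..n-1}" for S \<omega>
  proof (rule restrict_ext)
    fix i assume i: "i \<in> S"
    then have i1: "i \<in> {1..n-1}" using that by auto
    have "W i k \<omega> = (\<Sum>l\<in>{i..<i+k}. c i k l * restrict (\<lambda>l. \<epsilon> l \<omega>) (nb S) l)" if k: "k \<in> {1..min K (n - i)}" for k
      unfolding c[OF in_Q[OF i1 k]]
    proof (intro sum.cong refl)
      fix l assume "l \<in> {i..<i+k}"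
      then have "l \<in> nb S" using i i1 k by (auto simp: nb_def intro!: bexI[of _ i])
      then show "c i k l * \<epsilon> l \<omega> = c i k l * restrict (\<lambda>l. \<epsilon> l \<omega>) (nb S) l" by simp
    qed
    then show "a * \<xi> i \<omega> = G i (restrict (\<lambda>l. \<epsilon> l \<omega>) (nb S))"
      using i1 by (simp add: \<xi>_def G_def)
  qed
  have Gm: "(\<lambda>e. \<lambda>i\<in>S. G i e) \<in> PiM (nb S) (\<lambda>_. borel) \<rightarrow>\<^sub>M PiM S (\<lambda>_. borel)" if "S \<subseteq> {1..n-1}" for S
  proof (rule measurable_restrict)
    fix i assume i: "i \<in> S"
    then have i1: "i \<in> {1..n-1}" using that by auto
    have "(\<lambda>e. e l) \<in> borel_measurable (PiM (nb S) (\<lambda>_. borel))"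
      if k: "k \<in> {1..min K (n - i)}" and l: "l \<in> {i..<i+k}" for k l
    proof -
      have "l \<in> nb S" using i i1 k l by (auto simp: nb_def intro!: bexI[of _ i])
      then show ?thesis by (rule measurable_component_singleton)
    qed
    then show "G i \<in> borel_measurable (PiM (nb S) (\<lambda>_. borel))"
      unfolding G_def by (intro borel_measurable_times borel_measurable_sum borel_measurable_diff
        borel_measurable_power borel_measurable_const)
  qed
  have "nb A \<inter> nb B = {}" using AB(3) by (fastforce simp: nb_def)
  then have "indep_var (PiM (nb A) (\<lambda>_. borel)) (\<lambda>\<omega>. restrict (\<lambda>i. \<epsilon> i \<omega>) (nb A))
      (PiM (nb B) (\<lambda>_. borel)) (\<lambda>\<omega>. restrict (\<lambda>i. \<epsilon> i \<omega>) (nb B))"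
    by (intro indep_var_restrict[OF \<epsilon>_indep]) (auto simp: nb_def)
  from indep_var_compose[OF this Gm[OF AB(1)] Gm[OF AB(2)]]
  show "indep_var (PiM A (\<lambda>_. borel)) (\<lambda>\<omega>. restrict (\<lambda>i. a * \<xi> i \<omega>) A)
      (PiM B (\<lambda>_. borel)) (\<lambda>\<omega>. restrict (\<lambda>i. a * \<xi> i \<omega>) B)"
    by (simp add: G[OF AB(1)] G[OF AB(2)] comp_def)
qed

end

text \<open>Only the last \<open>k\<close> and the first \<open>k\<close> values survive. Applied to
  the observation points this bounds the sum of distances, applied to squared process values it
  bounds the telescoping terms.\<close>

lemma lag_sum_telescope:
  fixes f :: "nat \<Rightarrow> real"
  assumes "k \<le> n"
  shows "(\<Sum>i=1..n-k. f (i + k) - f i) = (\<Sum>i\<in>{n-k<..n}. f i) - (\<Sum>i=1..k. f i)"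
proof -
  have 1: "(\<Sum>i=1..n. f i) = (\<Sum>i=1..n-k. f i) + (\<Sum>i\<in>{n-k<..n}. f i)"
  proof -
    have "{1..n} = {1..n-k} \<union> {n-k<..n}" by auto
    then show ?thesis by (simp only:) (rule sum.union_disjoint, auto)
  qed
  have 2: "(\<Sum>i=1..n. f i) = (\<Sum>i=1..k. f i) + (\<Sum>i\<in>{k<..n}. f i)"
  proof -
    have "{1..n} = {1..k} \<union> {k<..n}" using assms by auto
    then show ?thesis by (simp only:) (rule sum.union_disjoint, auto)
  qed
  have 3: "(\<Sum>i=1..n-k. f (i + k)) = (\<Sum>i\<in>{k<..n}. f i)"
    using assms by (intro sum.reindex_bij_witness[of _ "\<lambda>i. i - k" "\<lambda>i. i + k"]) auto
  show ?thesis using 1 2 3 by (simp add: sum_subtractf)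
qed

section \<open>Variance of the quadratic form\<close>

context ou_sample
begin

definition S :: "'a \<Rightarrow> real" where "S \<omega> = (\<Sum>i\<in>{1..n-1}. \<xi> i \<omega>)"
definition V :: real where "V = expectation (\<lambda>\<omega>. (S \<omega>)\<^sup>2)"

lemma S_measurable [measurable]: "S \<in> borel_measurable M"
  unfolding S_def[abs_def] by measurable

lemma S_eq: "S \<omega> = (\<Sum>(i, k)\<in>Q. w k * ((W i k \<omega>)\<^sup>2 - 1))"
proof -
  have "S \<omega> = (\<Sum>i\<in>{1..n-1}. \<Sum>k\<in>{1..min K (n - i)}. w k * ((W i k \<omega>)\<^sup>2 - 1))"
    unfolding S_def by (intro sum.cong refl) (simp only: \<xi>_def if_True)
  also have "\<dots> = (\<Sum>(i, k)\<in>Q. w k * ((W i k \<omega>)\<^sup>2 - 1))"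
    unfolding Q_def by (rule sum.Sigma) auto
  finally show ?thesis .
qed

lemma S_W_sq:
  "(\<Sum>i=1..n-1. \<Sum>k=1..min K (n - i). w k * (W_sq \<theta>\<^sub>0 v\<^sub>0 (\<lambda>t. Z t \<omega>) (u i) (u (i + k)) - 1)) = S \<omega>"
  unfolding S_def
proof (intro sum.cong refl)
  fix i assume i: "i \<in> {1..n-1}"
  show "(\<Sum>k=1..min K (n - i). w k * (W_sq \<theta>\<^sub>0 v\<^sub>0 (\<lambda>t. Z t \<omega>) (u i) (u (i + k)) - 1)) = \<xi> i \<omega>"
    unfolding \<xi>_def W_def if_P[OF i]
    by (intro sum.cong refl) (simp only: W_sq_eq_innov[OF Q_D(7)[OF in_Q[OF i]]])
qed

lemma S_mean: "expectation S = 0"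
proof -
  have "expectation S = (\<Sum>i\<in>{1..n-1}. expectation (\<xi> i))"
    unfolding S_def[abs_def] by (rule Bochner_Integration.integral_sum) (rule \<xi>_abs(1))
  then show ?thesis by (simp add: \<xi>_mean)
qed

lemma tau_sq_eq: "tau_sq M \<theta>\<^sub>0 v\<^sub>0 Z w K n u = V / n"
  unfolding tau_sq_def variance_of_def S_W_sq S_mean V_def by simp

lemma \<xi>_mult_integrable: "integrable M (\<lambda>\<omega>. \<xi> i \<omega> * \<xi> j \<omega>)"
  and \<xi>_mult_le: "expectation (\<lambda>\<omega>. \<xi> i \<omega> * \<xi> j \<omega>) \<le> \<kappa>"
proof -
  note le = abs_mult_le_mean_squares
  have *: "integrable M (\<lambda>\<omega>. ((\<xi> i \<omega>)\<^sup>2 + (\<xi> j \<omega>)\<^sup>2) / 2)"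
    by (intro integrable_divide_zero Bochner_Integration.integrable_add \<xi>_sq(1))
  show 1: "integrable M (\<lambda>\<omega>. \<xi> i \<omega> * \<xi> j \<omega>)"
    by (rule Bochner_Integration.integrable_bound[OF *]) (use le in auto)
  have "expectation (\<lambda>\<omega>. \<xi> i \<omega> * \<xi> j \<omega>) \<le> expectation (\<lambda>\<omega>. ((\<xi> i \<omega>)\<^sup>2 + (\<xi> j \<omega>)\<^sup>2) / 2)"
    by (rule integral_mono[OF 1 *]) (rule order_trans[OF abs_ge_self le])
  also have "\<dots> \<le> \<kappa>"
    using \<xi>_sq(1)[of i] \<xi>_sq(1)[of j] \<xi>_sq(2)[of i] \<xi>_sq(2)[of j] by simp
  finally show "expectation (\<lambda>\<omega>. \<xi> i \<omega> * \<xi> j \<omega>) \<le> \<kappa>" .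
qed

lemma W_sq_cov:
  assumes "(i, k) \<in> Q" "(j, l) \<in> Q"
  shows "integrable M (\<lambda>\<omega>. ((W i k \<omega>)\<^sup>2 - 1) * ((W j l \<omega>)\<^sup>2 - 1))"
    and "expectation (\<lambda>\<omega>. ((W i k \<omega>)\<^sup>2 - 1) * ((W j l \<omega>)\<^sup>2 - 1)) = 2 * (expectation (\<lambda>\<omega>. W i k \<omega> * W j l \<omega>))\<^sup>2"
proof -
  note iss = isserlis[OF lc_W[OF assms(1)] lc_W[OF assms(2)]]
  have eq: "((W i k \<omega>)\<^sup>2 - 1) * ((W j l \<omega>)\<^sup>2 - 1) = (W i k \<omega>)\<^sup>2 * (W j l \<omega>)\<^sup>2 - (W i k \<omega>)\<^sup>2 - (W j l \<omega>)\<^sup>2 + 1" for \<omega>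
    by (simp add: algebra_simps)
  show "integrable M (\<lambda>\<omega>. ((W i k \<omega>)\<^sup>2 - 1) * ((W j l \<omega>)\<^sup>2 - 1))"
    unfolding eq using iss(1) W_integrable[OF assms(1)] W_integrable[OF assms(2)] by simp
  show "expectation (\<lambda>\<omega>. ((W i k \<omega>)\<^sup>2 - 1) * ((W j l \<omega>)\<^sup>2 - 1)) = 2 * (expectation (\<lambda>\<omega>. W i k \<omega> * W j l \<omega>))\<^sup>2"
    unfolding eq using iss W_integrable[OF assms(1)] W_integrable[OF assms(2)]
    by (simp add: W_variance[OF assms(1)] W_variance[OF assms(2)] prob_space)
qed

text \<open>Weights and covariances are nonnegative, so the diagonal terms of lag \<open>K\<close>
  alone give a lower bound: there are n - K of them, and each squared innovation has variance
  2.\<close>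

lemma V_lower: "2 * (w K)\<^sup>2 * (real n - real K) \<le> V"
proof -
  define c where "c p q = (case p of (i, k) \<Rightarrow> case q of (j, l) \<Rightarrow>
      expectation (\<lambda>\<omega>. W i k \<omega> * W j l \<omega>))" for p q
  have "(S \<omega>)\<^sup>2 = (\<Sum>p\<in>Q. \<Sum>q\<in>Q. w (snd p) * w (snd q) *
      (((W (fst p) (snd p) \<omega>)\<^sup>2 - 1) * ((W (fst q) (snd q) \<omega>)\<^sup>2 - 1)))" for \<omega>
    unfolding S_eq power2_eq_square[of "sum _ Q"] sum_product split_def
    by (intro sum.cong refl) (simp only: mult_ac)
  then have "V = (\<Sum>p\<in>Q. \<Sum>q\<in>Q. expectation (\<lambda>\<omega>. w (snd p) * w (snd q) *
      (((W (fst p) (snd p) \<omega>)\<^sup>2 - 1) * ((W (fst q) (snd q) \<omega>)\<^sup>2 - 1))))"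
    unfolding V_def using W_sq_cov(1)
    by (simp only:, intro integral_double_sum integrable_mult_right) auto
  also have "\<dots> = (\<Sum>p\<in>Q. \<Sum>q\<in>Q. w (snd p) * w (snd q) * (2 * (c p q)\<^sup>2))"
    using W_sq_cov(2) by (intro sum.cong refl) (auto simp: c_def)
  finally have V: "V = (\<Sum>p\<in>Q. \<Sum>q\<in>Q. w (snd p) * w (snd q) * (2 * (c p q)\<^sup>2))" .
  have nn: "0 \<le> w (snd p)" if "p \<in> Q" for p using that w[of "snd p"] by (auto simp: Q_def)
  have cpp: "c p p = 1" if "p \<in> Q" for p
    using that W_variance[of "fst p" "snd p"] by (auto simp: c_def power2_eq_square split: prod.splits)
  \<comment> \<open>For n < K the left side is negative, while the truncated difference is
    0.\<close>
  have "2 * (w K)\<^sup>2 * (real n - real K) \<le> 2 * (w K)\<^sup>2 * real (n - K)"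
    by (intro mult_left_mono) auto
  also have "\<dots> = (\<Sum>p\<in>{1..n-K} \<times> {K}. 2 * (w (snd p))\<^sup>2)"
  proof -
    have "(\<Sum>p\<in>{1..n-K} \<times> {K}. 2 * (w (snd p))\<^sup>2) = (\<Sum>p\<in>{1..n-K} \<times> {K}. 2 * (w K)\<^sup>2)"
      by (intro sum.cong) auto
    then show ?thesis by (simp add: card_cartesian_product)
  qed
  also have "\<dots> \<le> (\<Sum>p\<in>Q. 2 * (w (snd p))\<^sup>2)"
    using K by (intro sum_mono2 finite_Q) (auto simp: Q_def)
  also have "\<dots> \<le> V"
    unfolding V
  proof (rule sum_mono)
    fix p assume p: "p \<in> Q"
    have "2 * (w (snd p))\<^sup>2 = w (snd p) * w (snd p) * (2 * (c p p)\<^sup>2)"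
      using cpp[OF p] by (simp add: power2_eq_square)
    also have "\<dots> \<le> (\<Sum>q\<in>Q. w (snd p) * w (snd q) * (2 * (c p q)\<^sup>2))"
      using p nn finite_Q by (intro member_le_sum[of p Q "\<lambda>q. w (snd p) * w (snd q) * (2 * (c p q)\<^sup>2)"]) auto
    finally show "2 * (w (snd p))\<^sup>2 \<le> (\<Sum>q\<in>Q. w (snd p) * w (snd q) * (2 * (c p q)\<^sup>2))" .
  qed
  finally show ?thesis .
qed

text \<open>All pairs starting at \<open>i\<close> end no later than \<open>u j\<close>, so their
  innovations are orthogonal to those starting at \<open>j\<close>; by normality the centred squares
  are then uncorrelated as well.\<close>

lemma \<xi>_orthogonal:
  assumes "i \<in> {1..n-1}" "j \<in> {1..n-1}" "i + K \<le> j"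
  shows "expectation (\<lambda>\<omega>. \<xi> i \<omega> * \<xi> j \<omega>) = 0"
proof -
  have "expectation (\<lambda>\<omega>. \<xi> i \<omega> * \<xi> j \<omega>)
    = (\<Sum>k=1..min K (n - i). \<Sum>l=1..min K (n - j). expectation (\<lambda>\<omega>. w k * w l * (((W i k \<omega>)\<^sup>2 - 1) * ((W j l \<omega>)\<^sup>2 - 1))))"
  proof -
    have "\<xi> i \<omega> * \<xi> j \<omega> = (\<Sum>k=1..min K (n - i). \<Sum>l=1..min K (n - j). w k * w l * (((W i k \<omega>)\<^sup>2 - 1) * ((W j l \<omega>)\<^sup>2 - 1)))" for \<omega>
      unfolding \<xi>_def if_P[OF assms(1)] if_P[OF assms(2)] sum_product
      by (intro sum.cong refl) (simp only: mult_ac)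
    then show ?thesis
      using W_sq_cov(1)[OF in_Q[OF assms(1)] in_Q[OF assms(2)]]
      by (simp only:, intro integral_double_sum integrable_mult_right)
  qed
  also have "\<dots> = 0"
  proof (intro sum.neutral ballI)
    fix k l assume k: "k \<in> {1..min K (n - i)}" and l: "l \<in> {1..min K (n - j)}"
    note q = in_Q[OF assms(1) k] in_Q[OF assms(2) l]
    have "u (i + k) \<le> u j" using assms k by (intro u_le) auto
    then have "expectation (\<lambda>\<omega>. W j l \<omega> * W i k \<omega>) = 0"
      unfolding W_def using Q_D(5-7)[OF q(1)] Q_D(5-7)[OF q(2)] by (intro innov_orthogonal) auto
    then show "expectation (\<lambda>\<omega>. w k * w l * (((W i k \<omega>)\<^sup>2 - 1) * ((W j l \<omega>)\<^sup>2 - 1))) = 0"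
      using W_sq_cov(2)[OF q(2,1)] by (subst mult.commute[of "(W i k _)\<^sup>2 - 1"]) simp
  qed
  finally show ?thesis .
qed

text \<open>At most 2 K + 1 indices are correlated with a given one. The bound serves to show that
  \<open>S\<close> is small compared with the total weight.\<close>

lemma V_upper: "V \<le> (2 * K + 1) * \<kappa> * n"
proof -
  have "V = (\<Sum>i\<in>{1..n-1}. \<Sum>j\<in>{1..n-1}. expectation (\<lambda>\<omega>. \<xi> i \<omega> * \<xi> j \<omega>))"
    unfolding V_def S_def power2_eq_square sum_product by (intro integral_double_sum \<xi>_mult_integrable)
  also have "\<dots> \<le> (\<Sum>i\<in>{1..n-1}. (2 * K + 1) * \<kappa>)"
  proof (rule sum_mono)
    fix i assume i: "i \<in> {1..n-1}"
    have "(\<Sum>j\<in>{1..n-1}. expectation (\<lambda>\<omega>. \<xi> i \<omega> * \<xi> j \<omega>))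
        = (\<Sum>j\<in>{1..n-1} \<inter> {i-K..i+K}. expectation (\<lambda>\<omega>. \<xi> i \<omega> * \<xi> j \<omega>))"
    proof (intro sum.mono_neutral_right ballI)
      fix j assume j: "j \<in> {1..n-1} - ({1..n-1} \<inter> {i-K..i+K})"
      then have "i + K \<le> j \<or> j + K \<le> i" by auto
      then show "expectation (\<lambda>\<omega>. \<xi> i \<omega> * \<xi> j \<omega>) = 0"
        using \<xi>_orthogonal[of i j] \<xi>_orthogonal[of j i] i j by (auto simp: mult.commute)
    qed auto
    also have "\<dots> \<le> real (card ({1..n-1} \<inter> {i-K..i+K})) * \<kappa>"
      by (rule sum_bounded_above) (rule \<xi>_mult_le)
    also have "\<dots> \<le> real (2 * K + 1) * \<kappa>"
    proof (intro mult_right_mono)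
      have "card ({1..n-1} \<inter> {i-K..i+K}) \<le> card {i-K..i+K}" by (intro card_mono) auto
      also have "\<dots> \<le> 2 * K + 1" by simp
      finally show "real (card ({1..n-1} \<inter> {i-K..i+K})) \<le> real (2 * K + 1)" by (simp only: of_nat_le_iff)
    qed (use \<kappa>_ge_1 in auto)
    finally show "(\<Sum>j\<in>{1..n-1}. expectation (\<lambda>\<omega>. \<xi> i \<omega> * \<xi> j \<omega>)) \<le> (2 * K + 1) * \<kappa>" by simp
  qed
  also have "\<dots> = (2 * K + 1) * \<kappa> * real (n - 1)" by simp
  also have "\<dots> \<le> (2 * K + 1) * \<kappa> * n"
    using \<kappa>_ge_1 by (intro mult_left_mono) auto
  finally show ?thesis .
qed

lemma chf_S_bound:
  assumes "0 < V"
  shows "cmod (char (distr M borel (\<lambda>\<omega>. S \<omega> / sqrt V)) t - complex_of_real (exp (- t\<^sup>2 / 2)))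
     \<le> 3 * (4 * real K + 1)\<^sup>2 * (n * (\<kappa> / sqrt V)^3) * \<bar>t\<bar>^3"
proof -
  have sV: "0 < sqrt V" "(sqrt V)\<^sup>2 = V" using assms by auto
  let ?X = "\<lambda>i \<omega>. (1 / sqrt V) * \<xi> i \<omega>"
  have sum: "(\<Sum>i\<in>{1..n-1}. ?X i \<omega>) = S \<omega> / sqrt V" for \<omega>
    by (simp add: S_def sum_divide_distrib)
  have "cmod (char (distr M borel (\<lambda>\<omega>. \<Sum>i\<in>{1..n-1}. ?X i \<omega>)) t - complex_of_real (exp (- t\<^sup>2 / 2)))
     \<le> 3 * (4 * real K + 1)\<^sup>2 * (card {1..n-1} * (\<kappa> / sqrt V)^3) * \<bar>t\<bar>^3"
  proof (rule m_dependent_chf_bound[OF _ \<xi>_m_dependent])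
    fix i
    show "integrable M (\<lambda>\<omega>. \<bar>?X i \<omega>\<bar>^3)"
      using \<xi>_cube(1)[of i] by (simp add: power_divide)
    show "expectation (?X i) = 0" using \<xi>_mean[of i] by simp
    show "expectation (\<lambda>\<omega>. \<bar>?X i \<omega>\<bar>) \<le> \<kappa> / sqrt V"
      using \<xi>_abs[of i] sV by (simp add: divide_right_mono)
    \<comment> \<open>A single scale has to bound three moments by its powers 1, 2 and 3; \<kappa>
      \<ge> 1 makes this possible.\<close>
    have k2: "\<kappa> \<le> \<kappa>\<^sup>2" using \<kappa>_ge_1 by (simp add: self_le_power)
    have k3: "\<kappa> - 1 \<le> \<kappa>^3" using \<kappa>_ge_1 self_le_power[of \<kappa> 3] by simp
    show "expectation (\<lambda>\<omega>. (?X i \<omega>)\<^sup>2) \<le> (\<kappa> / sqrt V)\<^sup>2"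
      using \<xi>_sq[of i] k2 sV by (simp add: power_divide divide_right_mono order_trans[OF _ k2])
    show "expectation (\<lambda>\<omega>. \<bar>?X i \<omega>\<bar>^3) \<le> (\<kappa> / sqrt V)^3"
      using \<xi>_cube[of i] sV by (simp add: power_divide divide_right_mono order_trans[OF _ k3])
  next
    show "expectation (\<lambda>\<omega>. (\<Sum>i\<in>{1..n-1}. ?X i \<omega>)\<^sup>2) = 1"
      unfolding sum using assms by (simp add: power_divide V_def[symmetric])
    show "0 \<le> \<kappa> / sqrt V" using \<kappa>_ge_1 sV by simp
  qed auto
  also have "\<dots> \<le> 3 * (4 * real K + 1)\<^sup>2 * (n * (\<kappa> / sqrt V)^3) * \<bar>t\<bar>^3"
    using \<kappa>_ge_1 sV by (intro mult_right_mono mult_left_mono) auto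
  finally show ?thesis unfolding sum .
qed

end

text \<open>In terms of r = exp (- x) both sides are rational: sinh x = (1 - r^2) / (2 r) and tanh
  (x / 2) = (1 - r) / (1 + r).\<close>

lemma ou_square_identity:
  fixes x y z :: real assumes x: "0 < x"
  shows "(z - exp (- x) * y)\<^sup>2 / (1 - exp (- (2 * x)))
    = (z - y)\<^sup>2 / (2 * sinh x) + (z\<^sup>2 - y\<^sup>2) / 2 + tanh (x / 2) * (z\<^sup>2 + y\<^sup>2) / 2"
proof -
  define r where "r = exp (- x)"
  have r: "0 < r" "r < 1" using x by (auto simp: r_def)
  have e: "exp (- (2 * x)) = r\<^sup>2" by (simp add: r_def power2_eq_square flip: exp_add)
  have s: "sinh x = (1 - r\<^sup>2) / (2 * r)"
  proof -
    have "exp x = 1 / r" by (simp add: r_def exp_minus divide_inverse)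
    then show ?thesis using r by (simp add: sinh_field_def r_def[symmetric] field_simps power2_eq_square)
  qed
  have t: "tanh (x / 2) = (1 - r) / (1 + r)"
    by (simp add: tanh_real_altdef r_def)
  have f: "1 - r\<^sup>2 = (1 - r) * (1 + r)" by (simp add: power2_eq_square algebra_simps)
  have "(z - y)\<^sup>2 / (2 * sinh x) = r * (z - y)\<^sup>2 / ((1 - r) * (1 + r))"
  proof -
    have "2 * sinh x = (1 - r\<^sup>2) / r" unfolding s using r by (simp add: field_simps)
    then show ?thesis by (simp add: f mult.commute)
  qed
  moreover have "(z\<^sup>2 - y\<^sup>2) / 2 + tanh (x / 2) * (z\<^sup>2 + y\<^sup>2) / 2 = (z\<^sup>2 - r * y\<^sup>2) * (1 - r) / ((1 - r) * (1 + r))"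
    unfolding t using r by (simp add: divide_simps) (simp add: algebra_simps)
  moreover have "r * (z - y)\<^sup>2 + (z\<^sup>2 - r * y\<^sup>2) * (1 - r) = (z - r * y)\<^sup>2"
    by (simp add: power2_eq_square algebra_simps)
  ultimately show ?thesis
    unfolding e f r_def[symmetric] by (metis (no_types, opaque_lifting) add.assoc add_divide_distrib)
qed

text \<open>Exchanging the two points only flips the sign of the difference of squares. Adding both
  orders cancels it, as in \<open>pcl\<close>; in \<open>pl\<close> the marginal term completes it
  to half the sum of squares over v, which is free of \<theta>.\<close>

lemma cond_loss_eq:
  assumes "s < t" "0 < \<theta>" "0 < v"
  shows "cond_loss z t s (\<theta>, v) = ln v + ln (1 - exp (- (2 * \<theta> * (t - s))))
      + ((z t - z s)\<^sup>2 / (2 * sinh (\<theta> * (t - s))) + ((z t)\<^sup>2 - (z s)\<^sup>2) / 2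
         + tanh (\<theta> * (t - s) / 2) * ((z t)\<^sup>2 + (z s)\<^sup>2) / 2) / v"
    and "cond_loss z s t (\<theta>, v) = ln v + ln (1 - exp (- (2 * \<theta> * (t - s))))
      + ((z t - z s)\<^sup>2 / (2 * sinh (\<theta> * (t - s))) + ((z s)\<^sup>2 - (z t)\<^sup>2) / 2
         + tanh (\<theta> * (t - s) / 2) * ((z t)\<^sup>2 + (z s)\<^sup>2) / 2) / v"
proof -
  have x: "0 < \<theta> * (t - s)" using assms by simp
  have *: "(a - exp (- \<theta> * (t - s)) * b)\<^sup>2 / (v * (1 - exp (- (2 * \<theta> * (t - s)))))
    = ((a - b)\<^sup>2 / (2 * sinh (\<theta> * (t - s))) + (a\<^sup>2 - b\<^sup>2) / 2 + tanh (\<theta> * (t - s) / 2) * (a\<^sup>2 + b\<^sup>2) / 2) / v" for a b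
    using ou_square_identity[OF x, of a b] by (simp add: mult.assoc mult.commute[of v] flip: divide_divide_eq_left)
  show "cond_loss z t s (\<theta>, v) = ln v + ln (1 - exp (- (2 * \<theta> * (t - s))))
      + ((z t - z s)\<^sup>2 / (2 * sinh (\<theta> * (t - s))) + ((z t)\<^sup>2 - (z s)\<^sup>2) / 2
         + tanh (\<theta> * (t - s) / 2) * ((z t)\<^sup>2 + (z s)\<^sup>2) / 2) / v"
    using *[of "z t" "z s"] assms by (simp add: cond_loss_def abs_minus_commute[of s t])
  show "cond_loss z s t (\<theta>, v) = ln v + ln (1 - exp (- (2 * \<theta> * (t - s))))
      + ((z t - z s)\<^sup>2 / (2 * sinh (\<theta> * (t - s))) + ((z s)\<^sup>2 - (z t)\<^sup>2) / 2
         + tanh (\<theta> * (t - s) / 2) * ((z t)\<^sup>2 + (z s)\<^sup>2) / 2) / v"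
    using *[of "z s" "z t"] assms by (simp add: cond_loss_def power2_commute[of "z s" "z t"] add.commute[of "(z s)\<^sup>2"])
qed

lemma sum_off_diagonal:
  fixes G :: "nat \<Rightarrow> nat \<Rightarrow> real"
  shows "(\<Sum>i=1..n. \<Sum>j\<in>{1..n} - {i}. G i j) = (\<Sum>i=1..n-1. \<Sum>j=i+1..n. G i j + G j i)"
proof -
  let ?U = "SIGMA i:{1..n-1}. {i+1..n}" and ?L = "SIGMA i:{1..n}. {1..<i}"
  have "(\<Sum>i=1..n. \<Sum>j\<in>{1..n} - {i}. G i j) = (\<Sum>(i, j)\<in>(SIGMA i:{1..n}. {1..n} - {i}). G i j)"
    by (rule sum.Sigma) auto
  also have "(SIGMA i:{1..n}. {1..n} - {i}) = ?U \<union> ?L" by auto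
  also have "(\<Sum>(i, j)\<in>?U \<union> ?L. G i j) = (\<Sum>(i, j)\<in>?U. G i j) + (\<Sum>(i, j)\<in>?L. G i j)"
    by (rule sum.union_disjoint) auto
  also have "(\<Sum>(i, j)\<in>?L. G i j) = (\<Sum>(i, j)\<in>?U. G j i)"
    by (rule sum.reindex_bij_witness[of _ prod.swap prod.swap]) auto
  also have "(\<Sum>(i, j)\<in>?U. G i j) + (\<Sum>(i, j)\<in>?U. G j i) = (\<Sum>(i, j)\<in>?U. G i j + G j i)"
    by (simp add: sum.distrib split_def)
  also have "\<dots> = (\<Sum>i=1..n-1. \<Sum>j=i+1..n. G i j + G j i)"
    by (rule sum.Sigma[symmetric]) auto
  finally show ?thesis .
qed

section \<open>The two contrasts as functions of pair data\<close>

context ou_sample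
begin

text \<open>\<open>(i, k) \<in> Q\<close> stands for the pair \<open>s\<^sub>i, s\<^sub>i\<^sub>+\<^sub>k\<close>; \<open>Eq\<close> collects the telescoping terms of the identity.\<close>

definition wq :: "nat \<times> nat \<Rightarrow> real" where "wq = (\<lambda>(i, k). w k)"
definition dq :: "nat \<times> nat \<Rightarrow> real" where "dq = (\<lambda>(i, k). u (i + k) - u i)"
definition Dq :: "(real \<Rightarrow> real) \<Rightarrow> nat \<times> nat \<Rightarrow> real" where "Dq z = (\<lambda>(i, k). (z (u (i + k)) - z (u i))\<^sup>2)"
definition Bq :: "(real \<Rightarrow> real) \<Rightarrow> nat \<times> nat \<Rightarrow> real" where "Bq z = (\<lambda>(i, k). (z (u (i + k)))\<^sup>2 + (z (u i))\<^sup>2)"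
definition Eq :: "(real \<Rightarrow> real) \<Rightarrow> real" where
  "Eq z = (\<Sum>(i, k)\<in>Q. w k * (((z (u (i + k)))\<^sup>2 - (z (u i))\<^sup>2) / 2))"

abbreviation "AA \<equiv> pair_data.A Q wq"
abbreviation "HH z \<equiv> pair_data.H Q wq dq (Dq z)"
abbreviation "RR z \<equiv> pair_data.R Q wq dq (Dq z) (Bq z)"
abbreviation "gg z \<equiv> pair_data.g Q wq dq (Dq z) (Bq z)"

lemma sum_Q_swap: "(\<Sum>(i, k)\<in>Q. f i k) = (\<Sum>k=1..K. \<Sum>i=1..n-k. f i k)"
proof -
  have "(\<Sum>(i, k)\<in>Q. f i k) = (\<Sum>(k, i)\<in>(SIGMA k:{1..K}. {1..n-k}). f i k)"
    by (rule sum.reindex_bij_witness[of _ prod.swap prod.swap]) (auto simp: Q_def)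
  also have "\<dots> = (\<Sum>k=1..K. \<Sum>i=1..n-k. f i k)"
    by (rule sum.Sigma[symmetric]) auto
  finally show ?thesis .
qed

lemma sum_pairs_eq_Q: "(\<Sum>i=1..n-1. \<Sum>j=i+1..n. w (j - i) * F i j) = (\<Sum>(i, k)\<in>Q. w k * F i (i + k))"
proof -
  have "(\<Sum>j=i+1..n. w (j - i) * F i j) = (\<Sum>k=1..min K (n - i). w k * F i (i + k))" for i
  proof -
    have "(\<Sum>j=i+1..n. w (j - i) * F i j) = (\<Sum>k=1..n-i. w k * F i (i + k))"
      by (rule sum.reindex_bij_witness[of _ "\<lambda>k. i + k" "\<lambda>j. j - i"]) auto
    also have "\<dots> = (\<Sum>k=1..min K (n - i). w k * F i (i + k))"
      using w_gt_K by (intro sum.mono_neutral_right) auto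
    finally show ?thesis .
  qed
  then have "(\<Sum>i=1..n-1. \<Sum>j=i+1..n. w (j - i) * F i j) = (\<Sum>i=1..n-1. \<Sum>k=1..min K (n - i). w k * F i (i + k))"
    by simp
  also have "\<dots> = (\<Sum>(i, k)\<in>Q. w k * F i (i + k))"
    unfolding Q_def by (rule sum.Sigma) auto
  finally show ?thesis .
qed

lemma A_eq: "(\<Sum>p\<in>Q. wq p) = (\<Sum>k=1..K. w k * real (n - k))"
  using sum_Q_swap[of "\<lambda>i k. w k"] by (simp add: wq_def split_def mult.commute)

lemma A_bounds: "wsum * (real n - real K) \<le> (\<Sum>p\<in>Q. wq p)" "(\<Sum>p\<in>Q. wq p) \<le> wsum * n"
  unfolding A_eq wsum_def sum_distrib_right using w by (auto intro!: sum_mono mult_left_mono)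

text \<open>For n > K there is a pair of lag \<open>K\<close>, so the total weight is
  positive.\<close>

lemma pair_data_Q: assumes "K < n" shows "pair_data Q wq dq (Dq z) (Bq z)"
proof
  have "0 < wsum * (real n - real K)" using assms wsum_pos by simp
  then show "0 < (\<Sum>p\<in>Q. wq p)" using A_bounds(1) by linarith
qed (use w Q_D in \<open>auto simp: finite_Q wq_def dq_def Dq_def Bq_def\<close>)

lemma pcl_eq:
  assumes n: "K < n" and pos: "0 < \<theta>" "0 < v"
  shows "pcl w n u z (\<theta>, v) = 2 * gg z \<theta> v"
proof -
  interpret pd: pair_data Q wq dq "Dq z" "Bq z" by (rule pair_data_Q[OF n])
  have "pcl w n u z (\<theta>, v) = (\<Sum>i=1..n-1. \<Sum>j=i+1..n. w (j - i) *
      (cond_loss z (u j) (u i) (\<theta>, v) + cond_loss z (u i) (u j) (\<theta>, v)))"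
    unfolding pcl_def sum_off_diagonal
  proof (intro sum.cong refl)
    fix i j assume "j \<in> {i+1..n}"
    then have "nat \<bar>int i - int j\<bar> = j - i" "nat \<bar>int j - int i\<bar> = j - i" by auto
    then show "w (nat \<bar>int i - int j\<bar>) * cond_loss z (u j) (u i) (\<theta>, v) + w (nat \<bar>int j - int i\<bar>) * cond_loss z (u i) (u j) (\<theta>, v)
      = w (j - i) * (cond_loss z (u j) (u i) (\<theta>, v) + cond_loss z (u i) (u j) (\<theta>, v))"
      by (simp add: distrib_left)
  qed
  also have "\<dots> = (\<Sum>(i, k)\<in>Q. w k * (cond_loss z (u (i + k)) (u i) (\<theta>, v) + cond_loss z (u i) (u (i + k)) (\<theta>, v)))"
    by (rule sum_pairs_eq_Q)
  also have "\<dots> = (\<Sum>p\<in>Q. 2 * (wq p * ln v + wq p * ln (1 - exp (- (2 * \<theta> * dq p))) +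
      wq p / 2 * (Dq z p / sinh (\<theta> * dq p) + tanh (\<theta> * dq p / 2) * Bq z p) / v))"
  proof (intro sum.cong refl)
    fix p assume p: "p \<in> Q"
    obtain i k where ik: "p = (i, k)" by (cases p)
    have lt: "u i < u (i + k)" using Q_D(7) p ik by auto
    show "(case p of (i, k) \<Rightarrow> w k * (cond_loss z (u (i + k)) (u i) (\<theta>, v) + cond_loss z (u i) (u (i + k)) (\<theta>, v)))
      = 2 * (wq p * ln v + wq p * ln (1 - exp (- (2 * \<theta> * dq p))) +
        wq p / 2 * (Dq z p / sinh (\<theta> * dq p) + tanh (\<theta> * dq p / 2) * Bq z p) / v)"
      unfolding ik prod.case cond_loss_eq[OF lt pos]
      by (simp add: wq_def dq_def Dq_def Bq_def add_divide_distrib diff_divide_distrib algebra_simps)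
  qed
  also have "\<dots> = 2 * gg z \<theta> v"
    unfolding pd.g_def pd.A_def pd.L_def pd.C_def sum.distrib
    unfolding sum_distrib_left[symmetric] sum_distrib_right[symmetric] sum_divide_distrib[symmetric] sum.distrib
    by simp
  finally show ?thesis .
qed

lemma pl_eq:
  assumes n: "K < n" and pos: "0 < \<theta>" "0 < v"
  shows "pl w n u z (\<theta>, v) = gg z \<theta> v + (AA * ln v + (\<Sum>p\<in>Q. wq p * Bq z p / 2) / v)"
proof -
  interpret pd: pair_data Q wq dq "Dq z" "Bq z" by (rule pair_data_Q[OF n])
  have "pl w n u z (\<theta>, v) = (\<Sum>(i, k)\<in>Q. w k * pair_loss z (u i) (u (i + k)) (\<theta>, v))"
    unfolding pl_def by (rule sum_pairs_eq_Q)
  also have "\<dots> = (\<Sum>p\<in>Q. (wq p * ln v + wq p * ln (1 - exp (- (2 * \<theta> * dq p))) +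
      wq p / 2 * (Dq z p / sinh (\<theta> * dq p) + tanh (\<theta> * dq p / 2) * Bq z p) / v) + (wq p * ln v + wq p * Bq z p / 2 / v))"
  proof (intro sum.cong refl)
    fix p assume p: "p \<in> Q"
    obtain i k where ik: "p = (i, k)" by (cases p)
    have lt: "u i < u (i + k)" using Q_D(7) p ik by auto
    show "(case p of (i, k) \<Rightarrow> w k * pair_loss z (u i) (u (i + k)) (\<theta>, v))
      = (wq p * ln v + wq p * ln (1 - exp (- (2 * \<theta> * dq p))) +
        wq p / 2 * (Dq z p / sinh (\<theta> * dq p) + tanh (\<theta> * dq p / 2) * Bq z p) / v) + (wq p * ln v + wq p * Bq z p / 2 / v)"
      unfolding ik prod.case pair_loss_def cond_loss_eq[OF lt pos]
      by (simp add: wq_def dq_def Dq_def Bq_def add_divide_distrib diff_divide_distrib algebra_simps)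
  qed
  also have "\<dots> = gg z \<theta> v + (AA * ln v + (\<Sum>p\<in>Q. wq p * Bq z p / 2) / v)"
    unfolding pd.g_def pd.A_def pd.L_def pd.C_def sum.distrib
    unfolding sum_distrib_left[symmetric] sum_distrib_right[symmetric] sum_divide_distrib[symmetric] sum.distrib
    by simp
  finally show ?thesis .
qed

text \<open>Summing the identity at the true parameter expresses
  \<open>v\<^sub>0 * (AA + S \<omega>)\<close> exactly as \<open>C\<close> at
  \<open>\<theta>\<^sub>0\<close> plus the telescoping terms \<open>Eq\<close>. Apart from
  \<open>Eq\<close>, the only error is that of replacing \<open>\<theta>\<^sub>0 * C\<close> by
  \<open>H\<close>.\<close>

lemma H_expansion:
  assumes n: "K < n"
  shows "\<bar>HH (\<lambda>t. Z t \<omega>) - \<theta>\<^sub>0 * v\<^sub>0 * (AA + S \<omega>)\<bar> \<le> (2 * \<theta>\<^sub>0 + \<theta>\<^sub>0\<^sup>2) * (RR (\<lambda>t. Z t \<omega>) + \<bar>Eq (\<lambda>t. Z t \<omega>)\<bar>)"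
proof -
  let ?z = "\<lambda>t. Z t \<omega>"
  interpret pd: pair_data Q wq dq "Dq ?z" "Bq ?z" by (rule pair_data_Q[OF n])
  have "v\<^sub>0 * (AA + S \<omega>) = (\<Sum>(i, k)\<in>Q. w k * (v\<^sub>0 * (W i k \<omega>)\<^sup>2))"
    unfolding S_eq pd.A_def sum.distrib[symmetric] sum_distrib_left
    by (intro sum.cong refl) (auto simp: wq_def algebra_simps)
  also have "\<dots> = pd.C \<theta>\<^sub>0 + Eq ?z"
    unfolding pd.C_def Eq_def sum.distrib[symmetric] split_def
  proof (intro sum.cong refl)
    fix p assume p: "p \<in> Q"
    obtain i k where ik: "p = (i, k)" by (cases p)
    have lt: "u i < u (i + k)" using Q_D(7) p ik by auto
    have x: "0 < \<theta>\<^sub>0 * (u (i + k) - u i)" using lt \<theta>\<^sub>0 by simp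
    have "v\<^sub>0 * (W i k \<omega>)\<^sup>2 = (Z (u (i + k)) \<omega> - exp (- (\<theta>\<^sub>0 * (u (i + k) - u i))) * Z (u i) \<omega>)\<^sup>2 / (1 - exp (- (2 * (\<theta>\<^sub>0 * (u (i + k) - u i)))))"
      unfolding W_def W_sq_eq_innov[OF lt, symmetric] W_sq_def using v\<^sub>0 by (simp add: mult.assoc)
    note W2 = this[unfolded ou_square_identity[OF x]]
    show "w (snd p) * (v\<^sub>0 * (W (fst p) (snd p) \<omega>)\<^sup>2)
      = wq p / 2 * (Dq ?z p / sinh (\<theta>\<^sub>0 * dq p) + tanh (\<theta>\<^sub>0 * dq p / 2) * Bq ?z p)
      + w (snd p) * (((Z (u (fst p + snd p)) \<omega>)\<^sup>2 - (Z (u (fst p)) \<omega>)\<^sup>2) / 2)"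
      unfolding ik fst_conv snd_conv W2
      by (simp add: wq_def dq_def Dq_def Bq_def add_divide_distrib diff_divide_distrib algebra_simps)
  qed
  finally have eq: "\<theta>\<^sub>0 * v\<^sub>0 * (AA + S \<omega>) = \<theta>\<^sub>0 * pd.C \<theta>\<^sub>0 + \<theta>\<^sub>0 * Eq ?z"
    by (simp only: mult.assoc distrib_left[of \<theta>\<^sub>0, symmetric])
  have b: "\<bar>\<theta>\<^sub>0 * pd.C \<theta>\<^sub>0 - pd.H\<bar> \<le> (\<theta>\<^sub>0 + \<theta>\<^sub>0\<^sup>2) * pd.R" by (rule pd.mult_C_bounds[OF \<theta>\<^sub>0])
  have "\<bar>pd.H - \<theta>\<^sub>0 * v\<^sub>0 * (AA + S \<omega>)\<bar> \<le> (\<theta>\<^sub>0 + \<theta>\<^sub>0\<^sup>2) * pd.R + \<theta>\<^sub>0 * \<bar>Eq ?z\<bar>"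
  proof -
    have "\<theta>\<^sub>0 * \<bar>Eq ?z\<bar> = \<bar>\<theta>\<^sub>0 * Eq ?z\<bar>" using \<theta>\<^sub>0 by (simp add: abs_mult)
    then show ?thesis using b eq by linarith
  qed
  \<comment> \<open>A common constant for both terms, so that later only the sum of
    \<open>RR\<close> and the modulus of \<open>Eq\<close> has to be controlled.\<close>
  also have "\<dots> \<le> (2 * \<theta>\<^sub>0 + \<theta>\<^sub>0\<^sup>2) * pd.R + (2 * \<theta>\<^sub>0 + \<theta>\<^sub>0\<^sup>2) * \<bar>Eq ?z\<bar>"
    using \<theta>\<^sub>0 pd.R_nonneg by (intro add_mono mult_right_mono) auto
  finally show ?thesis by (simp add: distrib_left)
qed

text \<open>For each lag \<open>k\<close> the distances telescope to at most \<open>k\<close>, as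
  all points lie in the unit interval.\<close>

lemma sum_dq_le: "(\<Sum>p\<in>Q. wq p * dq p) \<le> real K * wsum"
proof -
  have "(\<Sum>p\<in>Q. wq p * dq p) = (\<Sum>k=1..K. w k * (\<Sum>i=1..n-k. u (i + k) - u i))"
    using sum_Q_swap[of "\<lambda>i k. w k * (u (i + k) - u i)"]
    by (simp add: wq_def dq_def split_def sum_distrib_left)
  also have "\<dots> \<le> (\<Sum>k=1..K. w k * real K)"
  proof (intro sum_mono mult_left_mono w)
    fix k assume k: "k \<in> {1..K}"
    show "(\<Sum>i=1..n-k. u (i + k) - u i) \<le> real K"
    proof (cases "k \<le> n")
      case True
      have "(\<Sum>i\<in>{n-k<..n}. u i) \<le> real (card {n-k<..n}) * 1"
        using u by (intro sum_bounded_above) auto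
      moreover have "0 \<le> (\<Sum>i=1..k. u i)" using u True by (intro sum_nonneg) auto
      ultimately show ?thesis using lag_sum_telescope[OF True, of u] True k by simp
    qed simp
  qed auto
  also have "\<dots> = real K * wsum" by (simp add: wsum_def sum_distrib_left mult.commute)
  finally show ?thesis .
qed

lemma expectation_Z_sq: "s \<in> {0..1} \<Longrightarrow> expectation (\<lambda>\<omega>. (Z s \<omega>)\<^sup>2) = v\<^sub>0"
  using expectation_Z_Z[of s s] by (simp add: power2_eq_square)

lemma Z_sq_integrable: "s \<in> {0..1} \<Longrightarrow> integrable M (\<lambda>\<omega>. (Z s \<omega>)\<^sup>2)"
  by (intro lc_integrable_power lin_comb_base)

text \<open>At the true parameters a squared increment over distance \<Delta> has mean 2 v (1 - exp
  (- \<theta> \<Delta>)) \<le> 2 v \<theta> \<Delta>. Every term of \<open>R\<close> thus has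
  expectation of order \<Delta>, and the weighted distances have a bounded sum.\<close>

lemma R_expectation:
  assumes n: "K < n"
  shows "integrable M (\<lambda>\<omega>. RR (\<lambda>t. Z t \<omega>))"
    and "expectation (\<lambda>\<omega>. RR (\<lambda>t. Z t \<omega>)) \<le> (1 + 2 * v\<^sub>0 + 2 * \<theta>\<^sub>0 * v\<^sub>0) * (real K * wsum)"
proof -
  have R: "RR (\<lambda>t. Z t \<omega>) = (\<Sum>p\<in>Q. wq p * (dq p + dq p * Bq (\<lambda>t. Z t \<omega>) p + Dq (\<lambda>t. Z t \<omega>) p))" for \<omega>
    using pair_data.R_def[OF pair_data_Q[OF n]] by blast
  have i: "integrable M (\<lambda>\<omega>. wq p * (dq p + dq p * Bq (\<lambda>t. Z t \<omega>) p + Dq (\<lambda>t. Z t \<omega>) p))"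
    and e: "expectation (\<lambda>\<omega>. wq p * (dq p + dq p * Bq (\<lambda>t. Z t \<omega>) p + Dq (\<lambda>t. Z t \<omega>) p))
      \<le> (1 + 2 * v\<^sub>0 + 2 * \<theta>\<^sub>0 * v\<^sub>0) * (wq p * dq p)" if p: "p \<in> Q" for p
  proof -
    obtain i k where ik: "p = (i, k)" by (cases p)
    note q = Q_D[OF p[unfolded ik]]
    note Zi = Z_sq_integrable[OF q(5)] Z_sq_integrable[OF q(6)]
    have B: "integrable M (\<lambda>\<omega>. Bq (\<lambda>t. Z t \<omega>) p)" "expectation (\<lambda>\<omega>. Bq (\<lambda>t. Z t \<omega>) p) = 2 * v\<^sub>0"
      unfolding Bq_def ik using Zi q by (auto simp: expectation_Z_sq)
    have iZZ: "integrable M (\<lambda>\<omega>. Z (u (i + k)) \<omega> * Z (u i) \<omega>)"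
      by (intro lc_integrable_mult lin_comb_base q)
    have D: "integrable M (\<lambda>\<omega>. Dq (\<lambda>t. Z t \<omega>) p)"
      unfolding Dq_def ik prod.case power2_diff using Zi iZZ by (simp add: mult.assoc)
    have "expectation (\<lambda>\<omega>. Dq (\<lambda>t. Z t \<omega>) p) = 2 * v\<^sub>0 * (1 - exp (- (\<theta>\<^sub>0 * dq p)))"
      unfolding Dq_def ik prod.case power2_diff using Zi iZZ q
      by (simp add: mult.assoc expectation_Z_sq expectation_Z_Z dq_def algebra_simps)
    also have "\<dots> \<le> 2 * v\<^sub>0 * (\<theta>\<^sub>0 * dq p)"
      using one_minus_exp_le[of "\<theta>\<^sub>0 * dq p"] v\<^sub>0 by (intro mult_left_mono) auto
    finally have eD: "expectation (\<lambda>\<omega>. Dq (\<lambda>t. Z t \<omega>) p) \<le> 2 * v\<^sub>0 * (\<theta>\<^sub>0 * dq p)" .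
    show "integrable M (\<lambda>\<omega>. wq p * (dq p + dq p * Bq (\<lambda>t. Z t \<omega>) p + Dq (\<lambda>t. Z t \<omega>) p))"
      using B D by simp
    have "expectation (\<lambda>\<omega>. wq p * (dq p + dq p * Bq (\<lambda>t. Z t \<omega>) p + Dq (\<lambda>t. Z t \<omega>) p))
      = wq p * (dq p + dq p * (2 * v\<^sub>0) + expectation (\<lambda>\<omega>. Dq (\<lambda>t. Z t \<omega>) p))"
      using B D by (simp add: prob_space)
    also have "\<dots> \<le> wq p * (dq p + dq p * (2 * v\<^sub>0) + 2 * v\<^sub>0 * (\<theta>\<^sub>0 * dq p))"
      using eD w[OF q(2)] by (intro mult_left_mono add_left_mono) (auto simp: wq_def ik)
    finally show "expectation (\<lambda>\<omega>. wq p * (dq p + dq p * Bq (\<lambda>t. Z t \<omega>) p + Dq (\<lambda>t. Z t \<omega>) p))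
      \<le> (1 + 2 * v\<^sub>0 + 2 * \<theta>\<^sub>0 * v\<^sub>0) * (wq p * dq p)" by (simp add: algebra_simps)
  qed
  show "integrable M (\<lambda>\<omega>. RR (\<lambda>t. Z t \<omega>))" unfolding R using i by (rule Bochner_Integration.integrable_sum)
  have "expectation (\<lambda>\<omega>. RR (\<lambda>t. Z t \<omega>)) = (\<Sum>p\<in>Q. expectation (\<lambda>\<omega>. wq p * (dq p + dq p * Bq (\<lambda>t. Z t \<omega>) p + Dq (\<lambda>t. Z t \<omega>) p)))"
    unfolding R using i by (rule Bochner_Integration.integral_sum)
  also have "\<dots> \<le> (\<Sum>p\<in>Q. (1 + 2 * v\<^sub>0 + 2 * \<theta>\<^sub>0 * v\<^sub>0) * (wq p * dq p))" by (rule sum_mono) (rule e)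
  also have "\<dots> \<le> (1 + 2 * v\<^sub>0 + 2 * \<theta>\<^sub>0 * v\<^sub>0) * (real K * wsum)"
    unfolding sum_distrib_left[symmetric] using sum_dq_le \<theta>\<^sub>0 v\<^sub>0 by (intro mult_left_mono) auto
  finally show "expectation (\<lambda>\<omega>. RR (\<lambda>t. Z t \<omega>)) \<le> (1 + 2 * v\<^sub>0 + 2 * \<theta>\<^sub>0 * v\<^sub>0) * (real K * wsum)" .
qed

text \<open>For each lag \<open>k\<close> the sum reduces to \<open>k\<close> squared values at
  either end, each of mean \<open>v\<^sub>0\<close>; the factor 1 / 2 compensates for the two
  ends.\<close>

lemma Eq_expectation:
  assumes n: "K < n"
  shows "integrable M (\<lambda>\<omega>. \<bar>Eq (\<lambda>t. Z t \<omega>)\<bar>)" and "expectation (\<lambda>\<omega>. \<bar>Eq (\<lambda>t. Z t \<omega>)\<bar>) \<le> v\<^sub>0 * (real K * wsum)"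
proof -
  define b where "b \<omega> = (\<Sum>k=1..K. w k / 2 * ((\<Sum>i\<in>{n-k<..n}. (Z (u i) \<omega>)\<^sup>2) + (\<Sum>i=1..k. (Z (u i) \<omega>)\<^sup>2)))" for \<omega>
  have Eq: "Eq (\<lambda>t. Z t \<omega>) = (\<Sum>k=1..K. w k / 2 * ((\<Sum>i\<in>{n-k<..n}. (Z (u i) \<omega>)\<^sup>2) - (\<Sum>i=1..k. (Z (u i) \<omega>)\<^sup>2)))" for \<omega>
  proof -
    have "Eq (\<lambda>t. Z t \<omega>) = (\<Sum>k=1..K. w k / 2 * (\<Sum>i=1..n-k. (Z (u (i + k)) \<omega>)\<^sup>2 - (Z (u i) \<omega>)\<^sup>2))"
      unfolding Eq_def sum_Q_swap by (simp add: sum_distrib_left)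
    also have "\<dots> = (\<Sum>k=1..K. w k / 2 * ((\<Sum>i\<in>{n-k<..n}. (Z (u i) \<omega>)\<^sup>2) - (\<Sum>i=1..k. (Z (u i) \<omega>)\<^sup>2)))"
      using n by (intro sum.cong refl arg_cong2[where f="(*)"] lag_sum_telescope) auto
    finally show ?thesis .
  qed
  have le: "\<bar>Eq (\<lambda>t. Z t \<omega>)\<bar> \<le> b \<omega>" for \<omega>
    unfolding Eq b_def
  proof (rule order_trans[OF sum_abs], rule sum_mono)
    fix k assume k: "k \<in> {1..K}"
    have *: "\<bar>x - y\<bar> \<le> x + y" if "0 \<le> x" "0 \<le> y" for x y :: real using that by linarith
    have "\<bar>(\<Sum>i\<in>{n-k<..n}. (Z (u i) \<omega>)\<^sup>2) - (\<Sum>i=1..k. (Z (u i) \<omega>)\<^sup>2)\<bar>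
      \<le> (\<Sum>i\<in>{n-k<..n}. (Z (u i) \<omega>)\<^sup>2) + (\<Sum>i=1..k. (Z (u i) \<omega>)\<^sup>2)"
      by (rule *) (simp_all add: sum_nonneg)
    then show "\<bar>w k / 2 * ((\<Sum>i\<in>{n-k<..n}. (Z (u i) \<omega>)\<^sup>2) - (\<Sum>i=1..k. (Z (u i) \<omega>)\<^sup>2))\<bar>
      \<le> w k / 2 * ((\<Sum>i\<in>{n-k<..n}. (Z (u i) \<omega>)\<^sup>2) + (\<Sum>i=1..k. (Z (u i) \<omega>)\<^sup>2))"
      using w[of k] k by (simp add: abs_mult mult_left_mono)
  qed
  have iS: "integrable M (\<lambda>\<omega>. \<Sum>i\<in>I. (Z (u i) \<omega>)\<^sup>2)" and eS: "expectation (\<lambda>\<omega>. \<Sum>i\<in>I. (Z (u i) \<omega>)\<^sup>2) = real (card I) * v\<^sub>0"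
    if "I \<subseteq> {1..n}" for I
  proof -
    have ui: "u i \<in> {0..1}" if "i \<in> I" for i using u that \<open>I \<subseteq> {1..n}\<close> by blast
    show "integrable M (\<lambda>\<omega>. \<Sum>i\<in>I. (Z (u i) \<omega>)\<^sup>2)"
      by (intro Bochner_Integration.integrable_sum Z_sq_integrable ui)
    have "expectation (\<lambda>\<omega>. \<Sum>i\<in>I. (Z (u i) \<omega>)\<^sup>2) = (\<Sum>i\<in>I. expectation (\<lambda>\<omega>. (Z (u i) \<omega>)\<^sup>2))"
      by (intro Bochner_Integration.integral_sum Z_sq_integrable ui)
    then show "expectation (\<lambda>\<omega>. \<Sum>i\<in>I. (Z (u i) \<omega>)\<^sup>2) = real (card I) * v\<^sub>0"
      using ui by (simp add: expectation_Z_sq)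
  qed
  have ik: "integrable M (\<lambda>\<omega>. w k / 2 * ((\<Sum>i\<in>{n-k<..n}. (Z (u i) \<omega>)\<^sup>2) + (\<Sum>i=1..k. (Z (u i) \<omega>)\<^sup>2)))"
    and ek: "expectation (\<lambda>\<omega>. w k / 2 * ((\<Sum>i\<in>{n-k<..n}. (Z (u i) \<omega>)\<^sup>2) + (\<Sum>i=1..k. (Z (u i) \<omega>)\<^sup>2))) = w k * (real k * v\<^sub>0)"
    if "k \<in> {1..K}" for k
  proof -
    have I: "{n-k<..n} \<subseteq> {1..n}" "{1..k} \<subseteq> {1..n}" using that n by auto
    show "integrable M (\<lambda>\<omega>. w k / 2 * ((\<Sum>i\<in>{n-k<..n}. (Z (u i) \<omega>)\<^sup>2) + (\<Sum>i=1..k. (Z (u i) \<omega>)\<^sup>2)))"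
      by (intro integrable_mult_right Bochner_Integration.integrable_add iS I)
    show "expectation (\<lambda>\<omega>. w k / 2 * ((\<Sum>i\<in>{n-k<..n}. (Z (u i) \<omega>)\<^sup>2) + (\<Sum>i=1..k. (Z (u i) \<omega>)\<^sup>2))) = w k * (real k * v\<^sub>0)"
      using iS[OF I(1)] iS[OF I(2)] eS[OF I(1)] eS[OF I(2)] that n by simp
  qed
  have ib: "integrable M b" unfolding b_def using ik by (rule Bochner_Integration.integrable_sum)
  have "expectation b = (\<Sum>k=1..K. w k * (real k * v\<^sub>0))"
  proof -
    have "expectation b = (\<Sum>k=1..K. expectation (\<lambda>\<omega>. w k / 2 * ((\<Sum>i\<in>{n-k<..n}. (Z (u i) \<omega>)\<^sup>2) + (\<Sum>i=1..k. (Z (u i) \<omega>)\<^sup>2))))"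
      unfolding b_def using ik by (rule Bochner_Integration.integral_sum)
    also have "\<dots> = (\<Sum>k=1..K. w k * (real k * v\<^sub>0))" by (intro sum.cong refl ek)
    finally show ?thesis .
  qed
  also have "\<dots> \<le> (\<Sum>k=1..K. w k * (real K * v\<^sub>0))"
    using w v\<^sub>0 by (intro sum_mono mult_left_mono mult_right_mono) auto
  also have "\<dots> = v\<^sub>0 * (real K * wsum)" by (simp add: wsum_def sum_distrib_left mult_ac)
  finally have eb: "expectation b \<le> v\<^sub>0 * (real K * wsum)" .
  have m: "(\<lambda>\<omega>. Eq (\<lambda>t. Z t \<omega>)) \<in> borel_measurable M"
  proof -
    have "(\<lambda>\<omega>. w k * (((Z (u (i + k)) \<omega>)\<^sup>2 - (Z (u i) \<omega>)\<^sup>2) / 2)) \<in> borel_measurable M" if "(i, k) \<in> Q" for i k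
      using Z_sq_integrable[OF Q_D(5)[OF that]] Z_sq_integrable[OF Q_D(6)[OF that]] by measurable
    then show ?thesis unfolding Eq_def by (intro borel_measurable_sum) auto
  qed
  show i: "integrable M (\<lambda>\<omega>. \<bar>Eq (\<lambda>t. Z t \<omega>)\<bar>)"
    by (rule Bochner_Integration.integrable_bound[OF ib]) (use m le in \<open>auto intro: order_trans[OF _ abs_ge_self]\<close>)
  show "expectation (\<lambda>\<omega>. \<bar>Eq (\<lambda>t. Z t \<omega>)\<bar>) \<le> v\<^sub>0 * (real K * wsum)"
    by (rule order_trans[OF integral_mono[OF i ib le] eb])
qed

end

section \<open>Asymptotic normality of the estimators\<close>

lemma is_arg_min_double:
  fixes F G :: "'b \<Rightarrow> real"
  assumes "\<And>\<psi>. P \<psi> \<Longrightarrow> F \<psi> = 2 * G \<psi>"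
  shows "is_arg_min F P \<psi> \<longleftrightarrow> is_arg_min G P \<psi>"
  unfolding is_arg_min_def using assms by auto

text \<open>On \<open>E\<close> the Lipschitz bound for \<open>iexp\<close> applies, off
  \<open>E\<close> the trivial bound 2. The size of \<open>Y\<close> off \<open>E\<close> does not
  enter, which suits an estimator with arbitrary values there.\<close>

lemma (in prob_space) char_diff_le:
  assumes X[measurable]: "random_variable borel X" and Y[measurable]: "random_variable borel Y"
    and E[measurable]: "E \<in> events" and b: "0 \<le> b" and le: "AE \<omega> in M. \<omega> \<in> E \<longrightarrow> \<bar>Y \<omega> - X \<omega>\<bar> \<le> b"
  shows "cmod (char (distr M borel Y) t - char (distr M borel X) t) \<le> \<bar>t\<bar> * b + 2 * prob (space M - E)"
proof -
  have i: "integrable M (\<lambda>\<omega>. iexp (t * X \<omega>))" "integrable M (\<lambda>\<omega>. iexp (t * Y \<omega>))"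
    by (rule integrable_const_bound[where B=1]; auto)+
  have i2: "integrable M (\<lambda>\<omega>. \<bar>t\<bar> * b + 2 * indicator (space M - E) \<omega>)"
    by (intro Bochner_Integration.integrable_add integrable_const integrable_mult_right integrable_real_indicator)
       (auto simp: less_top[symmetric])
  have "char (distr M borel Y) t - char (distr M borel X) t = (CLINT \<omega>|M. iexp (t * Y \<omega>) - iexp (t * X \<omega>))"
    unfolding char_def using i by (simp add: integral_distr)
  also have "cmod \<dots> \<le> (\<integral>\<omega>. cmod (iexp (t * Y \<omega>) - iexp (t * X \<omega>)) \<partial>M)" by (rule integral_norm_bound)
  also have "\<dots> \<le> (\<integral>\<omega>. \<bar>t\<bar> * b + 2 * indicator (space M - E) \<omega> \<partial>M)"
  proof (rule integral_mono_AE[OF _ i2])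
    show "integrable M (\<lambda>\<omega>. cmod (iexp (t * Y \<omega>) - iexp (t * X \<omega>)))" using i by auto
    show "AE \<omega> in M. cmod (iexp (t * Y \<omega>) - iexp (t * X \<omega>)) \<le> \<bar>t\<bar> * b + 2 * indicator (space M - E) \<omega>"
      using le AE_space
    proof eventually_elim
      fix \<omega> assume w: "\<omega> \<in> E \<longrightarrow> \<bar>Y \<omega> - X \<omega>\<bar> \<le> b" "\<omega> \<in> space M"
      show "cmod (iexp (t * Y \<omega>) - iexp (t * X \<omega>)) \<le> \<bar>t\<bar> * b + 2 * indicator (space M - E) \<omega>"
      proof (cases "\<omega> \<in> E")
        case True
        have "cmod (iexp (t * Y \<omega>) - iexp (t * X \<omega>)) \<le> \<bar>t * Y \<omega> - t * X \<omega>\<bar>" by (rule cmod_iexp_diff_le)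
        also have "\<dots> = \<bar>t\<bar> * \<bar>Y \<omega> - X \<omega>\<bar>" by (simp flip: abs_mult right_diff_distrib)
        also have "\<dots> \<le> \<bar>t\<bar> * b" using w True by (intro mult_left_mono) auto
        finally show ?thesis using True by simp
      next
        case False
        have "cmod (iexp (t * Y \<omega>) - iexp (t * X \<omega>)) \<le> cmod (iexp (t * Y \<omega>)) + cmod (iexp (t * X \<omega>))"
          by (rule norm_triangle_ineq4)
        also have "\<dots> = 2" by (simp only: norm_exp_i_times)
        also have "\<dots> \<le> \<bar>t\<bar> * b + 2" using b by simp
        finally show ?thesis using False w by simp
      qed
    qed
  qed
  also have "\<dots> = \<bar>t\<bar> * b + 2 * prob (space M - E)"
    by (subst Bochner_Integration.integral_add)
       (auto simp: prob_space less_top[symmetric] intro!: integrable_mult_right integrable_real_indicator)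
  finally show ?thesis .
qed

section \<open>Characteristic function of the normalized estimator\<close>

context ou_sample
begin

text \<open>Outside an event of probability at most e / \<delta> + 1 / \<delta>^2 the remainder is
  at most \<open>\<delta>\<close> and \<open>S\<close> at most \<open>\<delta>\<close> standard
  deviations. There \<open>near\<close> locates the estimator, and its normalized error differs from
  \<open>S / sqrt V\<close> by an explicit amount. \<open>e\<close> adds the bounds on the means of
  \<open>RR\<close> and of the modulus of \<open>Eq\<close>; the conditions on \<open>\<eta>\<close>
  put these outcomes within the reach of \<open>near\<close>.\<close>

lemma chf_estimator_bound:
  fixes F :: "'a \<Rightarrow> real \<times> real \<Rightarrow> real" and K0 \<eta> \<delta> :: real
  defines "c \<equiv> 2 * \<theta>\<^sub>0 + \<theta>\<^sub>0\<^sup>2" and "e \<equiv> (1 + 3 * v\<^sub>0 + 2 * \<theta>\<^sub>0 * v\<^sub>0) * (real K * wsum)"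
  assumes n: "2 * K \<le> n"
    and near: "\<And>\<omega>. \<bar>HH (\<lambda>t. Z t \<omega>) / AA - \<theta>\<^sub>0 * v\<^sub>0\<bar> \<le> \<eta> \<Longrightarrow> RR (\<lambda>t. Z t \<omega>) / AA \<le> \<eta> \<Longrightarrow>
      (\<exists>\<psi>. is_arg_min (F \<omega>) (\<lambda>\<psi>. \<psi> \<in> J) \<psi>) \<and>
      (\<forall>\<theta> v. is_arg_min (F \<omega>) (\<lambda>\<psi>. \<psi> \<in> J) (\<theta>, v) \<longrightarrow>
        \<bar>\<theta> * v - HH (\<lambda>t. Z t \<omega>) / AA\<bar> \<le> K0 * (RR (\<lambda>t. Z t \<omega>) / AA))"
    and est: "argmin_estimator M J F \<psi>h"
    and \<delta>: "0 < \<delta>" and K0: "0 \<le> K0"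
    and \<eta>1: "(\<theta>\<^sub>0 * v\<^sub>0 * sqrt ((2 * K + 1) * \<kappa> * n) + c) * \<delta> * 2 / (wsum * n) \<le> \<eta>"
    and \<eta>2: "\<delta> * 2 / (wsum * n) \<le> \<eta>"
  shows "cmod (char (distr M borel (\<lambda>\<omega>. sqrt (real n) * wsum / (tau M \<theta>\<^sub>0 v\<^sub>0 Z w K n u * v\<^sub>0 * \<theta>\<^sub>0) *
          (snd (\<psi>h \<omega>) * fst (\<psi>h \<omega>) - v\<^sub>0 * \<theta>\<^sub>0))) t - complex_of_real (exp (- t\<^sup>2 / 2)))
    \<le> \<bar>t\<bar> * (2 * K / n * \<delta> + 2 * (K0 + c) * \<delta> / (w K * sqrt n * v\<^sub>0 * \<theta>\<^sub>0)) + 2 * (e / \<delta> + 1 / \<delta>\<^sup>2)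
      + 3 * (4 * real K + 1)\<^sup>2 * (\<kappa>^3 / (w K ^ 3 * sqrt n)) * \<bar>t\<bar>^3"
proof -
  have Kn: "K < n" and n0: "0 < real n" using n K by auto
  have c0: "0 \<le> c" using \<theta>\<^sub>0 by (simp add: c_def)
  interpret pd: pair_data Q wq dq "Dq z" "Bq z" for z by (rule pair_data_Q[OF Kn])
  let ?z = "\<lambda>\<omega> t. Z t \<omega>"
  have A0: "0 < AA" using pd.A_pos .
  have A: "wsum * n / 2 \<le> AA" "wsum * (real n - real K) \<le> AA" "AA \<le> wsum * n"
  proof -
    show 1: "wsum * (real n - real K) \<le> AA" "AA \<le> wsum * n" using A_bounds by (simp_all add: pd.A_def)
    have "wsum * (n / 2) \<le> wsum * (real n - real K)" using n wsum_pos by (intro mult_left_mono) auto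
    with 1 show "wsum * n / 2 \<le> AA" by simp
  qed
  \<comment> \<open>The assumption on \<open>n\<close> makes \<open>n - K\<close> at least half of
    \<open>n\<close>, here as in the lower bound for \<open>AA\<close>.\<close>
  have Vl: "(w K)\<^sup>2 * n \<le> V"
  proof -
    have "(w K)\<^sup>2 * n \<le> (w K)\<^sup>2 * (2 * (real n - real K))" using n by (intro mult_left_mono) auto
    also have "\<dots> = 2 * (w K)\<^sup>2 * (real n - real K)" by (simp only: mult_ac)
    also have "\<dots> \<le> V" by (rule V_lower)
    finally show ?thesis .
  qed
  then have V0: "0 < V" using wK n0 by (smt (verit) mult_pos_pos zero_less_power)
  have sV: "w K * sqrt n \<le> sqrt V"
    using real_sqrt_le_mono[OF Vl] wK by (simp add: real_sqrt_mult)
  have sV0: "0 < sqrt V" "0 < w K * sqrt n" using V0 wK n0 by auto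
  define T where "T \<omega> = RR (?z \<omega>) + \<bar>Eq (?z \<omega>)\<bar>" for \<omega>
  have T: "integrable M T" "expectation T \<le> e"
    unfolding T_def[abs_def] using R_expectation[OF Kn] Eq_expectation[OF Kn]
    by (auto simp: e_def algebra_simps)
  have T0: "0 \<le> T \<omega>" for \<omega> using pd.R_nonneg by (simp add: T_def)
  have [measurable]: "T \<in> borel_measurable M" using T(1) by auto
  define E where "E = {\<omega> \<in> space M. T \<omega> \<le> \<delta> \<and> \<bar>S \<omega>\<bar> \<le> \<delta> * sqrt V}"
  have E[measurable]: "E \<in> events" unfolding E_def by measurable
  have iS: "integrable M (\<lambda>\<omega>. (S \<omega>)\<^sup>2)"
    unfolding S_def power2_eq_square sum_product by (intro integrable_double_sum \<xi>_mult_integrable)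
  \<comment> \<open>Markov's inequality for \<open>T\<close> and Chebyshev's for \<open>S\<close>,
    whose variance is \<open>V\<close>.\<close>
  have PE: "prob (space M - E) \<le> e / \<delta> + 1 / \<delta>\<^sup>2"
  proof -
    have "space M - E \<subseteq> {\<omega> \<in> space M. \<delta> \<le> T \<omega>} \<union> {\<omega> \<in> space M. \<delta>\<^sup>2 * V \<le> (S \<omega>)\<^sup>2}"
    proof
      fix \<omega> assume w: "\<omega> \<in> space M - E"
      have "\<delta>\<^sup>2 * V \<le> (S \<omega>)\<^sup>2" if "\<not> \<bar>S \<omega>\<bar> \<le> \<delta> * sqrt V"
      proof -
        have "(\<delta> * sqrt V)\<^sup>2 \<le> \<bar>S \<omega>\<bar>\<^sup>2" using that \<delta> sV0 by (intro power_mono) auto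
        then show ?thesis using V0 by (simp add: power_mult_distrib)
      qed
      then show "\<omega> \<in> {\<omega> \<in> space M. \<delta> \<le> T \<omega>} \<union> {\<omega> \<in> space M. \<delta>\<^sup>2 * V \<le> (S \<omega>)\<^sup>2}"
        using w by (auto simp: E_def)
    qed
    then have "prob (space M - E) \<le> prob ({\<omega> \<in> space M. \<delta> \<le> T \<omega>} \<union> {\<omega> \<in> space M. \<delta>\<^sup>2 * V \<le> (S \<omega>)\<^sup>2})"
      by (rule finite_measure_mono) measurable
    also have "\<dots> \<le> prob {\<omega> \<in> space M. \<delta> \<le> T \<omega>} + prob {\<omega> \<in> space M. \<delta>\<^sup>2 * V \<le> (S \<omega>)\<^sup>2}"
      by (rule measure_Un_le) measurable
    also have "prob {\<omega> \<in> space M. \<delta> \<le> T \<omega>} \<le> expectation T / \<delta>"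
      by (rule integral_Markov_inequality_measure[where A="{}"]) (use T T0 \<delta> in auto)
    also have "\<dots> \<le> e / \<delta>" using T \<delta> by (intro divide_right_mono) auto
    also have "prob {\<omega> \<in> space M. \<delta>\<^sup>2 * V \<le> (S \<omega>)\<^sup>2} \<le> expectation (\<lambda>\<omega>. (S \<omega>)\<^sup>2) / (\<delta>\<^sup>2 * V)"
      by (rule integral_Markov_inequality_measure[where A="{}"]) (use iS V0 \<delta> in auto)
    also have "\<dots> = 1 / \<delta>\<^sup>2" using V0 by (simp add: V_def)
    finally show ?thesis by simp
  qed
  let ?Y = "\<lambda>\<omega>. sqrt (real n) * wsum / (tau M \<theta>\<^sub>0 v\<^sub>0 Z w K n u * v\<^sub>0 * \<theta>\<^sub>0) *
          (snd (\<psi>h \<omega>) * fst (\<psi>h \<omega>) - v\<^sub>0 * \<theta>\<^sub>0)"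
  let ?b = "2 * K / n * \<delta> + 2 * (K0 + c) * \<delta> / (w K * sqrt n * v\<^sub>0 * \<theta>\<^sub>0)"
  have b0: "0 \<le> ?b" using c0 K0 \<delta> wK \<theta>\<^sub>0 v\<^sub>0 by simp
  \<comment> \<open>\<open>am\<close> is the defining property of the estimator, which holds almost
    surely; the existence of a minimizer that it presupposes comes from \<open>near\<close>.\<close>
  have key: "\<bar>?Y \<omega> - S \<omega> / sqrt V\<bar> \<le> ?b"
    if w: "\<omega> \<in> E" and am: "(\<exists>\<psi>. is_arg_min (F \<omega>) (\<lambda>\<psi>. \<psi> \<in> J) \<psi>) \<longrightarrow> is_arg_min (F \<omega>) (\<lambda>\<psi>. \<psi> \<in> J) (\<psi>h \<omega>)" for \<omega>
  proof -
    define h where "h = HH (?z \<omega>) / AA"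
    define m where "m = fst (\<psi>h \<omega>) * snd (\<psi>h \<omega>)"
    have T\<delta>: "T \<omega> \<le> \<delta>" and S\<delta>: "\<bar>S \<omega>\<bar> \<le> \<delta> * sqrt V" using w by (auto simp: E_def)
    have R\<delta>: "RR (?z \<omega>) \<le> \<delta>" using T\<delta> by (simp add: T_def)
    have A2: "x / AA \<le> x * 2 / (wsum * n)" if "0 \<le> x" for x
    proof -
      have "x / AA \<le> x / (wsum * n / 2)" using A(1) A0 that n0 wsum_pos by (intro divide_left_mono) auto
      then show ?thesis by simp
    qed
    have h1: "\<bar>h - \<theta>\<^sub>0 * v\<^sub>0 - \<theta>\<^sub>0 * v\<^sub>0 * S \<omega> / AA\<bar> \<le> c * \<delta> / AA"
    proof -
      have eq: "h - \<theta>\<^sub>0 * v\<^sub>0 - \<theta>\<^sub>0 * v\<^sub>0 * S \<omega> / AA = (HH (?z \<omega>) - \<theta>\<^sub>0 * v\<^sub>0 * (AA + S \<omega>)) / AA"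
        using A0 by (simp add: h_def diff_divide_distrib add_divide_distrib distrib_left)
      have "\<bar>h - \<theta>\<^sub>0 * v\<^sub>0 - \<theta>\<^sub>0 * v\<^sub>0 * S \<omega> / AA\<bar> = \<bar>HH (?z \<omega>) - \<theta>\<^sub>0 * v\<^sub>0 * (AA + S \<omega>)\<bar> / AA"
        unfolding eq by (simp only: abs_divide abs_of_pos[OF A0])
      also have "\<dots> \<le> c * T \<omega> / AA"
        unfolding c_def T_def by (rule divide_right_mono[OF H_expansion[OF Kn] less_imp_le[OF A0]])
      also have "\<dots> \<le> c * \<delta> / AA" using T\<delta> c0 A0 by (intro divide_right_mono mult_left_mono) auto
      finally show ?thesis .
    qed
    have h_near: "\<bar>h - \<theta>\<^sub>0 * v\<^sub>0\<bar> \<le> \<eta>"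
    proof -
      have "\<bar>\<theta>\<^sub>0 * v\<^sub>0 * S \<omega> / AA\<bar> = \<theta>\<^sub>0 * v\<^sub>0 * \<bar>S \<omega>\<bar> / AA" using \<theta>\<^sub>0 v\<^sub>0 A0 by (simp add: abs_mult)
      also have "\<dots> \<le> \<theta>\<^sub>0 * v\<^sub>0 * (\<delta> * sqrt V) / AA"
        using S\<delta> \<theta>\<^sub>0 v\<^sub>0 A0 by (intro divide_right_mono mult_left_mono) auto
      also have "\<dots> \<le> \<theta>\<^sub>0 * v\<^sub>0 * (\<delta> * sqrt ((2 * K + 1) * \<kappa> * n)) / AA"
        using V_upper \<theta>\<^sub>0 v\<^sub>0 A0 \<delta> by (intro divide_right_mono mult_left_mono) auto
      finally have S_le: "\<bar>\<theta>\<^sub>0 * v\<^sub>0 * S \<omega> / AA\<bar> \<le> \<theta>\<^sub>0 * v\<^sub>0 * (\<delta> * sqrt ((2 * K + 1) * \<kappa> * n)) / AA" .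
      have "\<bar>h - \<theta>\<^sub>0 * v\<^sub>0\<bar> \<le> \<bar>h - \<theta>\<^sub>0 * v\<^sub>0 - \<theta>\<^sub>0 * v\<^sub>0 * S \<omega> / AA\<bar> + \<bar>\<theta>\<^sub>0 * v\<^sub>0 * S \<omega> / AA\<bar>"
        using abs_triangle_ineq[of "h - \<theta>\<^sub>0 * v\<^sub>0 - \<theta>\<^sub>0 * v\<^sub>0 * S \<omega> / AA" "\<theta>\<^sub>0 * v\<^sub>0 * S \<omega> / AA"]
        unfolding diff_add_cancel .
      also have "\<dots> \<le> c * \<delta> / AA + \<theta>\<^sub>0 * v\<^sub>0 * (\<delta> * sqrt ((2 * K + 1) * \<kappa> * n)) / AA"
        by (rule add_mono[OF h1 S_le])
      also have "\<dots> = (\<theta>\<^sub>0 * v\<^sub>0 * sqrt ((2 * K + 1) * \<kappa> * n) + c) * \<delta> / AA"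
        by (simp add: add_divide_distrib algebra_simps)
      also have "\<dots> \<le> (\<theta>\<^sub>0 * v\<^sub>0 * sqrt ((2 * K + 1) * \<kappa> * n) + c) * \<delta> * 2 / (wsum * n)"
        using \<theta>\<^sub>0 v\<^sub>0 c0 \<delta> \<kappa>_ge_1 by (intro A2) auto
      finally show ?thesis using \<eta>1 by linarith
    qed
    have R2: "RR (?z \<omega>) / AA \<le> \<delta> / AA" using R\<delta> A0 by (intro divide_right_mono) auto
    have "RR (?z \<omega>) / AA \<le> \<eta>" using R2 A2[of \<delta>] \<delta> \<eta>2 by linarith
    note near = near[OF h_near[unfolded h_def] this]
    then have "is_arg_min (F \<omega>) (\<lambda>\<psi>. \<psi> \<in> J) (fst (\<psi>h \<omega>), snd (\<psi>h \<omega>))" using am by simp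
    then have "\<bar>m - h\<bar> \<le> K0 * (RR (?z \<omega>) / AA)"
      using near unfolding h_def m_def by blast
    moreover have "K0 * (RR (?z \<omega>) / AA) \<le> K0 * (\<delta> / AA)" using R2 K0 by (rule mult_left_mono)
    ultimately have m: "\<bar>m - \<theta>\<^sub>0 * v\<^sub>0 - \<theta>\<^sub>0 * v\<^sub>0 * S \<omega> / AA\<bar> \<le> (K0 + c) * \<delta> / AA"
      using h1 by (simp add: distrib_right add_divide_distrib)
    define f where "f = m - \<theta>\<^sub>0 * v\<^sub>0 - \<theta>\<^sub>0 * v\<^sub>0 * S \<omega> / AA"
    have "sqrt (real n) / tau M \<theta>\<^sub>0 v\<^sub>0 Z w K n u = n / sqrt V"
      unfolding tau_def tau_sq_eq using n0 V0 by (simp add: real_sqrt_divide)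
    then have pre: "sqrt (real n) * wsum / (tau M \<theta>\<^sub>0 v\<^sub>0 Z w K n u * v\<^sub>0 * \<theta>\<^sub>0) = n * wsum / (sqrt V * v\<^sub>0 * \<theta>\<^sub>0)"
      by (simp add: divide_simps split: if_splits)
    have "?Y \<omega> = n * wsum / (sqrt V * v\<^sub>0 * \<theta>\<^sub>0) * (\<theta>\<^sub>0 * v\<^sub>0 * S \<omega> / AA + f)"
      unfolding pre by (simp add: f_def m_def mult.commute)
    also have "\<dots> = n * wsum / AA * (S \<omega> / sqrt V) + n * wsum / (sqrt V * v\<^sub>0 * \<theta>\<^sub>0) * f"
      using \<theta>\<^sub>0 v\<^sub>0 by (simp add: distrib_left mult_ac)
    finally have Y_eq: "?Y \<omega> = n * wsum / AA * (S \<omega> / sqrt V) + n * wsum / (sqrt V * v\<^sub>0 * \<theta>\<^sub>0) * f" .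
    \<comment> \<open>The first term comes from normalizing by \<open>n * wsum\<close> and not by
      the exact weight \<open>AA\<close>, a relative error of order 1 / n; the second is the
      deviation \<open>f\<close> of the product from its linearization.\<close>
    have "?Y \<omega> - S \<omega> / sqrt V = (n * wsum / AA - 1) * (S \<omega> / sqrt V) + n * wsum / (sqrt V * v\<^sub>0 * \<theta>\<^sub>0) * f"
      unfolding Y_eq left_diff_distrib mult_1_left by (rule diff_add_eq[symmetric])
    then have "\<bar>?Y \<omega> - S \<omega> / sqrt V\<bar> \<le> \<bar>(n * wsum / AA - 1) * (S \<omega> / sqrt V)\<bar> + \<bar>n * wsum / (sqrt V * v\<^sub>0 * \<theta>\<^sub>0) * f\<bar>"
      by (simp only: abs_triangle_ineq)
    also have "\<bar>(n * wsum / AA - 1) * (S \<omega> / sqrt V)\<bar> \<le> 2 * K / n * \<delta>"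
      unfolding abs_mult
    proof (intro mult_mono)
      have "n * wsum / AA - 1 = (n * wsum - AA) / AA" using A0 by (simp add: diff_divide_distrib)
      then have "\<bar>n * wsum / AA - 1\<bar> = (n * wsum - AA) / AA" using A(3) A0 by (simp add: mult.commute)
      also have "\<dots> \<le> (K * wsum) / AA" using A(2) A0 by (intro divide_right_mono) (auto simp: algebra_simps)
      also have "\<dots> \<le> (K * wsum) * 2 / (wsum * n)" using wsum_pos by (intro A2) auto
      also have "\<dots> = 2 * K / n" using wsum_pos by simp
      finally show "\<bar>n * wsum / AA - 1\<bar> \<le> 2 * K / n" .
      show "\<bar>S \<omega> / sqrt V\<bar> \<le> \<delta>" using S\<delta> sV0 by (simp add: field_simps)
    qed auto
    also have "\<bar>n * wsum / (sqrt V * v\<^sub>0 * \<theta>\<^sub>0) * f\<bar> \<le> 2 * (K0 + c) * \<delta> / (w K * sqrt n * v\<^sub>0 * \<theta>\<^sub>0)"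
    proof -
      have "\<bar>n * wsum / (sqrt V * v\<^sub>0 * \<theta>\<^sub>0) * f\<bar> = n * wsum / (sqrt V * v\<^sub>0 * \<theta>\<^sub>0) * \<bar>f\<bar>"
        using wsum_pos \<theta>\<^sub>0 v\<^sub>0 V0 by (simp add: abs_mult)
      also have "\<dots> \<le> n * wsum / (sqrt V * v\<^sub>0 * \<theta>\<^sub>0) * ((K0 + c) * \<delta> * 2 / (wsum * n))"
        using m A2[of "(K0 + c) * \<delta>"] K0 c0 \<delta> wsum_pos \<theta>\<^sub>0 v\<^sub>0 V0 unfolding f_def
        by (intro mult_left_mono) auto
      also have "\<dots> = 2 * (K0 + c) * \<delta> / (sqrt V * (v\<^sub>0 * \<theta>\<^sub>0))"
      proof -
        have "p / D * (y * 2 / p) = 2 * y / D" if "p \<noteq> 0" for p D y :: real using that by simp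
        from this[of "n * wsum"] show ?thesis
          using wsum_pos n0 unfolding mult.commute[of wsum] by (simp only: mult.assoc) simp
      qed
      also have "\<dots> \<le> 2 * (K0 + c) * \<delta> / (w K * sqrt n * (v\<^sub>0 * \<theta>\<^sub>0))"
        using sV sV0 wK n0 K0 c0 \<delta> \<theta>\<^sub>0 v\<^sub>0 by (intro divide_left_mono mult_right_mono mult_pos_pos) auto
      finally show ?thesis by (simp add: mult.assoc)
    qed
    finally show ?thesis by simp
  qed
  have \<psi>[measurable]: "\<psi>h \<in> borel_measurable M" using est by (simp add: argmin_estimator_def)
  have fs[measurable]: "(\<lambda>\<omega>. fst (\<psi>h \<omega>)) \<in> borel_measurable M" "(\<lambda>\<omega>. snd (\<psi>h \<omega>)) \<in> borel_measurable M"
    by (auto intro!: measurable_compose[OF \<psi>] borel_measurable_continuous_onI continuous_intros)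
  have "AE \<omega> in M. \<omega> \<in> E \<longrightarrow> \<bar>?Y \<omega> - S \<omega> / sqrt V\<bar> \<le> ?b"
    using est key unfolding argmin_estimator_def by (auto elim!: eventually_mono)
  then have "cmod (char (distr M borel ?Y) t - char (distr M borel (\<lambda>\<omega>. S \<omega> / sqrt V)) t)
      \<le> \<bar>t\<bar> * ?b + 2 * prob (space M - E)"
    by (intro char_diff_le E b0) measurable
  also have "\<dots> \<le> \<bar>t\<bar> * ?b + 2 * (e / \<delta> + 1 / \<delta>\<^sup>2)" using PE by simp
  finally have 1: "cmod (char (distr M borel ?Y) t - char (distr M borel (\<lambda>\<omega>. S \<omega> / sqrt V)) t)
      \<le> \<bar>t\<bar> * ?b + 2 * (e / \<delta> + 1 / \<delta>\<^sup>2)" .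
  have "cmod (char (distr M borel (\<lambda>\<omega>. S \<omega> / sqrt V)) t - complex_of_real (exp (- t\<^sup>2 / 2)))
     \<le> 3 * (4 * real K + 1)\<^sup>2 * (n * (\<kappa> / sqrt V)^3) * \<bar>t\<bar>^3"
    by (rule chf_S_bound[OF V0])
  also have "\<dots> \<le> 3 * (4 * real K + 1)\<^sup>2 * (\<kappa>^3 / (w K ^ 3 * sqrt n)) * \<bar>t\<bar>^3"
  proof (intro mult_right_mono mult_left_mono)
    have "n * (\<kappa> / sqrt V)^3 \<le> n * (\<kappa> / (w K * sqrt n))^3"
      using sV sV0 wK n0 \<kappa>_ge_1 by (intro mult_left_mono power_mono divide_left_mono mult_pos_pos) auto
    also have "\<dots> = \<kappa>^3 / (w K ^ 3 * sqrt n)"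
    proof -
      have "(sqrt n)^3 = n * sqrt n" using n0 by (simp add: power3_eq_cube)
      then show ?thesis using n0 by (simp add: power_divide power_mult_distrib)
    qed
    finally show "n * (\<kappa> / sqrt V)^3 \<le> \<kappa>^3 / (w K ^ 3 * sqrt n)" .
  qed auto
  finally have 2: "cmod (char (distr M borel (\<lambda>\<omega>. S \<omega> / sqrt V)) t - complex_of_real (exp (- t\<^sup>2 / 2)))
     \<le> 3 * (4 * real K + 1)\<^sup>2 * (\<kappa>^3 / (w K ^ 3 * sqrt n)) * \<bar>t\<bar>^3" .
  show ?thesis using norm_triangle_le_diff[OF order_refl] 1 2
    by (smt (verit) norm_diff_triangle_le)
qed

end

section \<open>Minimizers close to the explicit statistic, for each parameter set\<close>

context ou_sample
begin

text \<open>The interface between analysis and probability: it concerns a single path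
  \<open>z\<close>, and the existence of a minimizer is part of the conclusion.\<close>

definition arg_min_near ::
  "(real \<times> real \<Rightarrow> real) \<Rightarrow> (real \<times> real) set \<Rightarrow> real \<Rightarrow> real \<Rightarrow> (real \<Rightarrow> real) \<Rightarrow> bool" where
  "arg_min_near F J K0 \<eta> z \<longleftrightarrow> (\<bar>HH z / AA - \<theta>\<^sub>0 * v\<^sub>0\<bar> \<le> \<eta> \<longrightarrow> RR z / AA \<le> \<eta> \<longrightarrow>
      (\<exists>\<psi>. is_arg_min F (\<lambda>\<psi>. \<psi> \<in> J) \<psi>) \<and>
      (\<forall>\<theta> v. is_arg_min F (\<lambda>\<psi>. \<psi> \<in> J) (\<theta>, v) \<longrightarrow> \<bar>\<theta> * v - HH z / AA\<bar> \<le> K0 * (RR z / AA)))"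

lemma is_arg_min_pcl:
  assumes "K < n" "J \<subseteq> {0<..} \<times> {0<..}"
  shows "is_arg_min (pcl w n u z) (\<lambda>\<psi>. \<psi> \<in> J) \<psi> \<longleftrightarrow>
    is_arg_min (\<lambda>\<psi>. gg z (fst \<psi>) (snd \<psi>)) (\<lambda>\<psi>. \<psi> \<in> J) \<psi>"
proof (rule is_arg_min_double)
  fix \<psi> assume "\<psi> \<in> J"
  then have "0 < fst \<psi>" "0 < snd \<psi>" using assms(2) by auto
  from pcl_eq[OF assms(1) this] show "pcl w n u z \<psi> = 2 * gg z (fst \<psi>) (snd \<psi>)" by simp
qed

lemma continuous_on_pl_correction: "continuous_on {0<..} (\<lambda>v. AA * ln v + B / v)"
  by (auto intro!: continuous_intros)

lemma near_pl_rectangle: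
  assumes n: "K < n" and J: "0 < a" "a \<le> b" "0 < c" "c \<le> d"
    and \<eta>: "a * d < \<theta>\<^sub>0 * v\<^sub>0 - \<eta>" "\<theta>\<^sub>0 * v\<^sub>0 + \<eta> < b * c"
  shows "arg_min_near (pl w n u z) ({a..b} \<times> {c..d}) (2 * b\<^sup>2 * d + b + b\<^sup>2) \<eta> z"
proof -
  interpret pd: pair_data Q wq dq "Dq z" "Bq z" by (rule pair_data_Q[OF n])
  show ?thesis
    unfolding arg_min_near_def
  proof (intro impI)
    assume "\<bar>HH z / AA - \<theta>\<^sub>0 * v\<^sub>0\<bar> \<le> \<eta>"
    then have "a * d < HH z / AA" "HH z / AA < b * c" using \<eta> by linarith+
    note am = pd.arg_min_rectangle_perturbed[OF pl_eq[OF n] continuous_on_pl_correction J this]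
    show "(\<exists>\<psi>. is_arg_min (pl w n u z) (\<lambda>\<psi>. \<psi> \<in> {a..b} \<times> {c..d}) \<psi>) \<and>
      (\<forall>\<theta> v. is_arg_min (pl w n u z) (\<lambda>\<psi>. \<psi> \<in> {a..b} \<times> {c..d}) (\<theta>, v) \<longrightarrow>
        \<bar>\<theta> * v - HH z / AA\<bar> \<le> (2 * b\<^sup>2 * d + b + b\<^sup>2) * (RR z / AA))"
      using am unfolding pd.K_def by blast
  qed
qed

lemma near_pcl_rectangle:
  assumes n: "K < n" and J: "0 < a" "a \<le> b" "0 < c" "c \<le> d"
    and \<eta>: "a * c < \<theta>\<^sub>0 * v\<^sub>0 - \<eta>" "\<theta>\<^sub>0 * v\<^sub>0 + \<eta> < b * d"
  shows "arg_min_near (pcl w n u z) ({a..b} \<times> {c..d}) (2 * b\<^sup>2 * d + b + b\<^sup>2) \<eta> z"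
proof -
  interpret pd: pair_data Q wq dq "Dq z" "Bq z" by (rule pair_data_Q[OF n])
  have "{a..b} \<times> {c..d} \<subseteq> {0<..} \<times> {0<..}" using J by auto
  note eq = is_arg_min_pcl[OF n this]
  show ?thesis
    unfolding arg_min_near_def eq
  proof (intro impI)
    assume "\<bar>HH z / AA - \<theta>\<^sub>0 * v\<^sub>0\<bar> \<le> \<eta>"
    then have "a * c < HH z / AA" "HH z / AA < b * d" using \<eta> by linarith+
    note am = pd.arg_min_rectangle[OF _ J this, where F="\<lambda>\<psi>. gg z (fst \<psi>) (snd \<psi>)", simplified fst_conv snd_conv, OF refl]
    show "(\<exists>\<psi>. is_arg_min (\<lambda>\<psi>. gg z (fst \<psi>) (snd \<psi>)) (\<lambda>\<psi>. \<psi> \<in> {a..b} \<times> {c..d}) \<psi>) \<and>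
      (\<forall>\<theta> v. is_arg_min (\<lambda>\<psi>. gg z (fst \<psi>) (snd \<psi>)) (\<lambda>\<psi>. \<psi> \<in> {a..b} \<times> {c..d}) (\<theta>, v) \<longrightarrow>
        \<bar>\<theta> * v - HH z / AA\<bar> \<le> (2 * b\<^sup>2 * d + b + b\<^sup>2) * (RR z / AA))"
      using am unfolding pd.K_def by blast
  qed
qed

text \<open>The analysis asks only for a positive \<open>H\<close>, so any \<eta> below the true
  product is admissible.\<close>

lemma near_pcl_profile:
  assumes n: "K < n" and J: "0 < a" "a \<le> b" and \<eta>: "\<eta> < \<theta>\<^sub>0 * v\<^sub>0"
  shows "arg_min_near (pcl w n u z) ({a..b} \<times> {0<..}) (b + b\<^sup>2) \<eta> z"
proof -
  interpret pd: pair_data Q wq dq "Dq z" "Bq z" by (rule pair_data_Q[OF n])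
  have "{a..b} \<times> {0<..} \<subseteq> {0<..} \<times> {0<..}" using J by auto
  note eq = is_arg_min_pcl[OF n this]
  show ?thesis
    unfolding arg_min_near_def eq
  proof (intro impI)
    assume "\<bar>HH z / AA - \<theta>\<^sub>0 * v\<^sub>0\<bar> \<le> \<eta>"
    then have "0 < HH z / AA" using \<eta> by linarith
    then have H: "0 < HH z" using pd.A_pos by (simp add: zero_less_divide_iff)
    have C: "0 < pd.C \<theta>" if "0 < \<theta>" for \<theta> using pd.C_pos[OF H that] .
    note am = pd.arg_min_profile[OF _ J C, where F="\<lambda>\<psi>. gg z (fst \<psi>) (snd \<psi>)", simplified fst_conv snd_conv, OF refl]
    show "(\<exists>\<psi>. is_arg_min (\<lambda>\<psi>. gg z (fst \<psi>) (snd \<psi>)) (\<lambda>\<psi>. \<psi> \<in> {a..b} \<times> {0<..}) \<psi>) \<and>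
      (\<forall>\<theta> v. is_arg_min (\<lambda>\<psi>. gg z (fst \<psi>) (snd \<psi>)) (\<lambda>\<psi>. \<psi> \<in> {a..b} \<times> {0<..}) (\<theta>, v) \<longrightarrow>
        \<bar>\<theta> * v - HH z / AA\<bar> \<le> (b + b\<^sup>2) * (RR z / AA))"
      using am by blast
  qed
qed

text \<open>\<open>H / A\<close> is confined between half and twice the true product, whence the
  first condition on \<eta> and the inner factor 2 in \<beta>. The second condition turns
  \<open>RR z / AA \<le> \<eta>\<close> into the smallness of \<open>R\<close> relative to
  \<open>A\<close> needed in the strip.\<close>

lemma near_strip:
  assumes n: "K < n" and J: "0 < c" "c \<le> d"
    and \<beta>: "\<beta> = exp 2 * (2 * (\<theta>\<^sub>0 * v\<^sub>0)) / c"
    and \<eta>: "\<eta> \<le> \<theta>\<^sub>0 * v\<^sub>0 / 2" "(2 * \<beta> + 1 / (2 * c) + \<beta> / (2 * c)) * \<eta> < 1"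
  shows "arg_min_near (pl w n u z) ({0<..} \<times> {c..d}) (2 * \<beta>\<^sup>2 * d + \<beta> + \<beta>\<^sup>2) \<eta> z"
    and "arg_min_near (pcl w n u z) ({0<..} \<times> {c..d}) (2 * \<beta>\<^sup>2 * d + \<beta> + \<beta>\<^sup>2) \<eta> z"
proof -
  interpret pd: pair_data Q wq dq "Dq z" "Bq z" by (rule pair_data_Q[OF n])
  have "{0<..} \<times> {c..d} \<subseteq> {0<..} \<times> {0<..}" using J by auto
  note eq = is_arg_min_pcl[OF n this]
  have h0: "0 < \<theta>\<^sub>0 * v\<^sub>0" using \<theta>\<^sub>0 v\<^sub>0 by simp
  have \<beta>0: "0 < \<beta>" using h0 J by (simp add: \<beta>)
  have near: "(\<exists>\<psi>. is_arg_min F (\<lambda>\<psi>. \<psi> \<in> {0<..} \<times> {c..d}) \<psi>) \<and>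
      (\<forall>\<theta> v. is_arg_min F (\<lambda>\<psi>. \<psi> \<in> {0<..} \<times> {c..d}) (\<theta>, v) \<longrightarrow>
        \<bar>\<theta> * v - HH z / AA\<bar> \<le> (2 * \<beta>\<^sup>2 * d + \<beta> + \<beta>\<^sup>2) * (RR z / AA))"
    if F: "\<And>\<theta> v. 0 < \<theta> \<Longrightarrow> 0 < v \<Longrightarrow> F (\<theta>, v) = gg z \<theta> v + f v" and f: "continuous_on {0<..} f"
      and h: "\<bar>HH z / AA - \<theta>\<^sub>0 * v\<^sub>0\<bar> \<le> \<eta>" and R: "RR z / AA \<le> \<eta>" for F f
  proof -
    have h': "0 < \<theta>\<^sub>0 * v\<^sub>0 / 2" "\<theta>\<^sub>0 * v\<^sub>0 / 2 \<le> HH z / AA" "HH z / AA \<le> 2 * (\<theta>\<^sub>0 * v\<^sub>0)"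
      using h \<eta>(1) h0 by linarith+
    let ?q = "2 * \<beta> + 1 / (2 * c) + \<beta> / (2 * c)"
    have q: "0 < ?q" using \<beta>0 J by (intro add_pos_pos) auto
    have "RR z \<le> \<eta> * AA" using R pd.A_pos by (simp add: pos_divide_le_eq)
    then have "?q * RR z \<le> ?q * (\<eta> * AA)" using q by (intro mult_left_mono) auto
    also have "\<dots> = (?q * \<eta>) * AA" by (simp only: mult.assoc)
    also have "\<dots> < 1 * AA" using \<eta>(2) pd.A_pos by (intro mult_strict_right_mono)
    finally have "?q * RR z < AA" by simp
    note am = pd.arg_min_strip[OF F f J h' \<beta> this]
    show ?thesis using am unfolding pd.K_def by blast
  qed
  show "arg_min_near (pl w n u z) ({0<..} \<times> {c..d}) (2 * \<beta>\<^sup>2 * d + \<beta> + \<beta>\<^sup>2) \<eta> z"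
    unfolding arg_min_near_def using near[OF pl_eq[OF n] continuous_on_pl_correction] by blast
  show "arg_min_near (pcl w n u z) ({0<..} \<times> {c..d}) (2 * \<beta>\<^sup>2 * d + \<beta> + \<beta>\<^sup>2) \<eta> z"
    unfolding arg_min_near_def eq
    using near[of "\<lambda>\<psi>. gg z (fst \<psi>) (snd \<psi>)" "\<lambda>_. 0"] by simp
qed

end

section \<open>The limit along the triangular array\<close>

locale ou_array = ou M \<theta>\<^sub>0 v\<^sub>0 Z for M :: "'a measure" and \<theta>\<^sub>0 v\<^sub>0 Z +
  fixes w :: "nat \<Rightarrow> real" and K :: nat and s :: "nat \<Rightarrow> nat \<Rightarrow> real"
  assumes w: "\<And>k. 1 \<le> k \<Longrightarrow> 0 \<le> w k" and K: "1 \<le> K" and wK: "0 < w K" and w_gt_K: "\<And>k. K < k \<Longrightarrow> w k = 0"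
    and s: "\<And>n i. i \<in> {1..n} \<Longrightarrow> s n i \<in> {0..1}" and mono: "\<And>n. strict_mono_on {1..n} (s n)"
begin

sublocale os: ou_sample M \<theta>\<^sub>0 v\<^sub>0 Z w K n "s n" for n
  by unfold_locales (use w K wK w_gt_K s mono in auto)

text \<open>Contrast and parameter set enter only through \<open>near\<close>, so this covers every
  case of the theorem. The row-wise bound on characteristic functions tends to 0 for each t, and
  Levy's continuity theorem concludes.\<close>

lemma estimator_clt:
  assumes near: "\<And>n \<omega>. K < n \<Longrightarrow> os.arg_min_near n (F n \<omega>) J K0 \<eta> (\<lambda>t. Z t \<omega>)"
    and \<eta>: "0 < \<eta>" and K0: "0 \<le> K0" and est: "\<And>n. argmin_estimator M J (F n) (\<psi>h n)"
  shows "converges_in_dist_std_normal M (\<lambda>n \<omega>.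
          sqrt (real n) * (\<Sum>k=1..K. w k) / (tau M \<theta>\<^sub>0 v\<^sub>0 Z w K n (s n) * v\<^sub>0 * \<theta>\<^sub>0) *
          (snd (\<psi>h n \<omega>) * fst (\<psi>h n \<omega>) - v\<^sub>0 * \<theta>\<^sub>0))"
    (is "converges_in_dist_std_normal M ?Y")
proof -
  define ws where "ws = (\<Sum>k=1..K. w k)"
  have ws: "os.wsum = ws" by (simp add: os.wsum_def ws_def)
  have ws0: "0 < ws" using os.wsum_pos by (simp add: ws)
  \<comment> \<open>The common value of \<kappa> in all rows, which makes the bounds uniform in
    n.\<close>
  define ka where "ka = 1 + 16 * real K * ws^3"
  have ka: "os.\<kappa> = ka" by (simp add: os.\<kappa>_def ws ka_def)
  have ka0: "0 < ka" using ws0 by (simp add: ka_def add_pos_nonneg)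
  define c where "c = 2 * \<theta>\<^sub>0 + \<theta>\<^sub>0\<^sup>2"
  define e where "e = (1 + 3 * v\<^sub>0 + 2 * \<theta>\<^sub>0 * v\<^sub>0) * (real K * ws)"
  \<comment> \<open>Any \<delta> with \<delta> \<rightarrow> \<infinity> and \<delta> / sqrt n
    \<rightarrow> 0 would do: the former makes the exceptional event unlikely, the latter removes
    the error and brings \<open>H / A\<close> into the neighbourhood given by \<eta>.\<close>
  define \<delta> where "\<delta> n = real n powr (1 / 4)" for n
  have lim1: "(\<lambda>n. \<delta> n / n) \<longlonglongrightarrow> 0" and lim2: "(\<lambda>n. \<delta> n / sqrt n) \<longlonglongrightarrow> 0"
    and lim3: "(\<lambda>n. 1 / \<delta> n) \<longlonglongrightarrow> 0" and lim4: "(\<lambda>n. 1 / (\<delta> n)\<^sup>2) \<longlonglongrightarrow> 0"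
    and lim5: "(\<lambda>n::nat. 1 / sqrt n) \<longlonglongrightarrow> 0"
    unfolding \<delta>_def by real_asymp+
  define q where "q = real (2 * K + 1) * ka"
  have "(\<lambda>n. \<theta>\<^sub>0 * v\<^sub>0 * sqrt q * 2 / ws * (\<delta> n / sqrt n) + c * 2 / ws * (\<delta> n / n)) \<longlonglongrightarrow>
      \<theta>\<^sub>0 * v\<^sub>0 * sqrt q * 2 / ws * 0 + c * 2 / ws * 0"
    by (intro tendsto_intros lim1 lim2)
  then have ev1: "\<forall>\<^sub>F n in sequentially.
      \<theta>\<^sub>0 * v\<^sub>0 * sqrt q * 2 / ws * (\<delta> n / sqrt n) + c * 2 / ws * (\<delta> n / n) < \<eta>"
    using \<eta> by (intro order_tendstoD(2)) auto
  have "(\<lambda>n. 2 / ws * (\<delta> n / n)) \<longlonglongrightarrow> 2 / ws * 0"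
    by (intro tendsto_intros lim1)
  then have ev2: "\<forall>\<^sub>F n in sequentially. 2 / ws * (\<delta> n / n) < \<eta>"
    using \<eta> by (intro order_tendstoD(2)) auto
  have \<psi>: "\<psi>h n \<in> borel_measurable M" for n using est[of n] by (simp add: argmin_estimator_def)
  have fs[measurable]: "(\<lambda>\<omega>. fst (\<psi>h n \<omega>)) \<in> borel_measurable M" "(\<lambda>\<omega>. snd (\<psi>h n \<omega>)) \<in> borel_measurable M" for n
    by (auto intro!: measurable_compose[OF \<psi>] borel_measurable_continuous_onI continuous_intros)
  have Y: "?Y n \<in> borel_measurable M" for n by measurable
  define bd where "bd t n = \<bar>t\<bar> * (2 * real K * (\<delta> n / n) + 2 * (K0 + c) / (w K * v\<^sub>0 * \<theta>\<^sub>0) * (\<delta> n / sqrt n))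
      + 2 * (e * (1 / \<delta> n) + 1 / (\<delta> n)\<^sup>2) + 3 * (4 * real K + 1)\<^sup>2 * (ka^3 / w K ^ 3) * \<bar>t\<bar>^3 * (1 / sqrt n)" for t and n :: nat
  have chf: "(\<lambda>n. char (distr M borel (?Y n)) t) \<longlonglongrightarrow> char std_normal_distribution t" for t
  proof -
    have "(\<lambda>n. char (distr M borel (?Y n)) t - complex_of_real (exp (- t\<^sup>2 / 2))) \<longlonglongrightarrow> 0"
    proof (rule Lim_null_comparison)
      have "bd t \<longlonglongrightarrow> \<bar>t\<bar> * (2 * real K * 0 + 2 * (K0 + c) / (w K * v\<^sub>0 * \<theta>\<^sub>0) * 0)
        + 2 * (e * 0 + 0) + 3 * (4 * real K + 1)\<^sup>2 * (ka^3 / w K ^ 3) * \<bar>t\<bar>^3 * 0"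
        unfolding bd_def by (intro tendsto_intros lim1 lim2 lim3 lim4 lim5)
      then show "bd t \<longlonglongrightarrow> 0" by simp
      show "\<forall>\<^sub>F n in sequentially. cmod (char (distr M borel (?Y n)) t - complex_of_real (exp (- t\<^sup>2 / 2))) \<le> bd t n"
        using ev1 ev2 eventually_ge_at_top[of "2 * K"]
      proof eventually_elim
        case (elim n)
        then have n0: "0 < n" using K by simp
        have Kn: "K < n" using elim(3) K by simp
        have \<delta>0: "0 < \<delta> n" using n0 by (simp add: \<delta>_def)
        have sq: "sqrt n * sqrt n = n" by simp
        have \<eta>1: "(\<theta>\<^sub>0 * v\<^sub>0 * sqrt (real (2 * K + 1) * ka * real n) + c) * \<delta> n * 2 / (ws * real n) \<le> \<eta>"
        proof -
          have "sqrt (real n) / n = 1 / sqrt n" using n0 by (simp add: field_simps)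
          then have "sqrt (real (2 * K + 1) * ka * real n) / real n = sqrt q / sqrt n"
            unfolding q_def[symmetric] real_sqrt_mult[of q] by (metis times_divide_eq_right mult.right_neutral)
          then have "(\<theta>\<^sub>0 * v\<^sub>0 * sqrt (real (2 * K + 1) * ka * real n) + c) * \<delta> n * 2 / (ws * real n)
            = \<theta>\<^sub>0 * v\<^sub>0 * (sqrt q / sqrt n) * \<delta> n * 2 / ws + c * \<delta> n * 2 / (ws * n)"
            by (simp add: distrib_right add_divide_distrib) (metis (no_types, opaque_lifting) times_divide_eq_right times_divide_times_eq mult.commute mult.left_commute)
          also have "\<dots> = \<theta>\<^sub>0 * v\<^sub>0 * sqrt q * 2 / ws * (\<delta> n / sqrt n) + c * 2 / ws * (\<delta> n / n)"
            by (simp add: mult_ac)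
          finally show ?thesis using elim(1) by simp
        qed
        have \<eta>2: "\<delta> n * 2 / (ws * real n) \<le> \<eta>" using elim(2) by (simp add: mult.commute)
        have "cmod (char (distr M borel (?Y n)) t - complex_of_real (exp (- t\<^sup>2 / 2)))
          \<le> \<bar>t\<bar> * (2 * K / n * \<delta> n + 2 * (K0 + c) * \<delta> n / (w K * sqrt n * v\<^sub>0 * \<theta>\<^sub>0)) + 2 * (e / \<delta> n + 1 / (\<delta> n)\<^sup>2)
            + 3 * (4 * real K + 1)\<^sup>2 * (ka^3 / (w K ^ 3 * sqrt n)) * \<bar>t\<bar>^3"
          using os.chf_estimator_bound[where n=n and F="F n" and \<eta>=\<eta> and J=J and \<psi>h="\<psi>h n" and \<delta>="\<delta> n" and t=t, unfolded ws ka, folded c_def e_def ws_def,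
              OF elim(3) _ est \<delta>0 K0 \<eta>1 \<eta>2] near[OF Kn]
          unfolding os.arg_min_near_def ws_def by blast
        also have "\<dots> = bd t n" by (simp add: bd_def mult_ac)
        finally show "cmod (char (distr M borel (?Y n)) t - complex_of_real (exp (- t\<^sup>2 / 2))) \<le> bd t n" .
      qed
    qed
    then have "(\<lambda>n. char (distr M borel (?Y n)) t) \<longlonglongrightarrow> complex_of_real (exp (- t\<^sup>2 / 2))"
      by (rule LIM_zero_cancel)
    then show ?thesis by (simp add: char_std_normal_distribution)
  qed
  show ?thesis
    unfolding converges_in_dist_std_normal_def
    by (rule levy_continuity[OF real_distribution_distr[OF Y] real_dist_normal_dist chf])
qed

end

text \<open>For rectangles the inequalities are strict because the limit is two-sided: if
  \<open>a * c\<close> were equal to \<open>\<theta>\<^sub>0 * v\<^sub>0\<close>, no point of the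
  rectangle would have a smaller product, and the normalized error could not become standard normal.
  In both parts strictness leaves a neighbourhood of the true product in which \<open>H / A\<close>
  may fluctuate.\<close>

theorem theorem3:
  fixes M :: "'a measure" and Z :: "real \<Rightarrow> 'a \<Rightarrow> real"
    and \<theta>\<^sub>0 v\<^sub>0 a b c d :: real
    and s :: "nat \<Rightarrow> nat \<Rightarrow> real" and w :: "nat \<Rightarrow> real" and K :: nat
  assumes "0 < \<theta>\<^sub>0" and "0 < v\<^sub>0"
    and "OU_process M \<theta>\<^sub>0 v\<^sub>0 Z"
    and "\<And>n i. i \<in> {1..n} \<Longrightarrow> s n i \<in> {0..1}"
    and "\<And>n. strict_mono_on {1..n} (s n)"
    and "(\<lambda>n. Max ((\<lambda>i. s n (i + 1) - s n i) ` {1..n-1})) \<longlonglongrightarrow> 0"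
    and "\<And>k. 1 \<le> k \<Longrightarrow> 0 \<le> w k"
    and "\<exists>k\<ge>1. w k \<noteq> 0"
    and "finite {k. 1 \<le> k \<and> w k \<noteq> 0}"
    and "K = Max {k. 1 \<le> k \<and> w k \<noteq> 0}"
    and "0 < a" and "a \<le> b" and "0 < c" and "c \<le> d"
  shows
    "(\<forall>J \<psi>h.
        (J = {a..b} \<times> {c..d} \<and> a * d < \<theta>\<^sub>0 * v\<^sub>0 \<and> \<theta>\<^sub>0 * v\<^sub>0 < b * c \<or>
         J = {0<..} \<times> {c..d}) \<longrightarrow>
        (\<exists>\<theta> v. (\<theta>, v) \<in> J \<and> \<theta> * v = \<theta>\<^sub>0 * v\<^sub>0) \<longrightarrow>
        (\<forall>n. argmin_estimator M J (\<lambda>\<omega>. pl w n (s n) (\<lambda>t. Z t \<omega>)) (\<psi>h n)) \<longrightarrow>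
        converges_in_dist_std_normal M (\<lambda>n \<omega>.
          sqrt (real n) * (\<Sum>k=1..K. w k) / (tau M \<theta>\<^sub>0 v\<^sub>0 Z w K n (s n) * v\<^sub>0 * \<theta>\<^sub>0) *
          (snd (\<psi>h n \<omega>) * fst (\<psi>h n \<omega>) - v\<^sub>0 * \<theta>\<^sub>0))) \<and>
     (\<forall>J \<psi>h.
        (J = {a..b} \<times> {c..d} \<and> a * c < \<theta>\<^sub>0 * v\<^sub>0 \<and> \<theta>\<^sub>0 * v\<^sub>0 < b * d \<or>
         J = {a..b} \<times> {0<..} \<or>
         J = {0<..} \<times> {c..d}) \<longrightarrow>
        (\<exists>\<theta> v. (\<theta>, v) \<in> J \<and> \<theta> * v = \<theta>\<^sub>0 * v\<^sub>0) \<longrightarrow>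
        (\<forall>n. argmin_estimator M J (\<lambda>\<omega>. pcl w n (s n) (\<lambda>t. Z t \<omega>)) (\<psi>h n)) \<longrightarrow>
        converges_in_dist_std_normal M (\<lambda>n \<omega>.
          sqrt (real n) * (\<Sum>k=1..K. w k) / (tau M \<theta>\<^sub>0 v\<^sub>0 Z w K n (s n) * v\<^sub>0 * \<theta>\<^sub>0) *
          (snd (\<psi>h n \<omega>) * fst (\<psi>h n \<omega>) - v\<^sub>0 * \<theta>\<^sub>0)))"
proof -
  let ?S = "{k. 1 \<le> k \<and> w k \<noteq> 0}"
  have KS: "K \<in> ?S" unfolding assms(10) using assms(8,9) by (intro Max_in) auto
  have KM: "w k = 0" if "K < k" for k
  proof (rule ccontr)
    assume "w k \<noteq> 0"
    then have "k \<le> K" unfolding assms(10) using that assms(9) by (intro Max_ge) auto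
    then show False using that by simp
  qed
  interpret prob_space M using assms(3) by (simp add: OU_process_def)
  interpret ou_array M \<theta>\<^sub>0 v\<^sub>0 Z w K s
  proof
    show "0 < w K" using KS assms(7)[of K] by auto
  qed (use assms(1-5,7) KS KM in auto)
  let ?h = "\<theta>\<^sub>0 * v\<^sub>0"
  have h0: "0 < ?h" using assms by simp
  define \<beta> where "\<beta> = exp 2 * (2 * ?h) / c"
  have \<beta>0: "0 < \<beta>" using h0 assms by (simp add: \<beta>_def)
  define q where "q = 2 * \<beta> + 1 / (2 * c) + \<beta> / (2 * c)"
  have q0: "0 < q" unfolding q_def using \<beta>0 assms by (intro add_pos_pos) auto
  \<comment> \<open>One \<eta> for the strip in both parts: the first entry keeps
    \<open>H / A\<close> within a factor 2 of the true product, the second gives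
    \<open>q * \<eta>s \<le> 1 / 2\<close>.\<close>
  define \<eta>s where "\<eta>s = min (?h / 2) (1 / (2 * q))"
  have \<eta>s: "0 < \<eta>s" "\<eta>s \<le> ?h / 2" "q * \<eta>s < 1"
  proof -
    show "0 < \<eta>s" "\<eta>s \<le> ?h / 2" using h0 q0 by (auto simp: \<eta>s_def)
    have "q * \<eta>s \<le> q * (1 / (2 * q))" using q0 by (intro mult_left_mono) (auto simp: \<eta>s_def)
    then show "q * \<eta>s < 1" using q0 by simp
  qed
  note strip = os.near_strip[OF _ assms(13,14) \<beta>_def \<eta>s(2) \<eta>s(3)[unfolded q_def]]
  have K0: "0 \<le> 2 * x\<^sup>2 * d + x + x\<^sup>2" if "0 < x" for x using that assms by simp
  have b0: "0 < b" using assms by linarith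
  have gap: "\<exists>\<eta>>0. x < ?h - \<eta> \<and> ?h + \<eta> < y" if "x < ?h" "?h < y" for x y
    using that by (intro exI[of _ "min (?h - x) (y - ?h) / 2"]) (auto simp: min_def field_simps)
  show ?thesis
  proof (intro conjI allI impI)
    fix J \<psi>h
    assume J: "J = {a..b} \<times> {c..d} \<and> a * d < ?h \<and> ?h < b * c \<or> J = {0<..} \<times> {c..d}"
      and est: "\<forall>n. argmin_estimator M J (\<lambda>\<omega>. pl w n (s n) (\<lambda>t. Z t \<omega>)) (\<psi>h n)"
    from J show "converges_in_dist_std_normal M (\<lambda>n \<omega>.
          sqrt (real n) * (\<Sum>k=1..K. w k) / (tau M \<theta>\<^sub>0 v\<^sub>0 Z w K n (s n) * v\<^sub>0 * \<theta>\<^sub>0) *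
          (snd (\<psi>h n \<omega>) * fst (\<psi>h n \<omega>) - v\<^sub>0 * \<theta>\<^sub>0))"
    proof (elim disjE conjE)
      assume JJ: "J = {a..b} \<times> {c..d}" and g: "a * d < ?h" "?h < b * c"
      from gap[OF g] obtain \<eta> where \<eta>: "0 < \<eta>" "a * d < ?h - \<eta>" "?h + \<eta> < b * c" by auto
      show ?thesis
        unfolding JJ
        by (rule estimator_clt[where F="\<lambda>n \<omega>. pl w n (s n) (\<lambda>t. Z t \<omega>)",
              OF os.near_pl_rectangle[OF _ assms(11-14) \<eta>(2,3)] \<eta>(1) K0[OF b0] est[unfolded JJ, rule_format]])
    next
      assume JJ: "J = {0<..} \<times> {c..d}"
      show ?thesis
        unfolding JJ
        by (rule estimator_clt[where F="\<lambda>n \<omega>. pl w n (s n) (\<lambda>t. Z t \<omega>)",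
              OF strip(1) \<eta>s(1) K0[OF \<beta>0] est[unfolded JJ, rule_format]])
    qed
  next
    fix J \<psi>h
    assume J: "J = {a..b} \<times> {c..d} \<and> a * c < ?h \<and> ?h < b * d \<or> J = {a..b} \<times> {0<..} \<or> J = {0<..} \<times> {c..d}"
      and est: "\<forall>n. argmin_estimator M J (\<lambda>\<omega>. pcl w n (s n) (\<lambda>t. Z t \<omega>)) (\<psi>h n)"
    from J show "converges_in_dist_std_normal M (\<lambda>n \<omega>.
          sqrt (real n) * (\<Sum>k=1..K. w k) / (tau M \<theta>\<^sub>0 v\<^sub>0 Z w K n (s n) * v\<^sub>0 * \<theta>\<^sub>0) *
          (snd (\<psi>h n \<omega>) * fst (\<psi>h n \<omega>) - v\<^sub>0 * \<theta>\<^sub>0))"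
    proof (elim disjE conjE)
      assume JJ: "J = {a..b} \<times> {c..d}" and g: "a * c < ?h" "?h < b * d"
      from gap[OF g] obtain \<eta> where \<eta>: "0 < \<eta>" "a * c < ?h - \<eta>" "?h + \<eta> < b * d" by auto
      show ?thesis
        unfolding JJ
        by (rule estimator_clt[where F="\<lambda>n \<omega>. pcl w n (s n) (\<lambda>t. Z t \<omega>)",
              OF os.near_pcl_rectangle[OF _ assms(11-14) \<eta>(2,3)] \<eta>(1) K0[OF b0] est[unfolded JJ, rule_format]])
    next
      assume JJ: "J = {a..b} \<times> {0<..}"
      have \<eta>: "?h / 2 < ?h" "0 < ?h / 2" and bb: "0 \<le> b + b\<^sup>2" using h0 b0 by auto
      show ?thesis
        unfolding JJ
        by (rule estimator_clt[where F="\<lambda>n \<omega>. pcl w n (s n) (\<lambda>t. Z t \<omega>)",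
              OF os.near_pcl_profile[OF _ assms(11,12) \<eta>(1)] \<eta>(2) bb est[unfolded JJ, rule_format]])
    next
      assume JJ: "J = {0<..} \<times> {c..d}"
      show ?thesis
        unfolding JJ
        by (rule estimator_clt[where F="\<lambda>n \<omega>. pcl w n (s n) (\<lambda>t. Z t \<omega>)",
              OF strip(2) \<eta>s(1) K0[OF \<beta>0] est[unfolded JJ, rule_format]])
    qed
  qed
qed

end
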